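(* Let $\mathfrak g$ be a complex simple Lie algebra of classical type $X$ and rank $l$, and let $I\subset\Pi$ be of cardinality $r$. If $X=A_l$, then $\sharp\mathcal F_I=\mathcal C_{l-r+1}$. If $X=B_l$, then $$\sharp\mathcal F_I=(l-r+1)\,\mathcal C_{l-r}+\sum_{j=1}^{n}\mathcal T'_{2(l-r)-l_j,\;l_j-1},$$ where $n=s-1$ if $\alpha_l\in I$, and $n=s$ otherwise. If $X=C_l$, then $\sharp\mathcal F_I=(l-r+1)\,\mathcal C_{l-r}$ if $\alpha_l\notin I$, and $\sharp\mathcal F_I=\frac{l-r+2}{2}\,\mathcal C_{l-r+1}$ if $\alpha_l\in I$. If $X=D_l$, then: - if $\sharp(\{\alpha_{l-1},\alpha_l\}\cap I)=1$, $\displaystyle\sharp\mathcal F_I=\frac{l-r+1}{2}\,\mathcal C_{l-r}+\sum_{j=1}^{s}\mathcal T'_{2(l-r)-l_j-1,\;l_j-1}$; - if $\{\alpha_{l-1},\alpha_l\}\subset I$, $\displaystyle\sharp\mathcal F_I=(l-r+1)\,\mathcal C_{l-r}+\sum_{j=1}^{s-1}\mathcal T'_{2(l-r)-l_j,\;l_j-1}$; - otherwise (that is, if $\{\alpha_{l-1},\alpha_l\}\cap I=\emptyset$), $\displaystyle\sharp\mathcal F_I=(3(l-r)-2)\,\mathcal C_{l-r-1}+\sum_{j=1}^{s}\Big(\mathcal T'_{2(l-r)-l_j-1,\;l_j-2}+\mathcal T'_{2(l-r)-l_j-1,\;l_j-1}\Big)$.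
   Context: $\Delta$ is the root system of $\mathfrak g$ (with respect to a Cartan subalgebra $\mathfrak h$), $\mathfrak g_\alpha$ ($\alpha\in\Delta$) the root spaces, $\Delta^+$ the positive roots, $\Pi=\{\alpha_1,\dots,\alpha_l\}$ the simple roots, numbered in the standard way: $\alpha_1,\dots,\alpha_l$ along the diagram in types $A_l$, $B_l$ ($\alpha_l$ short), $C_l$ ($\alpha_l$ long); in type $D_l$ ($l\ge4$), $\alpha_1,\dots,\alpha_{l-2}$ form a chain and $\alpha_{l-1},\alpha_l$ are both joined to $\alpha_{l-2}$. For $I\subset\Pi$, $\Delta_I=\mathbb ZI\cap\Delta$, $\mathfrak p_I=\mathfrak h\oplus\bigoplus_{\alpha\in\Delta_I\cup\Delta^+}\mathfrak g_\alpha$, and $$\mathcal F_I=\{\Phi\subset\Delta^+\setminus\Delta_I:\ \alpha\in\Phi,\ \beta\in\Delta^+\cup\Delta_I,\ \alpha+\beta\in\Delta^+\Rightarrow\alpha+\beta\in\Phi\}.$$ The map $\Phi\mapsto\bigoplus_{\alpha\in\Phi}\mathfrak g_\alpha$ is a bijection from $\mathcal F_I$ to the set of ad-nilpotent ideals of $\mathfrak p_I$ (ideals $\mathfrak i$ with $\mathrm{ad}_{\mathfrak p_I}x$ nilpotent for all $x\in\mathfrak i$), so $\sharp\mathcal F_I$ is the number of such ideals. $\mathcal C_m=\frac1{m+1}\binom{2m}{m}$ is the $m$-th Catalan number. For integers $p,q$, $\mathcal T'_{p,q}=\frac{(p+q+1)!\,(p-q+2)}{q!\,(p+2)!}$ for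 $q\ge0$, and $\mathcal T'_{p,-1}=0$. $I_1,\dots,I_s$ are the connected components of $I$ (in the Dynkin diagram), $r_j=\sharp I_j$, $m_j=\min\{i:\alpha_i\in I_j\}$, ordered so that $m_1<\dots<m_s$ ($s=0$ if $I=\emptyset$). In type $B_l$, $l_j=m_j-\sum_{k=1}^{j-1}r_k$. In type $D_l$, $l_j=m_j-\sum_{k=1}^{j-1}r_k$, except that if $I_s=\{\alpha_l\}$ then $l_s=m_s-\sum_{k=1}^{s-1}r_k-1$.
   Formalization: In type D_l with α_{l-1}, α_l ∈ I but α_{l-2} ∉ I, the sum's upper limit s-1 is corrected to s-2, since {α_{l-1}} and {α_l} are then two components; as printed it fails, e.g. for D_4, I={α_3,α_4} it gives 8 instead of 6. *)

theory Defs
  imports Complex_Main "HOL-Library.Function_Algebras"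
begin

section \<open>Complex Lie algebras and their roots\<close>

locale lie_algebra = vector_space scale
  for scale :: "complex \<Rightarrow> 'g::ab_group_add \<Rightarrow> 'g" +
  fixes brk :: "'g \<Rightarrow> 'g \<Rightarrow> 'g"
  assumes brk_add_left: "brk (x + y) z = brk x z + brk y z"
    and brk_add_right: "brk x (y + z) = brk x y + brk x z"
    and brk_scale_left: "brk (scale c x) y = scale c (brk x y)"
    and brk_scale_right: "brk x (scale c y) = scale c (brk x y)"
    and brk_self: "brk x x = 0"
    and jacobi: "brk x (brk y z) + brk y (brk z x) + brk z (brk x y) = 0"
begin

definition lie_ideal :: "'g set \<Rightarrow> bool" where
  "lie_ideal J \<longleftrightarrow> subspace J \<and> (\<forall>x. \<forall>y\<in>J. brk x y \<in> J)"

definition lie_subalgebra :: "'g set \<Rightarrow> bool" where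
  "lie_subalgebra S \<longleftrightarrow> subspace S \<and> (\<forall>x\<in>S. \<forall>y\<in>S. brk x y \<in> S)"

primrec lower_central :: "'g set \<Rightarrow> nat \<Rightarrow> 'g set" where
  "lower_central S 0 = S"
| "lower_central S (Suc n) = span {brk x y | x y. x \<in> S \<and> y \<in> lower_central S n}"

definition nilpotent_subalgebra :: "'g set \<Rightarrow> bool" where
  "nilpotent_subalgebra S \<longleftrightarrow> lie_subalgebra S \<and> (\<exists>n. lower_central S n = {0})"

definition cartan_subalgebra :: "'g set \<Rightarrow> bool" where
  "cartan_subalgebra H \<longleftrightarrow> nilpotent_subalgebra H \<and> {x. \<forall>y\<in>H. brk x y \<in> H} = H"

text \<open>
  A linear form on \<open>H\<close> is represented by its extension by zero to the whole type, so that
  equality, addition and negation of forms are those of functions.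
\<close>
definition linear_forms :: "'g set \<Rightarrow> ('g \<Rightarrow> complex) set" where
  "linear_forms H = {f. (\<forall>x\<in>H. \<forall>y\<in>H. f (x + y) = f x + f y) \<and>
     (\<forall>c. \<forall>x\<in>H. f (scale c x) = c * f x) \<and> (\<forall>x. x \<notin> H \<longrightarrow> f x = 0)}"

definition root_space :: "'g set \<Rightarrow> ('g \<Rightarrow> complex) \<Rightarrow> 'g set" where
  "root_space H a = {x. \<forall>y\<in>H. brk y x = scale (a y) x}"

definition roots :: "'g set \<Rightarrow> ('g \<Rightarrow> complex) set" where
  "roots H = {a \<in> linear_forms H. a \<noteq> 0 \<and> root_space H a \<noteq> {0}}"

end

locale simple_lie_algebra = lie_algebra +
  assumes finite_dim: "\<exists>B. finite B \<and> span B = UNIV"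
    and non_abelian: "\<exists>x y. brk x y \<noteq> 0"
    and ideals_trivial: "lie_ideal J \<Longrightarrow> J = {0} \<or> J = UNIV"

section \<open>Simple and positive roots, types, the Dynkin diagram\<close>

text \<open>
  Below, \<open>D\<close> is a set of roots and \<open>P\<close> a set of simple roots, both consisting of complex-valued
  functions.
\<close>

definition pos_roots :: "('g \<Rightarrow> complex) set \<Rightarrow> ('g \<Rightarrow> complex) set \<Rightarrow> ('g \<Rightarrow> complex) set" where
  "pos_roots D P = {b \<in> D. \<exists>c :: ('g \<Rightarrow> complex) \<Rightarrow> nat. b = (\<lambda>v. \<Sum>a\<in>P. of_nat (c a) * a v)}"

definition sub_roots :: "('g \<Rightarrow> complex) set \<Rightarrow> ('g \<Rightarrow> complex) set \<Rightarrow> ('g \<Rightarrow> complex) set" where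
  "sub_roots D I = {b \<in> D. \<exists>c :: ('g \<Rightarrow> complex) \<Rightarrow> int. b = (\<lambda>v. \<Sum>a\<in>I. of_int (c a) * a v)}"

definition simple_system :: "('g \<Rightarrow> complex) set \<Rightarrow> ('g \<Rightarrow> complex) set \<Rightarrow> bool" where
  "simple_system D P \<longleftrightarrow> finite P \<and> P \<subseteq> D \<and>
     (\<forall>c :: ('g \<Rightarrow> complex) \<Rightarrow> complex. (\<forall>v. (\<Sum>a\<in>P. c a * a v) = 0) \<longrightarrow> (\<forall>a\<in>P. c a = 0)) \<and>
     (\<forall>b\<in>D. b \<in> pos_roots D P \<or> - b \<in> pos_roots D P)"

datatype classical_type = TypeA | TypeB | TypeC | TypeD

text \<open>\<open>C\<^sub>2\<close> and \<open>B\<^sub>2\<close> are both allowed: they are the same root system with the two simple roots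
  numbered differently.\<close>
fun rank_ok :: "classical_type \<Rightarrow> nat \<Rightarrow> bool" where
  "rank_ok TypeA l = (l \<ge> 1)"
| "rank_ok TypeB l = (l \<ge> 2)"
| "rank_ok TypeC l = (l \<ge> 2)"
| "rank_ok TypeD l = (l \<ge> 4)"

definition std_roots_D :: "nat \<Rightarrow> (nat \<Rightarrow> 'v::ab_group_add) \<Rightarrow> 'v set" where
  "std_roots_D l e =
     {e i - e j | i j. i \<in> {1..l} \<and> j \<in> {1..l} \<and> i \<noteq> j} \<union>
     {e i + e j | i j. i \<in> {1..l} \<and> j \<in> {1..l} \<and> i \<noteq> j} \<union>
     {- (e i + e j) | i j. i \<in> {1..l} \<and> j \<in> {1..l} \<and> i \<noteq> j}"

fun std_roots :: "classical_type \<Rightarrow> nat \<Rightarrow> (nat \<Rightarrow> 'v::ab_group_add) \<Rightarrow> 'v set" where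
  "std_roots TypeA l e = {e i - e j | i j. i \<in> {1..l+1} \<and> j \<in> {1..l+1} \<and> i \<noteq> j}"
| "std_roots TypeB l e = std_roots_D l e \<union> {e i | i. i \<in> {1..l}} \<union> {- e i | i. i \<in> {1..l}}"
| "std_roots TypeC l e =
     std_roots_D l e \<union> {e i + e i | i. i \<in> {1..l}} \<union> {- (e i + e i) | i. i \<in> {1..l}}"
| "std_roots TypeD l e = std_roots_D l e"

fun std_simple :: "classical_type \<Rightarrow> nat \<Rightarrow> (nat \<Rightarrow> 'v::ab_group_add) \<Rightarrow> nat \<Rightarrow> 'v" where
  "std_simple TypeA l e i = e i - e (i + 1)"
| "std_simple TypeB l e i = (if i = l then e l else e i - e (i + 1))"
| "std_simple TypeC l e i = (if i = l then e l + e l else e i - e (i + 1))"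
| "std_simple TypeD l e i = (if i = l then e (l - 1) + e l else e i - e (i + 1))"

text \<open>
  \<open>D\<close> is isomorphic to the standard root system of type \<open>X\<close> and rank \<open>l\<close>, and \<open>\<alpha> 1, \<dots>, \<alpha> l\<close>
  correspond to its simple roots in the standard numbering. The isomorphism is given by the
  images \<open>e i\<close> of the standard coordinate vectors. It is injective on the span of the roots
  as soon as the \<open>\<alpha> i\<close> are linearly independent, which \<open>simple_system\<close> requires.
\<close>
definition root_system_type ::
  "classical_type \<Rightarrow> nat \<Rightarrow> ('g \<Rightarrow> complex) set \<Rightarrow> (nat \<Rightarrow> 'g \<Rightarrow> complex) \<Rightarrow> bool" where
  "root_system_type X l D \<alpha> \<longleftrightarrow> rank_ok X l \<and>
     (\<exists>e. D = std_roots X l e \<and> (\<forall>i\<in>{1..l}. \<alpha> i = std_simple X l e i))"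

text \<open>
  The coroot of \<open>a\<close> is the only linear form \<open>f\<close> on the span of \<open>D\<close> with \<open>f a = 2\<close> whose reflection
  \<open>b \<mapsto> b - f b a\<close> preserves \<open>D\<close>. Here \<open>f\<close> is defined on all functions: outside the span of \<open>D\<close>
  it is not unique, but the Cartan integers only use its values on \<open>D\<close>.
\<close>
definition is_coroot ::
  "('g \<Rightarrow> complex) set \<Rightarrow> ('g \<Rightarrow> complex) \<Rightarrow> (('g \<Rightarrow> complex) \<Rightarrow> complex) \<Rightarrow> bool" where
  "is_coroot D a f \<longleftrightarrow>
     (\<forall>x y. f (x + y) = f x + f y) \<and> (\<forall>c x. f (\<lambda>v. c * x v) = c * f x) \<and>
     f a = 2 \<and> (\<forall>b\<in>D. (\<lambda>v. b v - f b * a v) \<in> D)"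

definition cartan_integer ::
  "('g \<Rightarrow> complex) set \<Rightarrow> ('g \<Rightarrow> complex) \<Rightarrow> ('g \<Rightarrow> complex) \<Rightarrow> complex" where
  "cartan_integer D b a = (THE c. \<exists>f. is_coroot D a f \<and> c = f b)"

definition dynkin_adjacent ::
  "('g \<Rightarrow> complex) set \<Rightarrow> ('g \<Rightarrow> complex) \<Rightarrow> ('g \<Rightarrow> complex) \<Rightarrow> bool" where
  "dynkin_adjacent D a b \<longleftrightarrow> a \<noteq> b \<and> cartan_integer D a b \<noteq> 0"

definition components :: "('g \<Rightarrow> complex) set \<Rightarrow> ('g \<Rightarrow> complex) set \<Rightarrow> ('g \<Rightarrow> complex) set set" where
  "components D I =
     I // {(a, b). a \<in> I \<and> b \<in> I \<and> (a, b) \<in> {(x, y). x \<in> I \<and> y \<in> I \<and> dynkin_adjacent D x y}\<^sup>*}"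

section \<open>The sets to be counted\<close>

definition F_sets ::
  "('g \<Rightarrow> complex) set \<Rightarrow> ('g \<Rightarrow> complex) set \<Rightarrow> ('g \<Rightarrow> complex) set \<Rightarrow> ('g \<Rightarrow> complex) set set" where
  "F_sets D P I = {F. F \<subseteq> pos_roots D P - sub_roots D I \<and>
     (\<forall>a\<in>F. \<forall>b \<in> pos_roots D P \<union> sub_roots D I. a + b \<in> pos_roots D P \<longrightarrow> a + b \<in> F)}"

section \<open>Numerical quantities\<close>

definition catalan :: "nat \<Rightarrow> real" where
  "catalan m = 1 / real (m + 1) * real (2 * m choose m)"

text \<open>Only meaningful for \<open>q \<ge> - 1\<close> and, if \<open>q \<ge> 0\<close>, for \<open>p \<ge> - 2\<close> and \<open>p + q \<ge> - 1\<close>, so that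
  all factorials are taken of natural numbers.\<close>
definition T' :: "int \<Rightarrow> int \<Rightarrow> real" where
  "T' p q = (if q = - 1 then 0
     else fact (nat (p + q + 1)) * of_int (p - q + 2) / (fact (nat q) * fact (nat (p + 2))))"

definition comp_min :: "(nat \<Rightarrow> 'r) \<Rightarrow> nat \<Rightarrow> 'r set \<Rightarrow> nat" where
  "comp_min \<alpha> l K = Min {i \<in> {1..l}. \<alpha> i \<in> K}"

definition ell_B :: "(nat \<Rightarrow> 'r) \<Rightarrow> nat \<Rightarrow> (nat \<Rightarrow> 'r set) \<Rightarrow> nat \<Rightarrow> int" where
  "ell_B \<alpha> l K j = int (comp_min \<alpha> l (K j)) - (\<Sum>k=1..<j. int (card (K k)))"

definition ell_D :: "(nat \<Rightarrow> 'r) \<Rightarrow> nat \<Rightarrow> nat \<Rightarrow> (nat \<Rightarrow> 'r set) \<Rightarrow> nat \<Rightarrow> int" where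
  "ell_D \<alpha> l s K j = int (comp_min \<alpha> l (K j)) - (\<Sum>k=1..<j. int (card (K k)))
     - (if j = s \<and> K s = {\<alpha> l} then 1 else 0)"

text \<open>
  The number of summands in type \<open>D\<^sub>l\<close> when both \<open>\<alpha> (l-1)\<close> and \<open>\<alpha> l\<close> belong to \<open>I\<close>: the sum is over
  the components containing neither of them. This is all but the last component if \<open>\<alpha> (l-2)\<close>
  belongs to \<open>I\<close>; otherwise \<open>{\<alpha> (l-1)}\<close> and \<open>{\<alpha> l}\<close> are two distinct components, and both are left
  out. With \<open>s - 1\<close> summands in the latter case the formula fails: for \<open>D\<^sub>4\<close> and \<open>I = {\<alpha> 3, \<alpha> 4}\<close> it
  would give 8, while there are 6 ideals.
\<close>
definition num_terms_D :: "(nat \<Rightarrow> 'r) \<Rightarrow> nat \<Rightarrow> 'r set \<Rightarrow> nat \<Rightarrow> nat" where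
  "num_terms_D \<alpha> l I s = (if \<alpha> (l - 2) \<in> I then s - 1 else s - 2)"

end

theory Submission
  imports Defs
begin

text \<open>
  All classical root systems consist of differences \<open>\<epsilon> i - \<epsilon> j\<close> of vectors \<open>\<epsilon> 1, \<dots>, \<epsilon> n\<close>, and the
  positive roots are those with \<open>i < j\<close>. In type \<open>A\<close> the vectors carry no further structure and
  \<open>n = l + 1\<close>. In the other types the index set is folded, \<open>\<epsilon> (n + 1 - i) = - \<epsilon> i\<close>, with \<open>n = 2l + 1\<close>
  (\<open>B\<close>, so that the middle vector is zero) or \<open>n = 2l\<close> (\<open>C\<close> and \<open>D\<close>); pairs with \<open>i + j = n + 1\<close> are
  roots only in type \<open>C\<close>. The simple roots in \<open>I\<close> glue neighbouring indices together and cut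
  \<open>{1..n}\<close> into consecutive blocks, numbered \<open>1, \<dots>, N\<close>. The roots of the Levi part are those with both
  indices in one block. An ideal is stable under adding them, so whether it contains a root only
  depends on the two blocks of the root.

  In type \<open>A\<close> this identifies the ideals with the order ideals of a staircase, which are counted by
  a Catalan number (\<open>card_F_sets_nonsymmetric\<close>). In the folded types a root is better written as a sum
  \<open>\<epsilon> a + \<epsilon> b\<close>, and the ideals become downward closed sets of cells \<open>(p, q)\<close> with \<open>p \<le> q\<close> and
  \<open>p + q \<le> N\<close>, the blocks of \<open>a\<close> and \<open>b\<close>. A diagonal cell \<open>(p, p)\<close> is only present if it carries a
  root, which in types \<open>B\<close> and \<open>D\<close> means that the block \<open>p\<close> has at least two elements
  (\<open>card_F_sets_symmetric\<close>).

  These order ideals are counted by the number \<open>k\<close> of cells \<open>(p, p + 1)\<close> that they contain. Fixing \<open>k\<close>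
  leaves a trapezoid of free cells, whose order ideals are counted by a ballot number, and in addition
  the diagonal cell \<open>(k + 1, k + 1)\<close> if it is present; every other diagonal cell is forced in or out. The
  ballot numbers add up to a central binomial coefficient, and each diagonal cell present contributes one
  more ballot number (\<open>card_downsets_shifted\<close>). The ballot numbers are the \<open>T'\<close> of the statement. Below the
  middle, the blocks with at least two elements correspond to components of \<open>I\<close>, and \<open>l\<^sub>j\<close> is the number of
  the block of \<open>I\<^sub>j\<close>; a component that reaches the middle block contributes no summand.

  Type \<open>D\<close> needs two further ideas. If neither \<open>\<alpha>\<^sub>l\<^sub>-\<^sub>1\<close> nor \<open>\<alpha>\<^sub>l\<close> lies in \<open>I\<close>, then the two middle indices
  are not comparable, since \<open>\<epsilon> l - \<epsilon> (l + 1)\<close> is not a root. Every ideal is nevertheless closed under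
  replacing \<open>l + 1\<close> by \<open>l\<close> or under replacing \<open>l\<close> by \<open>l + 1\<close>, and inclusion-exclusion reduces the count
  to cells of the previous kind (\<open>card_F_sets_fork\<close>). If \<open>\<alpha>\<^sub>l\<close> but not \<open>\<alpha>\<^sub>l\<^sub>-\<^sub>1\<close> lies in \<open>I\<close>, changing the
  sign of the last coordinate exchanges the two roots; this is where the correction \<open>- 1\<close> in the
  definition of \<open>l\<^sub>j\<close> comes from.
\<close>


section \<open>Counting order ideals of cells\<close>

definition cell_le :: "nat \<times> nat \<Rightarrow> nat \<times> nat \<Rightarrow> bool" where
  "cell_le x y \<longleftrightarrow> fst x \<le> fst y \<and> snd x \<le> snd y"

definition downsets :: "(nat \<times> nat) set \<Rightarrow> (nat \<times> nat) set set" where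
  "downsets P = {U. U \<subseteq> P \<and> (\<forall>x\<in>U. \<forall>y\<in>P. cell_le y x \<longrightarrow> y \<in> U)}"

lemma cell_le_refl [simp]: "cell_le x x"
  by (simp add: cell_le_def)

lemma cell_le_trans: "cell_le x y \<Longrightarrow> cell_le y z \<Longrightarrow> cell_le x z"
  by (auto simp: cell_le_def)

lemma finite_downsets: "finite P \<Longrightarrow> finite (downsets P)"
  by (rule finite_subset[of _ "Pow P"]) (auto simp: downsets_def)

lemma card_downsets_empty [simp]: "card (downsets {}) = 1"
proof -
  have "downsets {} = {{}}"
    by (auto simp: downsets_def)
  then show ?thesis by simp
qed

text \<open>
  The order ideals avoiding \<open>c\<close> avoid everything above \<open>c\<close>; those containing \<open>c\<close> contain everything
  below \<open>c\<close>, and only the rest is free. All the counts below are obtained by iterating this.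
\<close>

lemma card_downsets_split:
  assumes fin: "finite P" and c: "c \<in> P"
  shows "card (downsets P) =
    card (downsets {x \<in> P. \<not> cell_le c x}) + card (downsets {x \<in> P. \<not> cell_le x c})"
proof -
  let ?without = "{U \<in> downsets P. c \<notin> U}" and ?with = "{U \<in> downsets P. c \<in> U}"
  have without: "?without = downsets {x \<in> P. \<not> cell_le c x}"
  proof
    show "?without \<subseteq> downsets {x \<in> P. \<not> cell_le c x}"
      using c unfolding downsets_def by blast
    show "downsets {x \<in> P. \<not> cell_le c x} \<subseteq> ?without"
    proof
      fix U assume U: "U \<in> downsets {x \<in> P. \<not> cell_le c x}"
      have "y \<in> U" if "x \<in> U" "y \<in> P" "cell_le y x" for x y
        using U that cell_le_trans[of c y x] unfolding downsets_def by blast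
      then show "U \<in> ?without"
        using U unfolding downsets_def by force
    qed
  qed
  let ?low = "{x \<in> P. cell_le x c}"
  have "bij_betw (\<lambda>U. U - ?low) ?with (downsets {x \<in> P. \<not> cell_le x c})"
  proof (rule bij_betw_byWitness[where f' = "\<lambda>U. U \<union> ?low"])
    show "\<forall>U\<in>?with. U - ?low \<union> ?low = U"
      by (auto simp: downsets_def)
    show "\<forall>U\<in>downsets {x \<in> P. \<not> cell_le x c}. U \<union> ?low - ?low = U"
      by (auto simp: downsets_def)
    show "(\<lambda>U. U - ?low) ` ?with \<subseteq> downsets {x \<in> P. \<not> cell_le x c}"
      by (auto simp: downsets_def)
    show "(\<lambda>U. U \<union> ?low) ` downsets {x \<in> P. \<not> cell_le x c} \<subseteq> ?with"
    proof
      fix W assume "W \<in> (\<lambda>U. U \<union> ?low) ` downsets {x \<in> P. \<not> cell_le x c}"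
      then obtain U where U: "U \<in> downsets {x \<in> P. \<not> cell_le x c}" and W: "W = U \<union> ?low"
        by blast
      have "y \<in> W" if "x \<in> W" "y \<in> P" "cell_le y x" for x y
        using U that cell_le_trans[of y x c] unfolding W downsets_def by blast
      moreover have "W \<subseteq> P" "c \<in> W"
        using U c unfolding W downsets_def by auto
      ultimately show "W \<in> ?with"
        unfolding downsets_def by blast
    qed
  qed
  then have "card ?with = card (downsets {x \<in> P. \<not> cell_le x c})"
    by (rule bij_betw_same_card)
  moreover have "downsets P = ?without \<union> ?with" "?without \<inter> ?with = {}"
    by auto
  moreover have "finite ?without" "finite ?with"
    using finite_downsets[OF fin] by auto
  ultimately show ?thesis
    using card_Un_disjoint[of ?without ?with] without by simp
qed

lemma card_downsets_isolated:
  assumes fin: "finite P" and c: "c \<in> P"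
    and iso: "\<And>x. x \<in> P \<Longrightarrow> x \<noteq> c \<Longrightarrow> \<not> cell_le x c \<and> \<not> cell_le c x"
  shows "card (downsets P) = 2 * card (downsets (P - {c}))"
proof -
  have "{x \<in> P. \<not> cell_le c x} = P - {c}" "{x \<in> P. \<not> cell_le x c} = P - {c}"
    using iso by auto
  then show ?thesis
    using card_downsets_split[OF fin c] by simp
qed

text \<open>
  The cells in rows \<open>1, \<dots>, k\<close> and columns from \<open>b\<close> on, row \<open>k\<close> having \<open>d\<close> cells and each earlier row one
  cell more than the next.
\<close>

definition trapezoid :: "nat \<Rightarrow> nat \<Rightarrow> nat \<Rightarrow> (nat \<times> nat) set" where
  "trapezoid k b d = {(p, q). 1 \<le> p \<and> p \<le> k \<and> b \<le> q \<and> p + q < k + b + d}"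

lemma finite_trapezoid: "finite (trapezoid k b d)"
  by (rule finite_subset[of _ "{..k} \<times> {..k + b + d}"]) (auto simp: trapezoid_def)

text \<open>
  The ballot numbers \<open>binom M k - binom M (k - 1)\<close>. The case distinction is needed because \<open>k - 1\<close> is
  truncated at zero.
\<close>

definition ballot :: "nat \<Rightarrow> nat \<Rightarrow> int" where
  "ballot M k = int (M choose k) - (if k = 0 then 0 else int (M choose (k - 1)))"

lemma ballot_Suc: "ballot (Suc M) (Suc k) = ballot M (Suc k) + ballot M k"
  by (cases k) (auto simp: ballot_def)

lemma ballot_middle: "ballot (2 * k + 2) (Suc k) = ballot (2 * k + 1) k"
proof -
  have "ballot (Suc (2 * k + 1)) (Suc k) = ballot (2 * k + 1) (Suc k) + ballot (2 * k + 1) k"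
    by (rule ballot_Suc)
  moreover have "(2 * k + 1) choose (Suc k) = (2 * k + 1) choose k"
    using binomial_symmetric[of k "2 * k + 1"] by simp
  then have "ballot (2 * k + 1) (Suc k) = 0"
    by (simp add: ballot_def)
  ultimately show ?thesis by simp
qed

text \<open>
  Splitting at the first cell of the last row either deletes the last row or the first column. This is
  the Pascal recursion of the ballot numbers, with \<open>ballot_middle\<close> covering an empty last row.
\<close>

lemma card_downsets_trapezoid: "int (card (downsets (trapezoid k b d))) = ballot (2 * k + d) k"
proof (induction k arbitrary: b d)
  case 0
  have "trapezoid 0 b d = {}"
    by (auto simp: trapezoid_def)
  then show ?case by (simp add: ballot_def)
next
  case (Suc k)
  note shorter = Suc.IH
  show ?case
  proof (induction d arbitrary: b)
    case 0
    have "trapezoid (Suc k) b 0 = trapezoid k b 1"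
      by (auto simp: trapezoid_def)
    then show ?case
      using shorter[of b 1] ballot_middle[of k] by simp
  next
    case (Suc d)
    let ?P = "trapezoid (Suc k) b (Suc d)"
    have c: "(Suc k, b) \<in> ?P"
      by (auto simp: trapezoid_def)
    have "{x \<in> ?P. \<not> cell_le (Suc k, b) x} = trapezoid k b (Suc (Suc d))"
      "{x \<in> ?P. \<not> cell_le x (Suc k, b)} = trapezoid (Suc k) (Suc b) d"
      by (auto simp: trapezoid_def cell_le_def)
    then have "int (card (downsets ?P)) = ballot (2 * k + Suc (Suc d)) k + ballot (2 * Suc k + d) (Suc k)"
      using card_downsets_split[OF finite_trapezoid c] shorter[of b "Suc (Suc d)"] Suc.IH[of "Suc b"]
      by simp
    then show ?case
      using ballot_Suc[of "2 * k + 2 + d" k] by simp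
  qed
qed

lemma binomial_absorb_comp_aux: "Suc k * (n choose Suc k) = (n - k) * (n choose k)"
  by (simp only: binomial_absorption binomial_absorb_comp)

text \<open>
  The staircase is a trapezoid with an empty last row, and the central ballot number is a Catalan number.
\<close>

lemma card_downsets_staircase:
  "real (card (downsets {(p, q). 1 \<le> p \<and> 1 \<le> q \<and> p + q \<le> N})) = catalan N"
proof -
  have "{(p, q). 1 \<le> p \<and> 1 \<le> q \<and> p + q \<le> N} = trapezoid N 1 0"
    by (auto simp: trapezoid_def)
  then have eq: "int (card (downsets {(p, q). 1 \<le> p \<and> 1 \<le> q \<and> p + q \<le> N})) = ballot (2 * N) N"
    using card_downsets_trapezoid[of N 1 0] by simp
  have "real_of_int (ballot (2 * N) N) = catalan N"
  proof (cases N)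
    case 0
    then show ?thesis by (simp add: ballot_def catalan_def)
  next
    case (Suc k)
    have "Suc k * (2 * N choose Suc k) = (2 * N - k) * (2 * N choose k)"
      by (rule binomial_absorb_comp_aux)
    then have "real (Suc k) * real (2 * N choose N) = real (k + 2) * real (2 * N choose k)"
      using Suc by (simp only: of_nat_mult [symmetric]) simp
    then have "real (2 * N choose k) = real (Suc k) * real (2 * N choose N) / real (k + 2)"
      by (simp add: field_simps)
    then show ?thesis
      using Suc by (simp add: ballot_def catalan_def field_simps)
  qed
  with eq have "real_of_int (int (card (downsets {(p, q). 1 \<le> p \<and> 1 \<le> q \<and> p + q \<le> N}))) = catalan N"
    by (simp only:)
  then show ?thesis
    by (simp only: of_int_of_nat_eq)
qed

text \<open>
  Pairs of blocks that carry a positive root outside the Levi part. The set \<open>S\<close> tells which blocks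
  can be paired with themselves.
\<close>

definition shifted_cells :: "nat \<Rightarrow> nat set \<Rightarrow> (nat \<times> nat) set" where
  "shifted_cells N S = {(p, q). 1 \<le> p \<and> p \<le> q \<and> p + q \<le> N \<and> (p = q \<longrightarrow> p \<in> S)}"

text \<open>
  What is left to decide about an order ideal once it is known to contain \<open>(k, k + 1)\<close>.
\<close>

definition shifted_tail :: "nat \<Rightarrow> nat set \<Rightarrow> nat \<Rightarrow> (nat \<times> nat) set" where
  "shifted_tail N S k = {(p, q) \<in> shifted_cells N S. k + 2 \<le> q \<or> (p = k + 1 \<and> q = k + 1)}"

lemma finite_shifted_cells: "finite (shifted_cells N S)"
  by (rule finite_subset[of _ "{..N} \<times> {..N}"]) (auto simp: shifted_cells_def)

lemma finite_shifted_tail: "finite (shifted_tail N S k)"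
  by (rule finite_subset[OF _ finite_shifted_cells[of N S]]) (auto simp: shifted_tail_def)

text \<open>
  The order ideals that contain \<open>(k, k + 1)\<close> but not \<open>(k + 1, k + 2)\<close>. The remaining cells form a
  trapezoid together with the diagonal cell \<open>(k + 1, k + 1)\<close>, which is comparable to none of them and so
  doubles the count if it is present.
\<close>

lemma card_downsets_tail_row:
  assumes N: "2 * k + 1 \<le> N" and S: "\<And>p. p \<in> S \<Longrightarrow> 2 * p \<le> N"
  shows "int (card (downsets {(p, q) \<in> shifted_tail N S k. p \<le> k \<or> q = k + 1})) =
    (if k + 1 \<in> S then 2 else 1) * ballot (N - 1) k"
proof -
  let ?Q = "{(p, q) \<in> shifted_tail N S k. p \<le> k \<or> q = k + 1}"
  let ?R = "trapezoid k (k + 2) (N - 2 * k - 1)"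
  have R: "int (card (downsets ?R)) = ballot (N - 1) k"
    using card_downsets_trapezoid[of k "k + 2" "N - 2 * k - 1"] N by simp
  show ?thesis
  proof (cases "k + 1 \<in> S")
    case True
    then have "2 * (k + 1) \<le> N" by (rule S)
    then have c: "(k + 1, k + 1) \<in> ?Q" and rest: "?Q - {(k + 1, k + 1)} = ?R"
      using N True by (auto simp: shifted_tail_def shifted_cells_def trapezoid_def)
    have fin: "finite ?Q"
      by (rule finite_subset[OF _ finite_shifted_tail[of N S k]]) auto
    have "card (downsets ?Q) = 2 * card (downsets (?Q - {(k + 1, k + 1)}))"
      by (rule card_downsets_isolated[OF fin c])
        (auto simp: cell_le_def shifted_tail_def shifted_cells_def)
    then show ?thesis
      using R True unfolding rest by simp
  next
    case False
    then have "?Q = ?R"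
      using N by (auto simp: shifted_tail_def shifted_cells_def trapezoid_def)
    then show ?thesis
      using R False by simp
  qed
qed

lemma card_downsets_tail:
  assumes S: "\<And>p. p \<in> S \<Longrightarrow> 2 * p \<le> N" and N: "2 * k + 1 \<le> N"
  shows "int (card (downsets (shifted_tail N S k))) =
    (\<Sum>j = k..(N - 1) div 2. (if j + 1 \<in> S then 2 else 1) * ballot (N - 1) j)"
  using N
proof (induction "(N - 1) div 2 - k" arbitrary: k)
  case 0
  then have k: "(N - 1) div 2 = k" by auto
  have "{(p, q) \<in> shifted_tail N S k. p \<le> k \<or> q = k + 1} = shifted_tail N S k"
    using 0 by (auto simp: shifted_tail_def shifted_cells_def)
  from card_downsets_tail_row[of k N S, unfolded this] 0(2) S k show ?case
    by simp
next
  case (Suc x)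
  then have N: "2 * (k + 1) + 1 \<le> N" by auto
  let ?P = "shifted_tail N S k" and ?c = "(k + 1, k + 2)"
  have c: "?c \<in> ?P"
    using N by (auto simp: shifted_tail_def shifted_cells_def)
  have "{x \<in> ?P. \<not> cell_le ?c x} = {(p, q) \<in> ?P. p \<le> k \<or> q = k + 1}"
    "{x \<in> ?P. \<not> cell_le x ?c} = shifted_tail N S (k + 1)"
    by (auto simp: shifted_tail_def shifted_cells_def cell_le_def)
  then have "int (card (downsets ?P)) =
      (if k + 1 \<in> S then 2 else 1) * ballot (N - 1) k + int (card (downsets (shifted_tail N S (k + 1))))"
    using card_downsets_split[OF finite_shifted_tail c] card_downsets_tail_row[OF Suc(3) S] by simp
  moreover have "int (card (downsets (shifted_tail N S (k + 1)))) =
      (\<Sum>j = k + 1..(N - 1) div 2. (if j + 1 \<in> S then 2 else 1) * ballot (N - 1) j)"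
    using Suc(2) N by (intro Suc(1)) auto
  moreover have "k \<le> (N - 1) div 2"
    using Suc(2) by simp
  ultimately show ?case
    by (simp add: sum.atLeast_Suc_atMost)
qed

lemma sum_ballot: "(\<Sum>j = 0..k. ballot M j) = int (M choose k)"
  by (induction k) (auto simp: ballot_def)

text \<open>
  Summing over the number of cells \<open>(p, p + 1)\<close>: the ballot numbers telescope, and the factor \<open>2\<close> for each
  \<open>p \<in> S\<close> adds one further ballot number.
\<close>

lemma card_downsets_shifted:
  assumes S: "\<And>p. p \<in> S \<Longrightarrow> 1 \<le> p \<and> 2 * p \<le> N" and N: "1 \<le> N"
  shows "int (card (downsets (shifted_cells N S))) =
    int ((N - 1) choose ((N - 1) div 2)) + (\<Sum>p\<in>S. ballot (N - 1) (p - 1))"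
proof -
  let ?K = "(N - 1) div 2"
  have "shifted_cells N S = shifted_tail N S 0"
    by (auto simp: shifted_tail_def shifted_cells_def)
  then have "int (card (downsets (shifted_cells N S))) =
      (\<Sum>j = 0..?K. (if j + 1 \<in> S then 2 else 1) * ballot (N - 1) j)"
    using card_downsets_tail[of S N 0] S N by auto
  also have "\<dots> = (\<Sum>j = 0..?K. ballot (N - 1) j + (if j + 1 \<in> S then ballot (N - 1) j else 0))"
    by (rule sum.cong) auto
  also have "\<dots> = int ((N - 1) choose ?K) + (\<Sum>j \<in> {j \<in> {0..?K}. j + 1 \<in> S}. ballot (N - 1) j)"
    by (simp only: sum.distrib sum_ballot sum.inter_filter[OF finite_atLeastAtMost])
  also have "(\<Sum>j \<in> {j \<in> {0..?K}. j + 1 \<in> S}. ballot (N - 1) j) = (\<Sum>p\<in>S. ballot (N - 1) (p - 1))"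
    by (rule sum.reindex_bij_witness[of _ "\<lambda>p. p - 1" "\<lambda>j. j + 1"]) (use S in force)+
  finally show ?thesis .
qed

text \<open>
  Passage from roots to cells: \<open>\<rho>\<close> parametrizes the roots and \<open>f\<close> gives the cell of a root. The sets on the
  left are the order ideals of a preorder, and these correspond to order ideals of its quotient.
\<close>

lemma card_downsets_pullback:
  fixes f :: "'x \<Rightarrow> nat \<times> nat" and \<rho> :: "'x \<Rightarrow> 'y"
  assumes wd: "\<And>x y. x \<in> L \<Longrightarrow> y \<in> L \<Longrightarrow> \<rho> x = \<rho> y \<Longrightarrow> f x = f y"
  shows "card {F. F \<subseteq> \<rho> ` L \<and>
      (\<forall>x\<in>L. \<forall>y\<in>L. \<rho> x \<in> F \<and> cell_le (f y) (f x) \<longrightarrow> \<rho> y \<in> F)} = card (downsets (f ` L))"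
proof -
  let ?A = "{F. F \<subseteq> \<rho> ` L \<and> (\<forall>x\<in>L. \<forall>y\<in>L. \<rho> x \<in> F \<and> cell_le (f y) (f x) \<longrightarrow> \<rho> y \<in> F)}"
  let ?g = "\<lambda>F. f ` {x \<in> L. \<rho> x \<in> F}" and ?h = "\<lambda>U. \<rho> ` {x \<in> L. f x \<in> U}"
  have "bij_betw ?g ?A (downsets (f ` L))"
  proof (rule bij_betw_byWitness[where f' = ?h])
    show "\<forall>F\<in>?A. ?h (?g F) = F"
    proof
      fix F assume F: "F \<in> ?A"
      show "?h (?g F) = F"
      proof
        show "?h (?g F) \<subseteq> F"
        proof
          fix z assume "z \<in> ?h (?g F)"
          then obtain x y where "x \<in> L" "y \<in> L" "\<rho> y \<in> F" "f x = f y" "z = \<rho> x" by auto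
          moreover from this have "cell_le (f x) (f y)" by simp
          ultimately show "z \<in> F" using F by blast
        qed
        show "F \<subseteq> ?h (?g F)"
        proof
          fix z assume z: "z \<in> F"
          then obtain x where "x \<in> L" "z = \<rho> x" using F by blast
          with z show "z \<in> ?h (?g F)" by blast
        qed
      qed
    qed
    have mem: "\<rho> x \<in> ?h U \<longleftrightarrow> f x \<in> U" if "x \<in> L" for x U
    proof
      assume "\<rho> x \<in> ?h U"
      then obtain y where "y \<in> L" "f y \<in> U" "\<rho> x = \<rho> y" by blast
      with wd[OF that] show "f x \<in> U" by simp
    next
      assume "f x \<in> U"
      with that show "\<rho> x \<in> ?h U" by blast
    qed
    show "\<forall>U\<in>downsets (f ` L). ?g (?h U) = U"
    proof
      fix U assume "U \<in> downsets (f ` L)"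
      then have "U \<subseteq> f ` L"
        by (simp add: downsets_def)
      moreover have "{x \<in> L. \<rho> x \<in> ?h U} = {x \<in> L. f x \<in> U}"
        using mem by blast
      ultimately show "?g (?h U) = U" by auto
    qed
    show "?g ` ?A \<subseteq> downsets (f ` L)"
      by (auto simp: downsets_def)
    show "?h ` downsets (f ` L) \<subseteq> ?A"
    proof
      fix F assume "F \<in> ?h ` downsets (f ` L)"
      then obtain U where U: "U \<in> downsets (f ` L)" and F: "F = ?h U" by blast
      have "\<rho> y \<in> F" if "x \<in> L" "y \<in> L" "\<rho> x \<in> F" "cell_le (f y) (f x)" for x y
        using that U unfolding F mem[OF that(1)] mem[OF that(2)] downsets_def by blast
      then show "F \<in> ?A" unfolding F by blast
    qed
  qed
  then show ?thesis by (rule bij_betw_same_card)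
qed

section \<open>Linear functionals and coordinates of roots\<close>

definition linfun :: "(('g \<Rightarrow> complex) \<Rightarrow> complex) \<Rightarrow> bool" where
  "linfun f \<longleftrightarrow> (\<forall>x y. f (x + y) = f x + f y) \<and> (\<forall>c x. f (\<lambda>v. c * x v) = c * f x)"

lemma linfun_add: "linfun f \<Longrightarrow> f (x + y) = f x + f y"
  by (simp add: linfun_def)

lemma linfun_scale: "linfun f \<Longrightarrow> f (\<lambda>v. c * x v) = c * f x"
  by (simp add: linfun_def)

lemma linfun_uminus: "linfun f \<Longrightarrow> f (- x) = - f x"
  using linfun_scale[of f "- 1" x] by (simp add: fun_Compl_def)

lemma linfun_diff: "linfun f \<Longrightarrow> f (x - y) = f x - f y"
  using linfun_add[of f x "- y"] linfun_uminus[of f y] by simp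

lemma linfun_zero: "linfun f \<Longrightarrow> f 0 = 0"
  using linfun_diff[of f 0 0] by simp

lemma linfun_sum:
  assumes "linfun f" "finite P"
  shows "f (\<lambda>v. \<Sum>a\<in>P. c a * a v) = (\<Sum>a\<in>P. c a * f a)"
  using assms(2)
proof (induction rule: finite_induct)
  case empty
  show ?case
    using linfun_zero[OF assms(1)] by (simp add: zero_fun_def)
next
  case (insert a P)
  have "(\<lambda>v. \<Sum>a\<in>insert a P. c a * a v) = (\<lambda>v. c a * a v) + (\<lambda>v. \<Sum>a\<in>P. c a * a v)"
    using insert(1,2) by (auto simp: plus_fun_def)
  then show ?case
    using insert linfun_add[OF assms(1)] linfun_scale[OF assms(1)] by simp
qed

text \<open>
  Linear independence of the simple roots is used only in this form: a linear functional can be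
  prescribed on them. Properties of roots are then read off from the values of suitable functionals.
\<close>

lemma exists_linfun:
  fixes P :: "('g \<Rightarrow> complex) set"
  assumes fin: "finite P"
    and indep: "\<And>c. (\<forall>v. (\<Sum>a\<in>P. c a * a v) = 0) \<Longrightarrow> \<forall>a\<in>P. c a = 0"
  shows "\<exists>f. linfun f \<and> (\<forall>a\<in>P. f a = g a)"
proof -
  interpret V: vector_space "\<lambda>c (x :: 'g \<Rightarrow> complex) v. c * x v"
    by unfold_locales (auto simp: plus_fun_def algebra_simps)
  interpret C: vector_space "(*) :: complex \<Rightarrow> complex \<Rightarrow> complex"
    by unfold_locales (auto simp: algebra_simps)
  interpret VC: vector_space_pair "\<lambda>c (x :: 'g \<Rightarrow> complex) v. c * x v"
    "(*) :: complex \<Rightarrow> complex \<Rightarrow> complex" ..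
  have sum_apply: "(\<Sum>a\<in>Q. h a) v = (\<Sum>a\<in>Q. h a v)"
    for Q and h :: "('g \<Rightarrow> complex) \<Rightarrow> 'g \<Rightarrow> complex" and v
    by (induction Q rule: infinite_finite_induct) auto
  have "V.independent P"
    unfolding V.dependent_finite[OF fin]
  proof safe
    fix u a assume "(\<Sum>v\<in>P. (\<lambda>w. u v * v w)) = 0" and a: "a \<in> P" and nz: "u a \<noteq> 0"
    then have "(\<Sum>v\<in>P. (\<lambda>w. u v * v w)) x = 0" for x by simp
    then have "\<forall>x. (\<Sum>v\<in>P. u v * v x) = 0"
      by (simp add: sum_apply)
    then show False
      using indep a nz by blast
  qed
  from VC.linear_independent_extend[OF this, of g] obtain f where
    f: "Vector_Spaces.linear (\<lambda>c x v. c * x v) (*) f" "\<forall>x\<in>P. f x = g x" by blast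
  then have "linfun f"
    unfolding linfun_def by (simp add: Vector_Spaces.linear_iff)
  with f(2) show ?thesis by blast
qed

text \<open>
  The pairs of indices whose difference \<open>\<epsilon> i - \<epsilon> j\<close> is a root. The parameter \<open>diag\<close> tells whether pairs
  of opposite indices are roots.
\<close>

definition legit_pair :: "nat \<Rightarrow> bool \<Rightarrow> nat \<Rightarrow> nat \<Rightarrow> bool" where
  "legit_pair n diag i j \<longleftrightarrow> i \<in> {1..n} \<and> j \<in> {1..n} \<and> i \<noteq> j \<and> (diag \<or> i + j \<noteq> n + 1)"

text \<open>
  The indicator function of a set of indices, made odd under \<open>i \<mapsto> n + 1 - i\<close> in the folded case.
\<close>

definition spike_weight :: "nat \<Rightarrow> bool \<Rightarrow> nat set \<Rightarrow> nat \<Rightarrow> int" where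
  "spike_weight n symm A t = (if t \<in> A then 1 else 0) - (if symm \<and> n + 1 - t \<in> A then 1 else 0)"

text \<open>
  Folded and unfolded coordinates are treated together: \<open>symm\<close> says that \<open>\<epsilon>\<close> is odd under
  \<open>i \<mapsto> n + 1 - i\<close>. The axiom on functionals expresses that there are no linear relations between the
  roots beyond those forced by this symmetry. It only speaks about differences because in type \<open>A\<close> the
  vectors \<open>\<epsilon> i\<close> are determined up to a common translation.
\<close>

locale root_coordinates =
  fixes n :: nat and \<epsilon> :: "nat \<Rightarrow> 'g \<Rightarrow> complex" and symm diag :: bool
  assumes functional:
    "\<And>x :: nat \<Rightarrow> int. (symm \<Longrightarrow> \<forall>i\<in>{1..n}. x (n + 1 - i) = - x i) \<Longrightarrow>
      \<exists>f. linfun f \<and> (\<forall>i\<in>{1..n}. \<forall>j\<in>{1..n}. f (\<epsilon> i - \<epsilon> j) = of_int (x i - x j))"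
    and symmetric: "\<And>i. symm \<Longrightarrow> i \<in> {1..n} \<Longrightarrow> \<epsilon> (n + 1 - i) = - \<epsilon> i"
    and diag_unless_symm: "symm \<or> diag"
begin

abbreviation legit :: "nat \<Rightarrow> nat \<Rightarrow> bool" where
  "legit \<equiv> legit_pair n diag"

abbreviation spike :: "nat set \<Rightarrow> nat \<Rightarrow> int" where
  "spike \<equiv> spike_weight n symm"

definition coord_roots :: "('g \<Rightarrow> complex) set" where
  "coord_roots = {\<epsilon> i - \<epsilon> j | i j. legit i j}"

lemma weight_eq:
  fixes x :: "nat \<Rightarrow> int"
  assumes "symm \<Longrightarrow> \<forall>i\<in>{1..n}. x (n + 1 - i) = - x i"
    and "\<epsilon> i - \<epsilon> j = \<epsilon> u - \<epsilon> v" "i \<in> {1..n}" "j \<in> {1..n}" "u \<in> {1..n}" "v \<in> {1..n}"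
  shows "x i - x j = x u - x v"
proof -
  obtain f where "\<forall>i\<in>{1..n}. \<forall>j\<in>{1..n}. f (\<epsilon> i - \<epsilon> j) = complex_of_int (x i - x j)"
    using functional[OF assms(1)] by blast
  then have "f (\<epsilon> i - \<epsilon> j) = complex_of_int (x i - x j)" "f (\<epsilon> u - \<epsilon> v) = complex_of_int (x u - x v)"
    using assms(3-) by blast+
  then have "complex_of_int (x i - x j) = of_int (x u - x v)" by (simp only: assms(2))
  then show ?thesis by (simp only: of_int_eq_iff)
qed

lemma spike_odd: "symm \<Longrightarrow> \<forall>i\<in>{1..n}. spike A (n + 1 - i) = - spike A i"
  by (auto simp: spike_weight_def)

lemma spike_bounds: "spike A t \<le> 1" "- 1 \<le> spike A t"
  by (auto simp: spike_weight_def)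

lemma spike_single:
  assumes "c \<in> {1..n}" "t \<in> {1..n}" "symm \<Longrightarrow> 2 * c \<noteq> n + 1"
  shows "spike {c} t = (if t = c then 1 else if symm \<and> t + c = n + 1 then - 1 else 0)"
proof -
  have "n + 1 - t = c \<longleftrightarrow> t + c = n + 1"
    using assms(1,2) by auto
  then show ?thesis
    using assms(3) by (auto simp: spike_weight_def)
qed

lemma root_nonzero:
  assumes "legit i j" shows "\<epsilon> i - \<epsilon> j \<noteq> 0"
proof
  assume "\<epsilon> i - \<epsilon> j = 0"
  then have "\<epsilon> i - \<epsilon> j = \<epsilon> i - \<epsilon> i" by simp
  then have "(int n + 1 - 2 * int i) - (int n + 1 - 2 * int j) =
      (int n + 1 - 2 * int i) - (int n + 1 - 2 * int i)"
    by (intro weight_eq[of "\<lambda>i. int n + 1 - 2 * int i" i j i i])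
      (use assms in \<open>auto simp: legit_pair_def of_nat_diff\<close>)
  with assms show False by (simp add: legit_pair_def)
qed

lemma coord_inject:
  assumes symm "\<epsilon> s = \<epsilon> t" "s \<in> {1..n}" "t \<in> {1..n}"
  shows "s = t"
proof -
  have eq: "\<epsilon> s - \<epsilon> s = \<epsilon> t - \<epsilon> s" using assms(2) by simp
  show ?thesis
  proof (cases "2 * s = n + 1 \<and> 2 * t = n + 1")
    case False
    have "spike {s} s - spike {s} s = spike {s} t - spike {s} s"
      "spike {t} s - spike {t} s = spike {t} t - spike {t} s"
      by (rule weight_eq[OF spike_odd eq]; use assms in simp)+
    then show ?thesis
      using False assms(1,3,4) by (auto simp: spike_weight_def split: if_splits)
  qed auto
qed

text \<open>
  A functional that is one on a single coordinate detects whether that coordinate occurs in a root. In the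
  folded case the root is recovered only up to the two ways of writing it.
\<close>

lemma root_eq:
  assumes eq: "\<epsilon> i - \<epsilon> j = \<epsilon> u - \<epsilon> v" and ij: "legit i j" and uv: "legit u v"
  shows "u = i \<and> v = j \<or> symm \<and> u = n + 1 - j \<and> v = n + 1 - i"
proof (cases symm)
  case False
  have "spike {c} i - spike {c} j = spike {c} u - spike {c} v" for c
    by (rule weight_eq[OF spike_odd eq]; use ij uv in \<open>auto simp: legit_pair_def\<close>)
  from this[of i] this[of j] False show ?thesis
    using ij uv by (auto simp: spike_weight_def legit_pair_def split: if_splits)
next
  case True
  have mem: "i \<in> {1..n}" "j \<in> {1..n}" "u \<in> {1..n}" "v \<in> {1..n}" "i \<noteq> j" "u \<noteq> v"
    using ij uv by (auto simp: legit_pair_def)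
  have weight: "spike {c} i - spike {c} j = spike {c} u - spike {c} v" for c
    by (rule weight_eq[OF spike_odd eq]; use mem in simp)
  have claim: "u = i \<or> v + i = n + 1 \<or> u + j = n + 1 \<or> v = j"
  proof (cases "2 * i = n + 1")
    case False
    then have single: "spike {i} t = (if t = i then 1 else if t + i = n + 1 then - 1 else 0)"
      if "t \<in> {1..n}" for t
      using spike_single[OF mem(1) that] True by simp
    show ?thesis
      using weight[of i] mem(5) unfolding single[OF mem(1)] single[OF mem(2)] single[OF mem(3)] single[OF mem(4)]
      by (simp split: if_splits)
  next
    case i: True
    then have "2 * j \<noteq> n + 1" using mem by auto
    then have single: "spike {j} t = (if t = j then 1 else if t + j = n + 1 then - 1 else 0)"
      if "t \<in> {1..n}" for t
      using spike_single[OF mem(2) that] True by simp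
    show ?thesis
      using weight[of j] mem(5) unfolding single[OF mem(1)] single[OF mem(2)] single[OF mem(3)] single[OF mem(4)]
      by (simp split: if_splits)
  qed
  have dual: "\<epsilon> s = - \<epsilon> t" if "s + t = n + 1" "s \<in> {1..n}" "t \<in> {1..n}" for s t
  proof -
    have "s = n + 1 - t" using that by simp
    then show ?thesis using symmetric[OF True that(3)] by simp
  qed
  from claim show ?thesis
  proof (elim disjE)
    assume "u = i"
    then have "\<epsilon> j = \<epsilon> v" using eq by simp
    with \<open>u = i\<close> show ?thesis using coord_inject[OF True] mem by auto
  next
    assume "v = j"
    then have "\<epsilon> i = \<epsilon> u" using eq by simp
    with \<open>v = j\<close> show ?thesis using coord_inject[OF True] mem by auto
  next
    assume vi: "v + i = n + 1"
    then have "\<epsilon> i = - \<epsilon> v" using dual[of i v] mem by simp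
    then have "- \<epsilon> j = \<epsilon> u" using eq by (simp add: algebra_simps)
    then have "\<epsilon> (n + 1 - j) = \<epsilon> u"
      using symmetric[OF True, of j] mem by simp
    moreover have "n + 1 - j \<in> {1..n}" using mem by auto
    ultimately have "n + 1 - j = u"
      using coord_inject[OF True] mem by metis
    with vi True mem show ?thesis by auto
  next
    assume uj: "u + j = n + 1"
    then have "\<epsilon> u = - \<epsilon> j" using dual[of u j] mem by simp
    then have "- \<epsilon> i = \<epsilon> v" using eq by (simp add: algebra_simps neg_eq_iff_add_eq_0)
    then have "\<epsilon> (n + 1 - i) = \<epsilon> v"
      using symmetric[OF True, of i] mem by simp
    moreover have "n + 1 - i \<in> {1..n}" using mem by auto
    ultimately have "n + 1 - i = v"
      using coord_inject[OF True] mem by metis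
    with uj True mem show ?thesis by auto
  qed
qed

lemma legit_if_root:
  assumes i: "i \<in> {1..n}" and j: "j \<in> {1..n}" and eq: "\<epsilon> i - \<epsilon> j = \<epsilon> u - \<epsilon> v" and uv: "legit u v"
  shows "legit i j"
proof -
  have ne: "i \<noteq> j"
    using root_nonzero[OF uv] eq by auto
  have "i + j \<noteq> n + 1" if "\<not> diag"
  proof
    assume ij: "i + j = n + 1"
    have symm using that diag_unless_symm by simp
    have "spike {i} i - spike {i} j = spike {i} u - spike {i} v"
      by (rule weight_eq[OF spike_odd eq]; use i j uv in \<open>simp add: legit_pair_def\<close>)
    moreover have single: "spike {i} t = (if t = i then 1 else if t + i = n + 1 then - 1 else 0)"
      if "t \<in> {1..n}" for t
      using spike_single[OF i that] ij ne \<open>symm\<close> by simp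
    from single[OF i] single[OF j] have "spike {i} i = 1" "spike {i} j = - 1"
      using ij ne by simp_all
    ultimately have "spike {i} u = 1" "spike {i} v = - 1"
      using spike_bounds(1)[of "{i}" u] spike_bounds(2)[of "{i}" v] by linarith+
    then have "u + v = n + 1"
      using single[of u] single[of v] uv by (auto simp: legit_pair_def split: if_splits)
    with uv that show False by (simp add: legit_pair_def)
  qed
  with ne i j show ?thesis by (auto simp: legit_pair_def)
qed

text \<open>
  If nothing cancels in a sum of two roots, then the functional that is one on all the coordinates involved
  takes a larger value on the sum than on any root. In the folded case the four coordinates are
  \<open>i\<close>, \<open>n + 1 - j\<close>, \<open>h\<close>, \<open>n + 1 - k\<close>, and a coordinate that is its own opposite contributes zero; at most
  one of them can be of this kind, so that the value is at least \<open>3\<close>, while it is at most \<open>2\<close> on a root.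
\<close>

lemma root_sum_cancels:
  assumes eq: "(\<epsilon> i - \<epsilon> j) + (\<epsilon> h - \<epsilon> k) = \<epsilon> u - \<epsilon> v"
    and ij: "legit i j" and hk: "legit h k" and uv: "legit u v"
  shows "j = h \<or> i = k \<or> symm \<and> (j + k = n + 1 \<or> i + h = n + 1)"
proof (rule ccontr)
  assume "\<not> ?thesis"
  then have no: "j \<noteq> h" "i \<noteq> k" "symm \<Longrightarrow> j + k \<noteq> n + 1" "symm \<Longrightarrow> i + h \<noteq> n + 1" by auto
  have mem: "i \<in> {1..n}" "j \<in> {1..n}" "h \<in> {1..n}" "k \<in> {1..n}" "u \<in> {1..n}" "v \<in> {1..n}"
    "i \<noteq> j" "h \<noteq> k"
    using assms by (auto simp: legit_pair_def)
  define A where "A = (if symm then {i, n + 1 - j, h, n + 1 - k} else {i, h})"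
  obtain f where f: "linfun f" "\<forall>i\<in>{1..n}. \<forall>j\<in>{1..n}. f (\<epsilon> i - \<epsilon> j) = of_int (spike A i - spike A j)"
    using functional[OF spike_odd] by blast
  have "f (\<epsilon> i - \<epsilon> j) + f (\<epsilon> h - \<epsilon> k) = f (\<epsilon> u - \<epsilon> v)"
    using linfun_add[OF f(1)] eq by metis
  then have "complex_of_int (spike A i - spike A j + (spike A h - spike A k)) = of_int (spike A u - spike A v)"
    using f(2) mem by simp
  then have sum: "spike A i - spike A j + (spike A h - spike A k) = spike A u - spike A v"
    by (simp only: of_int_eq_iff)
  show False
  proof (cases symm)
    case False
    then have "spike A i = 1" "spike A j = 0" "spike A h = 1" "spike A k = 0"
      "spike A u \<le> 1" "spike A v \<ge> 0"
      using mem no by (auto simp: spike_weight_def A_def)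
    with sum show False by simp
  next
    case True
    have A: "t \<in> A \<longleftrightarrow> t = i \<or> t + j = n + 1 \<or> t = h \<or> t + k = n + 1" if "t \<in> {1..n}" for t
      using True mem that by (auto simp: A_def)
    have dual: "n + 1 - t \<in> A \<longleftrightarrow> t + i = n + 1 \<or> t = j \<or> t + h = n + 1 \<or> t = k" if "t \<in> {1..n}" for t
    proof -
      have "n + 1 - t \<in> A \<longleftrightarrow> n + 1 - t = i \<or> n + 1 - t + j = n + 1 \<or> n + 1 - t = h \<or> n + 1 - t + k = n + 1"
        by (rule A) (use that in auto)
      moreover have "n + 1 - t = c \<longleftrightarrow> t + c = n + 1" "n + 1 - t + c = n + 1 \<longleftrightarrow> t = c"
        if "c \<in> {1..n}" for c
        using that \<open>t \<in> {1..n}\<close> by auto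
      ultimately show ?thesis using mem(1-4) by (simp only:)
    qed
    have apart: "i \<noteq> j" "j \<noteq> i" "h \<noteq> k" "k \<noteq> h" "j \<noteq> h" "h \<noteq> j" "i \<noteq> k" "k \<noteq> i"
      "i + h \<noteq> Suc n" "h + i \<noteq> Suc n" "j + k \<noteq> Suc n" "k + j \<noteq> Suc n"
      using mem(7,8) no(1,2) no(3,4)[OF True] by linarith+
    have "spike A i = (if 2 * i = n + 1 then 0 else 1)" "spike A h = (if 2 * h = n + 1 then 0 else 1)"
      "spike A j = (if 2 * j = n + 1 then 0 else - 1)" "spike A k = (if 2 * k = n + 1 then 0 else - 1)"
      unfolding spike_weight_def A[OF mem(1)] A[OF mem(2)] A[OF mem(3)] A[OF mem(4)]
        dual[OF mem(1)] dual[OF mem(2)] dual[OF mem(3)] dual[OF mem(4)]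
      by (simp_all add: apart True mult_2)
    moreover have "spike A u \<le> 1" "- 1 \<le> spike A v"
      by (rule spike_bounds)+
    ultimately show False
      using sum mem no True by (auto split: if_splits)
  qed
qed

end

section \<open>Roots of a parabolic subalgebra in terms of blocks\<close>

lemma simple_system_linfun:
  assumes "simple_system D P"
  shows "\<exists>f. linfun f \<and> (\<forall>a\<in>P. f a = g a)"
  using assms unfolding simple_system_def by (intro exists_linfun) auto

lemma Re_linfun_pos_roots:
  assumes f: "linfun f" and P: "finite P" "\<And>a. a \<in> P \<Longrightarrow> 0 \<le> Re (f a)" and b: "b \<in> pos_roots D P"
  shows "0 \<le> Re (f b)"
proof -
  obtain c :: "_ \<Rightarrow> nat" where "b = (\<lambda>v. \<Sum>a\<in>P. of_nat (c a) * a v)"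
    using b by (auto simp: pos_roots_def)
  then have "f b = (\<Sum>a\<in>P. of_nat (c a) * f a)"
    using linfun_sum[OF f P(1)] by simp
  then show ?thesis
    using P(2) by (auto intro!: sum_nonneg)
qed

text \<open>
  The map \<open>\<pi>\<close> sends an index to the number of its block.
\<close>

locale block_coordinates = root_coordinates n \<epsilon> symm diag
  for n and \<epsilon> :: "nat \<Rightarrow> 'g \<Rightarrow> complex" and symm diag +
  fixes \<pi> :: "nat \<Rightarrow> nat" and N :: nat
  assumes block_mono: "\<And>i j. i \<in> {1..n} \<Longrightarrow> j \<in> {1..n} \<Longrightarrow> i \<le> j \<Longrightarrow> \<pi> i \<le> \<pi> j"
    and block_surj: "\<pi> ` {1..n} = {1..N}"
    and block_symm: "\<And>i. symm \<Longrightarrow> i \<in> {1..n} \<Longrightarrow> \<pi> (n + 1 - i) + \<pi> i = N + 1"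
begin

lemma block_less: "i \<in> {1..n} \<Longrightarrow> j \<in> {1..n} \<Longrightarrow> \<pi> i < \<pi> j \<Longrightarrow> i < j"
  using block_mono[of j i] by force

lemma dual_block:
  assumes symm "s + t = n + 1" "s \<in> {1..n}" "t \<in> {1..n}"
  shows "\<pi> s + \<pi> t = N + 1" "\<epsilon> s = - \<epsilon> t"
proof -
  have "s = n + 1 - t" using assms by simp
  then show "\<pi> s + \<pi> t = N + 1" "\<epsilon> s = - \<epsilon> t"
    using block_symm[of t] symmetric[of t] assms by simp_all
qed

lemma same_block_if_same_root:
  assumes "\<epsilon> i - \<epsilon> j = \<epsilon> u - \<epsilon> v" "legit i j" "legit u v"
  shows "\<pi> u = \<pi> i \<and> \<pi> v = \<pi> j \<or> symm \<and> \<pi> u + \<pi> j = N + 1 \<and> \<pi> v + \<pi> i = N + 1"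
proof -
  have "i \<in> {1..n}" "j \<in> {1..n}" using assms(2) by (auto simp: legit_pair_def)
  then show ?thesis
    using root_eq[OF assms] block_symm[of i] block_symm[of j] by auto
qed

lemma block_less_if_same_root:
  assumes "\<epsilon> i - \<epsilon> j = \<epsilon> u - \<epsilon> v" "legit i j" "legit u v" "\<pi> u < \<pi> v"
  shows "\<pi> i < \<pi> j"
  using same_block_if_same_root[OF assms(1-3)] assms(4) by auto

end

text \<open>
  The simple roots themselves are not prescribed, so that no case distinction on the type is needed: it is enough
  that they are differences \<open>\<epsilon> i - \<epsilon> j\<close> with \<open>i < j\<close>, and that those in \<open>I\<close> are the ones with both indices in
  the same block.
\<close>

locale parabolic_coordinates = block_coordinates n \<epsilon> symm diag \<pi> N
  for n and \<epsilon> :: "nat \<Rightarrow> 'g \<Rightarrow> complex" and symm diag \<pi> N +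
  fixes D P I :: "('g \<Rightarrow> complex) set"
  assumes D_eq: "D = coord_roots" and simple: "simple_system D P" and I_subset: "I \<subseteq> P"
    and simple_coords: "\<And>a. a \<in> P \<Longrightarrow>
      \<exists>i j. legit i j \<and> i < j \<and> a = \<epsilon> i - \<epsilon> j \<and> (a \<in> I \<longleftrightarrow> \<pi> i = \<pi> j)"
begin

lemma finite_simple: "finite P"
  using simple by (simp add: simple_system_def)

text \<open>
  The functional with values \<open>n + 1 - 2i\<close> on the coordinates is positive on the simple roots, hence
  nonnegative on positive roots. As every root or its negative is positive, it decides which of the two is.
\<close>

lemma pos_roots_eq: "pos_roots D P = {\<epsilon> i - \<epsilon> j | i j. legit i j \<and> i < j}"
proof -
  obtain f where f: "linfun f"
    "\<forall>i\<in>{1..n}. \<forall>j\<in>{1..n}. f (\<epsilon> i - \<epsilon> j) =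
      of_int ((int n + 1 - 2 * int i) - (int n + 1 - 2 * int j))"
    using functional[of "\<lambda>i. int n + 1 - 2 * int i"] by (auto simp: of_nat_diff)
  then have val: "Re (f (\<epsilon> i - \<epsilon> j)) = 2 * (real j - real i)" if "legit i j" for i j
    using that by (simp add: legit_pair_def)
  have nonneg: "0 \<le> Re (f b)" if "b \<in> pos_roots D P" for b
  proof (rule Re_linfun_pos_roots[OF f(1) finite_simple _ that])
    fix a assume "a \<in> P"
    then show "0 \<le> Re (f a)"
      using simple_coords[of a] val by auto
  qed
  show ?thesis
  proof (intro equalityI subsetI)
    fix b assume b: "b \<in> pos_roots D P"
    then obtain i j where ij: "legit i j" "b = \<epsilon> i - \<epsilon> j"
      using D_eq by (auto simp: pos_roots_def coord_roots_def)
    then have "i \<le> j" using nonneg[OF b] val by simp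
    moreover have "i \<noteq> j" using ij by (simp add: legit_pair_def)
    ultimately have "i < j" by simp
    with ij show "b \<in> {\<epsilon> i - \<epsilon> j | i j. legit i j \<and> i < j}" by blast
  next
    fix b assume "b \<in> {\<epsilon> i - \<epsilon> j | i j. legit i j \<and> i < j}"
    then obtain i j where ij: "legit i j" "i < j" "b = \<epsilon> i - \<epsilon> j" by blast
    then have "b \<in> D" using D_eq by (auto simp: coord_roots_def)
    then have "b \<in> pos_roots D P \<or> - b \<in> pos_roots D P"
      using simple by (simp add: simple_system_def)
    moreover have "- b \<notin> pos_roots D P"
      using nonneg[of "- b"] val[OF ij(1)] ij linfun_uminus[OF f(1), of b] by auto
    ultimately show "b \<in> pos_roots D P" by blast
  qed
qed

lemma block_weight:
  obtains f where "linfun f"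
    "\<And>i j. i \<in> {1..n} \<Longrightarrow> j \<in> {1..n} \<Longrightarrow> f (\<epsilon> i - \<epsilon> j) = of_int (2 * (int (\<pi> j) - int (\<pi> i)))"
proof -
  have "int N + 1 - 2 * int (\<pi> (n + 1 - i)) = - (int N + 1 - 2 * int (\<pi> i))" if symm "i \<in> {1..n}" for i
  proof -
    have "int (\<pi> (n + 1 - i)) + int (\<pi> i) = int N + 1"
      using block_symm[OF that] by linarith
    then show ?thesis by linarith
  qed
  then obtain f where f: "linfun f"
    "\<forall>i\<in>{1..n}. \<forall>j\<in>{1..n}. f (\<epsilon> i - \<epsilon> j) =
      of_int ((int N + 1 - 2 * int (\<pi> i)) - (int N + 1 - 2 * int (\<pi> j)))"
    using functional[of "\<lambda>i. int N + 1 - 2 * int (\<pi> i)"] by blast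
  show ?thesis
  proof (rule that[OF f(1)])
    fix i j assume "i \<in> {1..n}" "j \<in> {1..n}"
    with f(2) have "f (\<epsilon> i - \<epsilon> j) = of_int ((int N + 1 - 2 * int (\<pi> i)) - (int N + 1 - 2 * int (\<pi> j)))"
      by blast
    also have "(int N + 1 - 2 * int (\<pi> i)) - (int N + 1 - 2 * int (\<pi> j)) = 2 * (int (\<pi> j) - int (\<pi> i))"
      by simp
    finally show "f (\<epsilon> i - \<epsilon> j) = of_int (2 * (int (\<pi> j) - int (\<pi> i)))" .
  qed
qed

text \<open>
  The functional with values \<open>N + 1 - 2 (\<pi> i)\<close> vanishes on \<open>I\<close> and is positive on the other simple roots. So
  it vanishes on a positive root only if no simple root outside \<open>I\<close> occurs in it.
\<close>

lemma sub_roots_eq: "sub_roots D I = {\<epsilon> i - \<epsilon> j | i j. legit i j \<and> \<pi> i = \<pi> j}"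
proof -
  obtain f where f: "linfun f"
    "\<And>i j. i \<in> {1..n} \<Longrightarrow> j \<in> {1..n} \<Longrightarrow> f (\<epsilon> i - \<epsilon> j) = of_int (2 * (int (\<pi> j) - int (\<pi> i)))"
    using block_weight by blast
  have finI: "finite I"
    using I_subset finite_simple by (rule finite_subset)
  have fI: "f a = 0" if a: "a \<in> I" for a
  proof -
    have "a \<in> P" using a I_subset by blast
    then obtain i j where "legit i j" "a = \<epsilon> i - \<epsilon> j" "\<pi> i = \<pi> j"
      using simple_coords[of a] a by auto
    then show ?thesis using f(2)[of i j] by (simp add: legit_pair_def)
  qed
  have fP: "0 < Re (f a)" if a: "a \<in> P" "a \<notin> I" for a
  proof -
    obtain i j where ij: "legit i j" "i < j" "a = \<epsilon> i - \<epsilon> j" "\<pi> i \<noteq> \<pi> j"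
      using simple_coords[of a] a by auto
    then have "\<pi> i < \<pi> j"
      using block_mono[of i j] by (auto simp: legit_pair_def)
    then show ?thesis using f(2)[of i j] ij by (simp add: legit_pair_def)
  qed
  have pos_in: "b \<in> sub_roots D I" if b: "b \<in> pos_roots D P" "f b = 0" for b
  proof -
    obtain c :: "_ \<Rightarrow> nat" where bD: "b \<in> D" and c: "b = (\<lambda>v. \<Sum>a\<in>P. of_nat (c a) * a v)"
      using b by (auto simp: pos_roots_def)
    then have "f b = (\<Sum>a\<in>P. of_nat (c a) * f a)"
      using linfun_sum[OF f(1) finite_simple] by simp
    then have sum0: "(\<Sum>a\<in>P. real (c a) * Re (f a)) = 0"
      using b(2) by (metis (mono_tags, lifting) Re_sum Re_complex_of_real complex_Re_of_nat
          sum.cong times_complex.simps(1) complex_Im_of_nat diff_zero mult_zero_left zero_complex.simps(1))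
    have nonneg: "0 \<le> real (c a) * Re (f a)" if "a \<in> P" for a
      using fI[of a] fP[of a] that by (cases "a \<in> I") auto
    have "real (c a) * Re (f a) = 0" if "a \<in> P" for a
      using sum_nonneg_eq_0_iff[of P "\<lambda>a. real (c a) * Re (f a)"] finite_simple nonneg sum0 that by blast
    then have c0: "c a = 0" if "a \<in> P" "a \<notin> I" for a
      using fP[OF that] that(1) by force
    have "b = (\<lambda>v. \<Sum>a\<in>I. of_int (int (c a)) * a v)"
      unfolding c using c0 by (intro ext sum.mono_neutral_cong_right) (use finite_simple I_subset in auto)
    then have "\<exists>c :: _ \<Rightarrow> int. b = (\<lambda>v. \<Sum>a\<in>I. of_int (c a) * a v)"
      by (rule exI[of _ "\<lambda>a. int (c a)"])
    then show ?thesis using bD unfolding sub_roots_def by simp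
  qed
  have uminus: "- b \<in> sub_roots D I" if b: "b \<in> sub_roots D I" "- b \<in> D" for b
  proof -
    obtain c :: "_ \<Rightarrow> int" where "b = (\<lambda>v. \<Sum>a\<in>I. of_int (c a) * a v)"
      using b by (auto simp: sub_roots_def)
    then have "- b = (\<lambda>v. \<Sum>a\<in>I. of_int (- c a) * a v)"
      by (auto simp: fun_Compl_def sum_negf)
    then have "\<exists>c :: _ \<Rightarrow> int. - b = (\<lambda>v. \<Sum>a\<in>I. of_int (c a) * a v)"
      by (rule exI[of _ "\<lambda>a. - c a"])
    with b(2) show ?thesis unfolding sub_roots_def by simp
  qed
  show ?thesis
  proof (intro equalityI subsetI)
    fix b assume b: "b \<in> sub_roots D I"
    then obtain i j where ij: "legit i j" "b = \<epsilon> i - \<epsilon> j"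
      using D_eq by (auto simp: sub_roots_def coord_roots_def)
    obtain c :: "_ \<Rightarrow> int" where "b = (\<lambda>v. \<Sum>a\<in>I. of_int (c a) * a v)"
      using b by (auto simp: sub_roots_def)
    then have "f b = (\<Sum>a\<in>I. of_int (c a) * f a)"
      using linfun_sum[OF f(1) finI] by simp
    then have "f b = 0" using fI by simp
    then have "complex_of_int (2 * (int (\<pi> j) - int (\<pi> i))) = 0"
      using f(2)[of i j] ij by (simp add: legit_pair_def)
    then have "\<pi> i = \<pi> j" by (simp only: of_int_eq_0_iff) simp
    with ij show "b \<in> {\<epsilon> i - \<epsilon> j | i j. legit i j \<and> \<pi> i = \<pi> j}" by blast
  next
    fix b assume "b \<in> {\<epsilon> i - \<epsilon> j | i j. legit i j \<and> \<pi> i = \<pi> j}"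
    then obtain i j where ij: "legit i j" "b = \<epsilon> i - \<epsilon> j" "\<pi> i = \<pi> j" by blast
    then have bD: "b \<in> D" using D_eq by (auto simp: coord_roots_def)
    have fb: "f b = 0" using f(2)[of i j] ij by (simp add: legit_pair_def)
    from bD have "b \<in> pos_roots D P \<or> - b \<in> pos_roots D P"
      using simple by (simp add: simple_system_def)
    then show "b \<in> sub_roots D I"
    proof
      assume "- b \<in> pos_roots D P"
      moreover have "f (- b) = 0" using linfun_uminus[OF f(1)] fb by simp
      ultimately have "- b \<in> sub_roots D I" by (rule pos_in)
      from uminus[OF this] bD show ?thesis by simp
    qed (use pos_in fb in blast)
  qed
qed

lemma parabolic_roots_eq:
  "pos_roots D P \<union> sub_roots D I = {\<epsilon> i - \<epsilon> j | i j. legit i j \<and> \<pi> i \<le> \<pi> j}"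
proof (intro equalityI subsetI)
  fix b assume "b \<in> pos_roots D P \<union> sub_roots D I"
  then obtain i j where "legit i j" "b = \<epsilon> i - \<epsilon> j" "i < j \<or> \<pi> i = \<pi> j"
    unfolding pos_roots_eq sub_roots_eq by blast
  moreover from this have "\<pi> i \<le> \<pi> j"
    using block_mono[of i j] by (auto simp: legit_pair_def)
  ultimately show "b \<in> {\<epsilon> i - \<epsilon> j | i j. legit i j \<and> \<pi> i \<le> \<pi> j}" by blast
next
  fix b assume "b \<in> {\<epsilon> i - \<epsilon> j | i j. legit i j \<and> \<pi> i \<le> \<pi> j}"
  then obtain i j where ij: "legit i j" "b = \<epsilon> i - \<epsilon> j" "\<pi> i \<le> \<pi> j" by blast
  have "i \<in> {1..n}" "j \<in> {1..n}" using ij(1) by (auto simp: legit_pair_def)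
  then have "\<pi> i = \<pi> j \<or> i < j"
    using block_less[of i j] ij(3) by (cases "\<pi> i = \<pi> j") auto
  with ij show "b \<in> pos_roots D P \<union> sub_roots D I"
    unfolding pos_roots_eq sub_roots_eq by blast
qed

lemma nilradical_roots_eq:
  "pos_roots D P - sub_roots D I = {\<epsilon> i - \<epsilon> j | i j. legit i j \<and> \<pi> i < \<pi> j}"
proof (intro equalityI subsetI)
  fix b assume b: "b \<in> pos_roots D P - sub_roots D I"
  then obtain i j where ij: "legit i j" "b = \<epsilon> i - \<epsilon> j" "i < j"
    unfolding pos_roots_eq by blast
  have "\<pi> i \<noteq> \<pi> j"
    using b ij unfolding sub_roots_eq by blast
  moreover have "\<pi> i \<le> \<pi> j"
    using ij block_mono[of i j] by (simp add: legit_pair_def)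
  ultimately have "\<pi> i < \<pi> j" by simp
  with ij show "b \<in> {\<epsilon> i - \<epsilon> j | i j. legit i j \<and> \<pi> i < \<pi> j}" by blast
next
  fix b assume "b \<in> {\<epsilon> i - \<epsilon> j | i j. legit i j \<and> \<pi> i < \<pi> j}"
  then obtain i j where ij: "legit i j" "b = \<epsilon> i - \<epsilon> j" "\<pi> i < \<pi> j" by blast
  then have "i < j" using block_less[of i j] by (auto simp: legit_pair_def)
  moreover have "b \<notin> sub_roots D I"
  proof
    assume "b \<in> sub_roots D I"
    then obtain u v where "legit u v" "b = \<epsilon> u - \<epsilon> v" "\<pi> u = \<pi> v"
      unfolding sub_roots_eq by blast
    then show False
      using block_less_if_same_root[of u v i j] ij by auto
  qed
  ultimately show "b \<in> pos_roots D P - sub_roots D I"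
    using ij unfolding pos_roots_eq by blast
qed

end

section \<open>Ideals in unfolded coordinates\<close>

context parabolic_coordinates
begin

lemma F_sets_add:
  "F \<in> F_sets D P I \<Longrightarrow> a \<in> F \<Longrightarrow> b \<in> pos_roots D P \<union> sub_roots D I \<Longrightarrow>
    a + b \<in> pos_roots D P \<Longrightarrow> a + b \<in> F"
  unfolding F_sets_def by blast

lemma F_sets_closed:
  assumes F: "F \<in> F_sets D P I" and a: "\<epsilon> i - \<epsilon> j \<in> F" and legit: "legit i k" "legit j k"
    and blocks: "\<pi> j \<le> \<pi> k" "\<pi> i < \<pi> k"
  shows "\<epsilon> i - \<epsilon> k \<in> F"
proof -
  have "\<epsilon> j - \<epsilon> k \<in> pos_roots D P \<union> sub_roots D I"
    unfolding parabolic_roots_eq using legit blocks by blast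
  moreover have "\<epsilon> i - \<epsilon> k = (\<epsilon> i - \<epsilon> j) + (\<epsilon> j - \<epsilon> k)" by simp
  moreover have "i < k" using legit blocks block_less by (auto simp: legit_pair_def)
  then have "\<epsilon> i - \<epsilon> k \<in> pos_roots D P"
    unfolding pos_roots_eq using legit by blast
  ultimately show ?thesis
    using F_sets_add[OF F a] by metis
qed

lemma F_sets_closed':
  assumes F: "F \<in> F_sets D P I" and a: "\<epsilon> i - \<epsilon> j \<in> F" and legit: "legit k j" "legit k i"
    and blocks: "\<pi> k \<le> \<pi> i" "\<pi> k < \<pi> j"
  shows "\<epsilon> k - \<epsilon> j \<in> F"
proof -
  have "\<epsilon> k - \<epsilon> i \<in> pos_roots D P \<union> sub_roots D I"
    unfolding parabolic_roots_eq using legit blocks by blast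
  moreover have "\<epsilon> k - \<epsilon> j = (\<epsilon> i - \<epsilon> j) + (\<epsilon> k - \<epsilon> i)" by simp
  moreover have "k < j" using legit blocks block_less by (auto simp: legit_pair_def)
  then have "\<epsilon> k - \<epsilon> j \<in> pos_roots D P"
    unfolding pos_roots_eq using legit by blast
  ultimately show ?thesis
    using F_sets_add[OF F a] by metis
qed

lemma F_sets_subset: "F \<in> F_sets D P I \<Longrightarrow> F \<subseteq> {\<epsilon> i - \<epsilon> j | i j. legit i j \<and> \<pi> i < \<pi> j}"
  unfolding F_sets_def nilradical_roots_eq by blast

text \<open>
  By \<open>root_sum_cancels\<close>, adding a root replaces one of the two indices. In the folded case the added root
  may first have to be rewritten in its other form.
\<close>

lemma root_sumE:
  assumes a: "legit i j" and b: "b \<in> pos_roots D P \<union> sub_roots D I"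
    and sum: "\<epsilon> i - \<epsilon> j + b \<in> pos_roots D P"
  obtains k where "legit i k" "legit j k" "\<pi> j \<le> \<pi> k" "\<epsilon> i - \<epsilon> j + b = \<epsilon> i - \<epsilon> k"
  | k where "legit k j" "legit k i" "\<pi> k \<le> \<pi> i" "\<epsilon> i - \<epsilon> j + b = \<epsilon> k - \<epsilon> j"
proof -
  obtain h k where hk: "legit h k" "b = \<epsilon> h - \<epsilon> k" "\<pi> h \<le> \<pi> k"
    using b unfolding parabolic_roots_eq by blast
  obtain u v where uv: "legit u v" "\<epsilon> i - \<epsilon> j + b = \<epsilon> u - \<epsilon> v"
    using sum unfolding pos_roots_eq by blast
  have mem: "i \<in> {1..n}" "j \<in> {1..n}" "h \<in> {1..n}" "k \<in> {1..n}" "h \<noteq> k" "diag \<or> h + k \<noteq> n + 1"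
    using a hk by (auto simp: legit_pair_def)
  note right_case = that(1) and left_case = that(2)
  have right: thesis if "legit j t" "b = \<epsilon> j - \<epsilon> t" "\<pi> j \<le> \<pi> t" for t
  proof (rule right_case[of t])
    have eq: "\<epsilon> i - \<epsilon> j + b = \<epsilon> i - \<epsilon> t" using that by simp
    then show "\<epsilon> i - \<epsilon> j + b = \<epsilon> i - \<epsilon> t" .
    show "legit i t"
      using legit_if_root[of i t u v] mem that(1) uv eq by (simp add: legit_pair_def)
  qed (use that in auto)
  have left: thesis if "legit t i" "b = \<epsilon> t - \<epsilon> i" "\<pi> t \<le> \<pi> i" for t
  proof (rule left_case[of t])
    have eq: "\<epsilon> i - \<epsilon> j + b = \<epsilon> t - \<epsilon> j" using that by simp
    then show "\<epsilon> i - \<epsilon> j + b = \<epsilon> t - \<epsilon> j" .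
    show "legit t j"
      using legit_if_root[of t j u v] mem that(1) uv eq by (simp add: legit_pair_def)
  qed (use that in auto)
  have cases: "j = h \<or> i = k \<or> symm \<and> (j + k = n + 1 \<or> i + h = n + 1)"
    using root_sum_cancels[of i j h k u v] uv hk a by simp
  then consider "j = h" | "i = k" | "symm" "j + k = n + 1" | "symm" "i + h = n + 1" by blast
  then show thesis
  proof cases
    case 1
    then show ?thesis using right[of k] hk by simp
  next
    case 2
    then show ?thesis using left[of h] hk by simp
  next
    case 3
    let ?t = "n + 1 - h"
    have "\<epsilon> ?t = - \<epsilon> h" "\<pi> ?t + \<pi> h = N + 1"
      using symmetric[of h] block_symm[of h] 3 mem by auto
    moreover have "\<epsilon> k = - \<epsilon> j" "\<pi> k + \<pi> j = N + 1"
      using dual_block[of k j] 3 mem by (auto simp: add.commute)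
    moreover have "legit j ?t"
      using mem 3 by (auto simp: legit_pair_def)
    ultimately show ?thesis using right[of ?t] hk by simp
  next
    case 4
    let ?t = "n + 1 - k"
    have "\<epsilon> ?t = - \<epsilon> k" "\<pi> ?t + \<pi> k = N + 1"
      using symmetric[of k] block_symm[of k] 4 mem by auto
    moreover have "\<epsilon> h = - \<epsilon> i" "\<pi> h + \<pi> i = N + 1"
      using dual_block[of h i] 4 mem by (auto simp: add.commute)
    moreover have "legit ?t i"
      using mem 4 by (auto simp: legit_pair_def)
    ultimately show ?thesis using left[of ?t] hk by simp
  qed
qed

text \<open>
  Every pair of distinct indices is a root here, so both indices of a root can be moved freely within the
  block order, one after the other.
\<close>

lemma card_F_sets_nonsymmetric:
  assumes ns: "\<not> symm"
  shows "real (card (F_sets D P I)) = catalan N"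
proof -
  have diag using ns diag_unless_symm by simp
  define L where "L = {(i, j). legit i j \<and> \<pi> i < \<pi> j}"
  define \<rho> where "\<rho> = (\<lambda>(i, j). \<epsilon> i - \<epsilon> j)"
  define f where "f = (\<lambda>(i, j). (\<pi> i, N + 1 - \<pi> j))"
  have img: "\<rho> ` L = {\<epsilon> i - \<epsilon> j | i j. legit i j \<and> \<pi> i < \<pi> j}"
    by (force simp: \<rho>_def L_def)
  have range: "\<pi> i \<in> {1..N}" if "i \<in> {1..n}" for i
    using block_surj that by blast
  have "F_sets D P I = {F. F \<subseteq> \<rho> ` L \<and> (\<forall>x\<in>L. \<forall>y\<in>L. \<rho> x \<in> F \<and> cell_le (f y) (f x) \<longrightarrow> \<rho> y \<in> F)}"
    (is "_ = ?rhs")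
  proof (intro equalityI subsetI)
    fix F assume F: "F \<in> F_sets D P I"
    have "\<rho> y \<in> F" if x: "x \<in> L" and y: "y \<in> L"
      and le: "\<rho> x \<in> F \<and> cell_le (f y) (f x)" for x y
    proof -
    obtain i j where ij: "x = (i, j)" "legit i j" "\<pi> i < \<pi> j" using x by (auto simp: L_def)
    obtain u v where uv: "y = (u, v)" "legit u v" "\<pi> u < \<pi> v" using y by (auto simp: L_def)
    have mem: "i \<in> {1..n}" "j \<in> {1..n}" "u \<in> {1..n}" "v \<in> {1..n}"
      using ij uv by (auto simp: legit_pair_def)
    have "\<pi> u \<le> \<pi> i" "\<pi> j \<le> \<pi> v"
      using le range[OF mem(2)] range[OF mem(4)] by (auto simp: f_def cell_le_def ij uv)
    have leg: "legit s t" if "s \<in> {1..n}" "t \<in> {1..n}" "s \<noteq> t" for s t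
      using that \<open>diag\<close> by (simp add: legit_pair_def)
    have "u \<noteq> j" "u \<noteq> v" using \<open>\<pi> u \<le> \<pi> i\<close> ij(3) uv(3) by auto
    have "\<epsilon> i - \<epsilon> j \<in> F" using le by (simp add: \<rho>_def ij)
    then have "\<epsilon> u - \<epsilon> j \<in> F"
      using F_sets_closed'[OF F, of i j u] leg[of u j] leg[of u i] mem \<open>u \<noteq> j\<close> \<open>\<pi> u \<le> \<pi> i\<close> ij(3)
      by (cases "u = i") auto
    then have "\<epsilon> u - \<epsilon> v \<in> F"
      using F_sets_closed[OF F, of u j v] leg[of u v] leg[of j v] mem \<open>u \<noteq> v\<close> \<open>\<pi> j \<le> \<pi> v\<close> uv(3)
      by (cases "v = j") auto
    then show "\<rho> y \<in> F" by (simp add: \<rho>_def uv)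
    qed
    moreover have "F \<subseteq> \<rho> ` L"
      using F_sets_subset[OF F] img by simp
    ultimately show "F \<in> ?rhs" by blast
  next
    fix F assume "F \<in> ?rhs"
    then have FL: "F \<subseteq> \<rho> ` L" and closed: "\<And>x y. x \<in> L \<Longrightarrow> y \<in> L \<Longrightarrow> \<rho> x \<in> F \<Longrightarrow> cell_le (f y) (f x) \<Longrightarrow> \<rho> y \<in> F"
      by blast+
    have "F \<subseteq> pos_roots D P - sub_roots D I"
      unfolding nilradical_roots_eq using FL img by simp
    moreover have "a + b \<in> F" if a: "a \<in> F" and b: "b \<in> pos_roots D P \<union> sub_roots D I"
      and sum: "a + b \<in> pos_roots D P" for a b
    proof -
      obtain i j where ij: "a = \<epsilon> i - \<epsilon> j" "legit i j" "\<pi> i < \<pi> j"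
        using a FL img by blast
      then have x: "(i, j) \<in> L" "\<rho> (i, j) \<in> F"
        using a by (auto simp: L_def \<rho>_def)
      from sum[unfolded ij(1)] show ?thesis
      proof (rule root_sumE[OF ij(2) b])
        fix k assume k: "legit i k" "\<pi> j \<le> \<pi> k" "\<epsilon> i - \<epsilon> j + b = \<epsilon> i - \<epsilon> k"
        then have "\<rho> (i, k) \<in> F"
          by (intro closed[OF x(1) _ x(2)]) (use ij in \<open>auto simp: L_def f_def cell_le_def\<close>)
        then show ?thesis unfolding ij(1) k(3) by (simp add: \<rho>_def)
      next
        fix k assume k: "legit k j" "\<pi> k \<le> \<pi> i" "\<epsilon> i - \<epsilon> j + b = \<epsilon> k - \<epsilon> j"
        then have "\<rho> (k, j) \<in> F"
          by (intro closed[OF x(1) _ x(2)]) (use ij in \<open>auto simp: L_def f_def cell_le_def\<close>)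
        then show ?thesis unfolding ij(1) k(3) by (simp add: \<rho>_def)
      qed
    qed
    ultimately show "F \<in> F_sets D P I" unfolding F_sets_def by blast
  qed
  also have "card \<dots> = card (downsets (f ` L))"
  proof (rule card_downsets_pullback)
    fix x y assume xy: "x \<in> L" "y \<in> L" "\<rho> x = \<rho> y"
    obtain i j u v where [simp]: "x = (i, j)" "y = (u, v)" by force
    show "f x = f y"
      using same_block_if_same_root[of i j u v] ns xy by (simp add: L_def \<rho>_def f_def)
  qed
  also have "f ` L = {(p, q). 1 \<le> p \<and> 1 \<le> q \<and> p + q \<le> N}"
  proof (intro equalityI subsetI)
    fix z assume "z \<in> f ` L"
    then obtain i j where "legit i j" "\<pi> i < \<pi> j" "z = (\<pi> i, N + 1 - \<pi> j)"
      by (auto simp: L_def f_def)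
    then show "z \<in> {(p, q). 1 \<le> p \<and> 1 \<le> q \<and> p + q \<le> N}"
      using range[of i] range[of j] by (auto simp: legit_pair_def)
  next
    fix z assume "z \<in> {(p, q). 1 \<le> p \<and> 1 \<le> q \<and> p + q \<le> N}"
    then obtain p q where z: "z = (p, q)" "1 \<le> p" "1 \<le> q" "p + q \<le> N" by blast
    then have "p \<in> \<pi> ` {1..n}" "N + 1 - q \<in> \<pi> ` {1..n}"
      unfolding block_surj by auto
    then obtain i j where ij: "i \<in> {1..n}" "\<pi> i = p" "j \<in> {1..n}" "\<pi> j = N + 1 - q" by force
    then have "(i, j) \<in> L" "f (i, j) = z"
      using z \<open>diag\<close> by (auto simp: L_def f_def legit_pair_def)
    then show "z \<in> f ` L" by (metis imageI)
  qed
  finally show ?thesis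
    using card_downsets_staircase[of N] by simp
qed

end

section \<open>Ideals in folded coordinates\<close>

text \<open>
  The pairs of indices for which the sum \<open>\<epsilon> a + \<epsilon> b\<close> is a root, in folded coordinates.
\<close>

definition legit_sum :: "nat \<Rightarrow> bool \<Rightarrow> nat \<Rightarrow> nat \<Rightarrow> bool" where
  "legit_sum n diag a b \<longleftrightarrow> a \<in> {1..n} \<and> b \<in> {1..n} \<and> a + b \<noteq> n + 1 \<and> (diag \<or> a \<noteq> b)"

lemma legit_sum_commute: "legit_sum n diag a b \<longleftrightarrow> legit_sum n diag b a"
  by (auto simp: legit_sum_def add.commute)

lemma legit_sum_iff:
  assumes "b \<in> {1..n}"
  shows "legit_sum n diag a b \<longleftrightarrow> legit_pair n diag a (n + 1 - b)"
  using assms by (auto simp: legit_sum_def legit_pair_def)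

context block_coordinates
begin

definition sum_cells :: "(nat \<times> nat) set" where
  "sum_cells = {(a, b). legit_sum n diag a b \<and> \<pi> a + \<pi> b \<le> N}"

definition sum_root :: "nat \<times> nat \<Rightarrow> 'g \<Rightarrow> complex" where
  "sum_root = (\<lambda>(a, b). \<epsilon> a + \<epsilon> b)"

definition block_cell :: "nat \<times> nat \<Rightarrow> nat \<times> nat" where
  "block_cell = (\<lambda>(a, b). (min (\<pi> a) (\<pi> b), max (\<pi> a) (\<pi> b)))"

text \<open>
  The blocks below the middle that carry a root \<open>\<epsilon> a + \<epsilon> b\<close> with both indices in the block.
\<close>

definition big_blocks :: "nat set" where
  "big_blocks = {p. 1 \<le> p \<and> 2 * p \<le> N \<and>
     (diag \<or> (\<exists>a\<in>{1..n}. \<exists>b\<in>{1..n}. a \<noteq> b \<and> \<pi> a = p \<and> \<pi> b = p))}"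

text \<open>
  Closure under replacing the index \<open>a\<close> of a root by \<open>a'\<close> whenever \<open>mv a' a\<close> holds and the result is a root.
  The relation is a parameter because type \<open>D\<close> requires larger ones than the roots provide.
\<close>

definition move_closed :: "(nat \<Rightarrow> nat \<Rightarrow> bool) \<Rightarrow> ('g \<Rightarrow> complex) set \<Rightarrow> bool" where
  "move_closed mv F \<longleftrightarrow> (\<forall>a b a'. (a, b) \<in> sum_cells \<longrightarrow> \<epsilon> a + \<epsilon> b \<in> F \<longrightarrow>
     legit_sum n diag a' b \<longrightarrow> mv a' a \<longrightarrow> \<epsilon> a' + \<epsilon> b \<in> F)"

lemma move_closedD:
  "move_closed mv F \<Longrightarrow> (a, b) \<in> sum_cells \<Longrightarrow> \<epsilon> a + \<epsilon> b \<in> F \<Longrightarrow>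
    legit_sum n diag a' b \<Longrightarrow> mv a' a \<Longrightarrow> \<epsilon> a' + \<epsilon> b \<in> F"
  unfolding move_closed_def by blast

lemma block_range: "i \<in> {1..n} \<Longrightarrow> \<pi> i \<in> {1..N}"
  using block_surj by blast

lemma sum_as_root:
  assumes symm "b \<in> {1..n}"
  shows "\<epsilon> a - \<epsilon> (n + 1 - b) = \<epsilon> a + \<epsilon> b"
  using symmetric[OF assms] by simp

lemma sum_root_eq:
  assumes symm "legit_sum n diag a b" "legit_sum n diag u v" "\<epsilon> a + \<epsilon> b = \<epsilon> u + \<epsilon> v"
  shows "u = a \<and> v = b \<or> u = b \<and> v = a"
proof -
  have mem: "a \<in> {1..n}" "b \<in> {1..n}" "u \<in> {1..n}" "v \<in> {1..n}"
    using assms(2,3) by (auto simp: legit_sum_def)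
  have "\<epsilon> a - \<epsilon> (n + 1 - b) = \<epsilon> u - \<epsilon> (n + 1 - v)"
    using assms(4) by (simp only: sum_as_root[OF assms(1) mem(2)] sum_as_root[OF assms(1) mem(4)])
  then have "u = a \<and> n + 1 - v = n + 1 - b \<or> symm \<and> u = n + 1 - (n + 1 - b) \<and> n + 1 - v = n + 1 - a"
    by (rule root_eq) (use assms legit_sum_iff mem in blast)+
  then show ?thesis using mem by auto
qed

lemma no_dual: "symm \<Longrightarrow> s \<in> {1..n} \<Longrightarrow> t \<in> {1..n} \<Longrightarrow> \<pi> s + \<pi> t \<le> N \<Longrightarrow> s + t \<noteq> n + 1"
  using dual_block(1)[of s t] by auto

text \<open>
  The smaller index \<open>a\<close> is replaced by \<open>a'\<close>, then \<open>b\<close> by \<open>b'\<close>. The first step would fail if \<open>a'\<close> equals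
  \<open>b\<close>; then all four indices lie in one block and replacing \<open>a\<close> by \<open>b'\<close> suffices. The second step may
  not be available if \<open>b\<close> and \<open>b'\<close> are opposite, and then a detour through a third index \<open>c\<close> is taken. The
  smaller index has no such problem, as its block lies below the middle.
\<close>

lemma move_closed_downward:
  assumes symm: symm
    and mv_levi: "\<And>a a'. a \<in> {1..n} \<Longrightarrow> a' \<in> {1..n} \<Longrightarrow> \<pi> a' \<le> \<pi> a \<Longrightarrow>
      diag \<or> a' + a \<noteq> n + 1 \<Longrightarrow> mv a' a"
    and mv_dual: "\<And>b b' a'. b \<in> {1..n} \<Longrightarrow> b' \<in> {1..n} \<Longrightarrow> b' + b = n + 1 \<Longrightarrow> b' \<noteq> b \<Longrightarrow> \<pi> b' \<le> \<pi> b \<Longrightarrow>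
      a' \<in> {1..n} \<Longrightarrow> 2 * \<pi> a' \<le> N \<Longrightarrow>
      mv b' b \<or> (\<exists>c\<in>{1..n}. c \<noteq> b \<and> c \<noteq> b' \<and> c \<noteq> a' \<and> \<pi> b' \<le> \<pi> c \<and> \<pi> c \<le> \<pi> b)"
    and closed: "move_closed mv F"
    and ab: "(a, b) \<in> sum_cells" "\<epsilon> a + \<epsilon> b \<in> F" "\<pi> a \<le> \<pi> b"
    and ab': "(a', b') \<in> sum_cells" "\<pi> a' \<le> \<pi> b'"
    and le: "\<pi> a' \<le> \<pi> a" "\<pi> b' \<le> \<pi> b"
  shows "\<epsilon> a' + \<epsilon> b' \<in> F"
proof -
  have legit: "legit_sum n diag a b" "legit_sum n diag a' b'" and N: "\<pi> a + \<pi> b \<le> N" "\<pi> a' + \<pi> b' \<le> N"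
    using ab ab' by (auto simp: sum_cells_def)
  have mem: "a \<in> {1..n}" "b \<in> {1..n}" "a' \<in> {1..n}" "b' \<in> {1..n}"
    using legit by (auto simp: legit_sum_def)
  have step: "(c', d) \<in> sum_cells \<and> \<epsilon> c' + \<epsilon> d \<in> F"
    if "(c, d) \<in> sum_cells" "\<epsilon> c + \<epsilon> d \<in> F" "mv c' c" "\<pi> c' \<le> \<pi> c" "c' \<in> {1..n}" "diag \<or> c' \<noteq> d" for c d c'
  proof -
    have "\<pi> c' + \<pi> d \<le> N" "d \<in> {1..n}" using that by (auto simp: sum_cells_def legit_sum_def)
    then have "legit_sum n diag c' d"
      using no_dual[OF symm that(5)] that by (auto simp: legit_sum_def)
    with \<open>\<pi> c' + \<pi> d \<le> N\<close> that move_closedD[OF closed] show ?thesis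
      by (auto simp: sum_cells_def)
  qed
  show ?thesis
  proof (cases "diag \<or> a' \<noteq> b")
    case True
    have "a' + a \<noteq> n + 1"
      using no_dual[OF symm] mem le ab(3) N by auto
    then have "(a', b) \<in> sum_cells \<and> \<epsilon> a' + \<epsilon> b \<in> F"
      using step[OF ab(1,2) mv_levi] mem le True by blast
    then have ba: "(b, a') \<in> sum_cells" "\<epsilon> b + \<epsilon> a' \<in> F"
      using legit_sum_commute[of n diag a' b] by (auto simp: sum_cells_def add.commute)
    have ne: "diag \<or> b' \<noteq> a'" using legit(2) by (auto simp: legit_sum_def)
    have "\<epsilon> b' + \<epsilon> a' \<in> F"
    proof (cases "diag \<or> b' + b \<noteq> n + 1")
      case True
      then show ?thesis using step[OF ba mv_levi] mem le ne by blast
    next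
      case False
      show ?thesis
      proof (cases "b' = b")
        case False
        from mv_dual[OF mem(2,4) _ False le(2) mem(3)] \<open>\<not> (diag \<or> b' + b \<noteq> n + 1)\<close> ab'(2) N
        consider "mv b' b" | c where "c \<in> {1..n}" "c \<noteq> b" "c \<noteq> b'" "c \<noteq> a'" "\<pi> b' \<le> \<pi> c" "\<pi> c \<le> \<pi> b"
          by auto
        then show ?thesis
        proof cases
          case 1
          then show ?thesis using step[OF ba] mem le ne by blast
        next
          case 2
          have "c + b \<noteq> n + 1" "b' + c \<noteq> n + 1"
            using 2 \<open>\<not> (diag \<or> b' + b \<noteq> n + 1)\<close> by auto
          then have "(c, a') \<in> sum_cells \<and> \<epsilon> c + \<epsilon> a' \<in> F"
            using step[OF ba mv_levi] mem 2 by blast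
          then show ?thesis
            using step[of c a' b'] mv_levi[of c b'] \<open>b' + c \<noteq> n + 1\<close> mem 2 ne by blast
        qed
      qed (use ba in simp)
    qed
    then show ?thesis by (simp add: add.commute)
  next
    case False
    then have "\<pi> b' = \<pi> a" "a' = b"
      using le ab(3) ab'(2) by auto
    then have "b' + a \<noteq> n + 1"
      using no_dual[OF symm] mem ab(3) N by auto
    moreover have "diag \<or> b' \<noteq> b"
      using legit(2) \<open>a' = b\<close> by (auto simp: legit_sum_def)
    ultimately have "\<epsilon> b' + \<epsilon> b \<in> F"
      using step[OF ab(1,2) mv_levi] mem \<open>\<pi> b' = \<pi> a\<close> by simp
    then show ?thesis using \<open>a' = b\<close> by (simp add: add.commute)
  qed
qed

lemma block_cell_image:
  assumes symm: symm
  shows "block_cell ` sum_cells = shifted_cells N big_blocks"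
proof (intro equalityI subsetI)
  fix z assume "z \<in> block_cell ` sum_cells"
  then obtain a b where ab: "legit_sum n diag a b" "\<pi> a + \<pi> b \<le> N" "z = block_cell (a, b)"
    by (auto simp: sum_cells_def)
  then have "a \<in> {1..n}" "b \<in> {1..n}" "diag \<or> a \<noteq> b" by (auto simp: legit_sum_def)
  moreover have "\<pi> a \<in> big_blocks" if "\<pi> a = \<pi> b"
  proof -
    have "diag \<or> (\<exists>c\<in>{1..n}. \<exists>d\<in>{1..n}. c \<noteq> d \<and> \<pi> c = \<pi> a \<and> \<pi> d = \<pi> a)"
      using calculation that by metis
    then show ?thesis
      unfolding big_blocks_def using calculation ab(2) that block_range[of a] by simp
  qed
  ultimately show "z \<in> shifted_cells N big_blocks"
    using ab block_range[of a] block_range[of b]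
    by (auto simp: shifted_cells_def block_cell_def min_def max_def)
next
  fix z assume "z \<in> shifted_cells N big_blocks"
  then obtain p q where z: "z = (p, q)" "1 \<le> p" "p \<le> q" "p + q \<le> N" "p = q \<longrightarrow> p \<in> big_blocks"
    by (auto simp: shifted_cells_def)
  have "\<exists>a\<in>{1..n}. \<exists>b\<in>{1..n}. \<pi> a = p \<and> \<pi> b = q \<and> (diag \<or> a \<noteq> b)"
  proof (cases "p = q \<and> \<not> diag")
    case True
    then show ?thesis using z(5) unfolding big_blocks_def by blast
  next
    case False
    have "p \<in> \<pi> ` {1..n}" "q \<in> \<pi> ` {1..n}" unfolding block_surj using z by auto
    then obtain a b where "a \<in> {1..n}" "b \<in> {1..n}" "\<pi> a = p" "\<pi> b = q" by blast
    with False show ?thesis by blast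
  qed
  then obtain a b where ab: "a \<in> {1..n}" "b \<in> {1..n}" "\<pi> a = p" "\<pi> b = q" "diag \<or> a \<noteq> b" by blast
  then have "(a, b) \<in> sum_cells" "block_cell (a, b) = z"
    using no_dual[OF symm, of a b] z by (auto simp: sum_cells_def legit_sum_def block_cell_def)
  then show "z \<in> block_cell ` sum_cells" by (metis imageI)
qed

text \<open>
  Sets closed under moves are the order ideals of cells, provided that the moves contain those given by
  roots and that replacing an index by its opposite is either a move or possible in two steps.
\<close>

lemma card_move_closed:
  assumes symm: symm
    and mv_le: "\<And>a a'. a \<in> {1..n} \<Longrightarrow> mv a' a \<Longrightarrow> \<pi> a' \<le> \<pi> a"
    and mv_levi: "\<And>a a'. a \<in> {1..n} \<Longrightarrow> a' \<in> {1..n} \<Longrightarrow> \<pi> a' \<le> \<pi> a \<Longrightarrow>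
      diag \<or> a' + a \<noteq> n + 1 \<Longrightarrow> mv a' a"
    and mv_dual: "\<And>b b' a'. b \<in> {1..n} \<Longrightarrow> b' \<in> {1..n} \<Longrightarrow> b' + b = n + 1 \<Longrightarrow> b' \<noteq> b \<Longrightarrow> \<pi> b' \<le> \<pi> b \<Longrightarrow>
      a' \<in> {1..n} \<Longrightarrow> 2 * \<pi> a' \<le> N \<Longrightarrow>
      mv b' b \<or> (\<exists>c\<in>{1..n}. c \<noteq> b \<and> c \<noteq> b' \<and> c \<noteq> a' \<and> \<pi> b' \<le> \<pi> c \<and> \<pi> c \<le> \<pi> b)"
  shows "card {F. F \<subseteq> sum_root ` sum_cells \<and> move_closed mv F} =
    card (downsets (shifted_cells N big_blocks))"
proof -
  have sets: "{F. F \<subseteq> sum_root ` sum_cells \<and> move_closed mv F} =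
    {F. F \<subseteq> sum_root ` sum_cells \<and> (\<forall>x\<in>sum_cells. \<forall>y\<in>sum_cells.
      sum_root x \<in> F \<and> cell_le (block_cell y) (block_cell x) \<longrightarrow> sum_root y \<in> F)}"
  proof (intro Collect_cong conj_cong refl iffI)
    fix F assume closed: "move_closed mv F"
    have sorted: "\<exists>a b. (a, b) \<in> sum_cells \<and> \<pi> a \<le> \<pi> b \<and> block_cell x = (\<pi> a, \<pi> b) \<and> sum_root x = \<epsilon> a + \<epsilon> b"
      if x: "x \<in> sum_cells" for x
    proof -
      obtain a b where ab: "x = (a, b)" by force
      show ?thesis
      proof (cases "\<pi> a \<le> \<pi> b")
        case True
        then show ?thesis using x ab by (intro exI[of _ a] exI[of _ b]) (auto simp: block_cell_def sum_root_def)
      next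
        case False
        then show ?thesis
          using x ab legit_sum_commute[of n diag a b]
          by (intro exI[of _ b] exI[of _ a]) (auto simp: block_cell_def sum_root_def sum_cells_def add.commute)
      qed
    qed
    show "\<forall>x\<in>sum_cells. \<forall>y\<in>sum_cells.
      sum_root x \<in> F \<and> cell_le (block_cell y) (block_cell x) \<longrightarrow> sum_root y \<in> F"
    proof (intro ballI impI)
      fix x y assume x: "x \<in> sum_cells" and y: "y \<in> sum_cells"
        and le: "sum_root x \<in> F \<and> cell_le (block_cell y) (block_cell x)"
      from sorted[OF x] obtain a b where ab: "(a, b) \<in> sum_cells" "\<pi> a \<le> \<pi> b"
        "block_cell x = (\<pi> a, \<pi> b)" "sum_root x = \<epsilon> a + \<epsilon> b" by blast
      from sorted[OF y] obtain a' b' where ab': "(a', b') \<in> sum_cells" "\<pi> a' \<le> \<pi> b'"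
        "block_cell y = (\<pi> a', \<pi> b')" "sum_root y = \<epsilon> a' + \<epsilon> b'" by blast
      have "\<epsilon> a' + \<epsilon> b' \<in> F"
        by (rule move_closed_downward[OF symm mv_levi mv_dual closed, of a b])
          (use ab ab' le in \<open>auto simp: cell_le_def\<close>)
      then show "sum_root y \<in> F" using ab' by simp
    qed
  next
    fix F assume down: "\<forall>x\<in>sum_cells. \<forall>y\<in>sum_cells.
      sum_root x \<in> F \<and> cell_le (block_cell y) (block_cell x) \<longrightarrow> sum_root y \<in> F"
    show "move_closed mv F"
      unfolding move_closed_def
    proof (intro allI impI)
      fix a b a' assume ab: "(a, b) \<in> sum_cells" "\<epsilon> a + \<epsilon> b \<in> F" and legit: "legit_sum n diag a' b" and mv: "mv a' a"
      have le: "\<pi> a' \<le> \<pi> a"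
        using mv_le[OF _ mv] ab(1) by (auto simp: sum_cells_def legit_sum_def)
      then have "(a', b) \<in> sum_cells" using ab(1) legit by (auto simp: sum_cells_def)
      moreover have "cell_le (block_cell (a', b)) (block_cell (a, b))"
        using le by (auto simp: cell_le_def block_cell_def)
      moreover have "sum_root (a, b) \<in> F" using ab(2) by (simp add: sum_root_def)
      ultimately have "sum_root (a', b) \<in> F" using down ab(1) by blast
      then show "\<epsilon> a' + \<epsilon> b \<in> F" by (simp add: sum_root_def)
    qed
  qed
  show ?thesis
    unfolding sets block_cell_image[OF symm, symmetric]
  proof (rule card_downsets_pullback)
    fix x y assume xy: "x \<in> sum_cells" "y \<in> sum_cells" "sum_root x = sum_root y"
    obtain a b u v where [simp]: "x = (a, b)" "y = (u, v)" by force
    have "u = a \<and> v = b \<or> u = b \<and> v = a"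
      using sum_root_eq[OF symm, of a b u v] xy by (simp add: sum_cells_def sum_root_def)
    then show "block_cell x = block_cell y"
      by (auto simp: block_cell_def min.commute max.commute)
  qed
qed

end

context parabolic_coordinates
begin

definition levi_move :: "nat \<Rightarrow> nat \<Rightarrow> bool" where
  "levi_move a' a \<longleftrightarrow> a \<in> {1..n} \<and> a' \<in> {1..n} \<and> \<pi> a' \<le> \<pi> a \<and> (diag \<or> a' + a \<noteq> n + 1)"

lemma nilradical_sum_roots:
  assumes symm: symm
  shows "{\<epsilon> i - \<epsilon> j | i j. legit i j \<and> \<pi> i < \<pi> j} = sum_root ` sum_cells"
proof (intro equalityI subsetI)
  fix x assume "x \<in> {\<epsilon> i - \<epsilon> j | i j. legit i j \<and> \<pi> i < \<pi> j}"
  then obtain i j where ij: "legit i j" "\<pi> i < \<pi> j" "x = \<epsilon> i - \<epsilon> j" by blast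
  have j: "j \<in> {1..n}" "n + 1 - j \<in> {1..n}" "n + 1 - (n + 1 - j) = j"
    using ij(1) by (auto simp: legit_pair_def)
  have "legit_sum n diag i (n + 1 - j)"
    using legit_sum_iff[OF j(2)] j(3) ij(1) by simp
  moreover have "\<pi> i + \<pi> (n + 1 - j) \<le> N"
    using block_symm[OF symm j(1)] ij(2) by simp
  moreover have "x = \<epsilon> i + \<epsilon> (n + 1 - j)"
    using ij(3) symmetric[OF symm j(1)] by simp
  ultimately show "x \<in> sum_root ` sum_cells"
    by (force simp: sum_root_def sum_cells_def)
next
  fix x assume "x \<in> sum_root ` sum_cells"
  then obtain a b where ab: "legit_sum n diag a b" "\<pi> a + \<pi> b \<le> N" "x = \<epsilon> a + \<epsilon> b"
    by (auto simp: sum_root_def sum_cells_def)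
  have b: "b \<in> {1..n}" using ab(1) by (auto simp: legit_sum_def)
  have "\<pi> a < \<pi> (n + 1 - b)" using block_symm[OF symm b] ab(2) by simp
  moreover have "x = \<epsilon> a - \<epsilon> (n + 1 - b)" using ab(3) sum_as_root[OF symm b] by simp
  ultimately show "x \<in> {\<epsilon> i - \<epsilon> j | i j. legit i j \<and> \<pi> i < \<pi> j}"
    using legit_sum_iff[OF b] ab(1) by blast
qed

text \<open>
  Adding the root \<open>\<epsilon> a' - \<epsilon> a\<close> replaces \<open>a\<close> by \<open>a'\<close>, and by \<open>root_sumE\<close> there is no other way to add a root.
\<close>

lemma F_sets_symmetric:
  assumes symm: symm
  shows "F_sets D P I = {F. F \<subseteq> sum_root ` sum_cells \<and> move_closed levi_move F}"
proof (intro equalityI subsetI)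
  fix F assume F: "F \<in> F_sets D P I"
  have "F \<subseteq> sum_root ` sum_cells"
    using F_sets_subset[OF F] nilradical_sum_roots[OF symm] by simp
  moreover have "move_closed levi_move F"
    unfolding move_closed_def
  proof (intro allI impI)
    fix a b a' assume ab: "(a, b) \<in> sum_cells" "\<epsilon> a + \<epsilon> b \<in> F" and legit: "legit_sum n diag a' b"
      and mv: "levi_move a' a"
    have b: "b \<in> {1..n}" using legit by (auto simp: legit_sum_def)
    show "\<epsilon> a' + \<epsilon> b \<in> F"
    proof (cases "a' = a")
      case False
      have "\<epsilon> a - \<epsilon> (n + 1 - b) \<in> F" using ab(2) by (simp only: sum_as_root[OF symm b])
      moreover have "legit a' (n + 1 - b)" using legit legit_sum_iff[OF b] by simp
      moreover have "legit a' a" "\<pi> a' \<le> \<pi> a"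
        using mv False by (auto simp: levi_move_def legit_pair_def)
      moreover have "\<pi> a' < \<pi> (n + 1 - b)"
        using block_symm[OF symm b] ab(1) \<open>\<pi> a' \<le> \<pi> a\<close> by (simp add: sum_cells_def)
      ultimately have "\<epsilon> a' - \<epsilon> (n + 1 - b) \<in> F"
        by (rule F_sets_closed'[OF F])
      then show ?thesis by (simp only: sum_as_root[OF symm b])
    qed (use ab in simp)
  qed
  ultimately show "F \<in> {F. F \<subseteq> sum_root ` sum_cells \<and> move_closed levi_move F}" by simp
next
  fix F assume "F \<in> {F. F \<subseteq> sum_root ` sum_cells \<and> move_closed levi_move F}"
  then have sub: "F \<subseteq> sum_root ` sum_cells" and closed: "move_closed levi_move F" by auto
  have "F \<subseteq> pos_roots D P - sub_roots D I"
    unfolding nilradical_roots_eq nilradical_sum_roots[OF symm] by (rule sub)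
  moreover have "x + y \<in> F" if x: "x \<in> F" and y: "y \<in> pos_roots D P \<union> sub_roots D I"
    and sum: "x + y \<in> pos_roots D P" for x y
  proof -
    obtain a b where ab: "(a, b) \<in> sum_cells" "x = \<epsilon> a + \<epsilon> b"
      using x sub by (auto simp: sum_root_def)
    have mem: "a \<in> {1..n}" "b \<in> {1..n}" using ab(1) by (auto simp: sum_cells_def legit_sum_def)
    let ?j = "n + 1 - b"
    have j: "?j \<in> {1..n}" "\<pi> ?j + \<pi> b = N + 1" "legit a ?j" "x = \<epsilon> a - \<epsilon> ?j"
      using mem ab block_symm[OF symm mem(2)] legit_sum_iff[OF mem(2)] sum_as_root[OF symm mem(2)]
      by (auto simp: sum_cells_def)
    from sum[unfolded j(4)] show ?thesis
    proof (rule root_sumE[OF j(3) y])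
      fix k assume k: "legit k ?j" "legit k a" "\<pi> k \<le> \<pi> a" "\<epsilon> a - \<epsilon> ?j + y = \<epsilon> k - \<epsilon> ?j"
      have "levi_move k a" using k(2,3) by (auto simp: levi_move_def legit_pair_def)
      moreover have "legit_sum n diag k b" using k(1) legit_sum_iff[OF mem(2)] by simp
      ultimately have "\<epsilon> k + \<epsilon> b \<in> F"
        using move_closedD[OF closed ab(1)] x ab(2) by simp
      then show ?thesis unfolding j(4) k(4) by (simp only: sum_as_root[OF symm mem(2)])
    next
      fix k assume k: "legit a k" "legit ?j k" "\<pi> ?j \<le> \<pi> k" "\<epsilon> a - \<epsilon> ?j + y = \<epsilon> a - \<epsilon> k"
      have kn: "k \<in> {1..n}" using k(1) by (auto simp: legit_pair_def)
      let ?c = "n + 1 - k"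
      have c: "?c \<in> {1..n}" "n + 1 - ?c = k" "\<pi> ?c + \<pi> k = N + 1" "\<epsilon> ?c = - \<epsilon> k"
        using kn block_symm[OF symm kn] symmetric[OF symm kn] by auto
      have "levi_move ?c b" using k(2,3) c j(2) mem by (auto simp: levi_move_def legit_pair_def)
      moreover have "legit_sum n diag ?c a"
        using k(1) legit_sum_iff[OF c(1), of diag a] c(2) legit_sum_commute[of n diag ?c a] by simp
      moreover have "(b, a) \<in> sum_cells" "\<epsilon> b + \<epsilon> a \<in> F"
        using ab x legit_sum_commute[of n diag a b] by (auto simp: sum_cells_def add.commute)
      ultimately have "\<epsilon> ?c + \<epsilon> a \<in> F"
        using move_closedD[OF closed] by blast
      then show ?thesis unfolding j(4) k(4) using c(4) by (simp add: add.commute)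
    qed
  qed
  ultimately show "F \<in> F_sets D P I" unfolding F_sets_def by blast
qed

lemma card_F_sets_symmetric:
  assumes symm: symm
    and dual: "\<And>b b' a'. b \<in> {1..n} \<Longrightarrow> b' \<in> {1..n} \<Longrightarrow> b' + b = n + 1 \<Longrightarrow> b' \<noteq> b \<Longrightarrow> \<pi> b' \<le> \<pi> b \<Longrightarrow>
      a' \<in> {1..n} \<Longrightarrow> 2 * \<pi> a' \<le> N \<Longrightarrow>
      diag \<or> (\<exists>c\<in>{1..n}. c \<noteq> b \<and> c \<noteq> b' \<and> c \<noteq> a' \<and> \<pi> b' \<le> \<pi> c \<and> \<pi> c \<le> \<pi> b)"
  shows "card (F_sets D P I) = card (downsets (shifted_cells N big_blocks))"
  unfolding F_sets_symmetric[OF symm]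
proof (rule card_move_closed[OF symm])
  fix b b' a' assume "b \<in> {1..n}" "b' \<in> {1..n}" "b' + b = n + 1" "b' \<noteq> b" "\<pi> b' \<le> \<pi> b"
    "a' \<in> {1..n}" "2 * \<pi> a' \<le> N"
  then show "levi_move b' b \<or> (\<exists>c\<in>{1..n}. c \<noteq> b \<and> c \<noteq> b' \<and> c \<noteq> a' \<and> \<pi> b' \<le> \<pi> c \<and> \<pi> c \<le> \<pi> b)"
    using dual[of b b' a'] by (auto simp: levi_move_def)
qed (auto simp: levi_move_def)

end

section \<open>The fork of type D\<close>

context block_coordinates
begin

lemma move_closed_disj:
  "move_closed (\<lambda>a' a. mv a' a \<or> mv' a' a) F \<longleftrightarrow> move_closed mv F \<and> move_closed mv' F"
  unfolding move_closed_def by blast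

lemma move_closed_single:
  "move_closed (\<lambda>a' a. a' = s \<and> a = t) F \<longleftrightarrow>
    (\<forall>b. (t, b) \<in> sum_cells \<longrightarrow> \<epsilon> t + \<epsilon> b \<in> F \<longrightarrow> legit_sum n diag s b \<longrightarrow> \<epsilon> s + \<epsilon> b \<in> F)"
  unfolding move_closed_def by blast

lemma finite_sum_cells: "finite sum_cells"
  by (rule finite_subset[of _ "{1..n} \<times> {1..n}"]) (auto simp: sum_cells_def legit_sum_def)

end

text \<open>
  Type \<open>D\<close> with \<open>{l}\<close> and \<open>{l + 1}\<close> as the two middle blocks. No root moves one of these indices to the other,
  and no third index lies between them.
\<close>

locale fork_coordinates = parabolic_coordinates n \<epsilon> symm diag \<pi> N D P I
  for n and \<epsilon> :: "nat \<Rightarrow> 'g \<Rightarrow> complex" and symm diag \<pi> N D P I +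
  fixes l :: nat
  assumes symm: symm and no_diag: "\<not> diag" and n_eq: "n = 2 * l" and l_ge: "2 \<le> l"
    and block_last: "\<pi> (l - 1) < \<pi> l" "\<pi> l < \<pi> (l + 1)"
begin

lemma N_eq: "N = 2 * \<pi> l" and block_next: "\<pi> (l + 1) = \<pi> l + 1"
proof -
  have sum: "\<pi> l + \<pi> (l + 1) = N + 1"
    using block_symm[OF symm, of l] n_eq l_ge by (simp add: mult_2)
  then have "\<pi> l + 1 \<in> \<pi> ` {1..n}"
    unfolding block_surj using block_last by simp
  then obtain i where i: "i \<in> {1..n}" "\<pi> i = \<pi> l + 1" by force
  then have "l + 1 \<le> i"
    using block_mono[of i l] l_ge n_eq by force
  then have "\<pi> (l + 1) \<le> \<pi> i"
    using block_mono[of "l + 1" i] i by simp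
  with i block_last sum show "N = 2 * \<pi> l" "\<pi> (l + 1) = \<pi> l + 1" by auto
qed

lemma block_less_l: "i \<in> {1..n} \<Longrightarrow> i < l \<Longrightarrow> \<pi> i < \<pi> l"
proof -
  assume i: "i \<in> {1..n}" "i < l"
  then have "l - 1 \<in> {1..n}" "i \<le> l - 1" using n_eq by auto
  then show ?thesis using block_mono[OF i(1)] block_last(1) by force
qed

lemma block_le_l: "i \<in> {1..n} \<Longrightarrow> i \<le> l \<Longrightarrow> \<pi> i \<le> \<pi> l"
  using block_mono[of i "l"] l_ge n_eq by auto

lemma block_gt_l: "i \<in> {1..n} \<Longrightarrow> l < i \<Longrightarrow> \<pi> l + 1 \<le> \<pi> i"
  using block_mono[of "l + 1" i] block_next l_ge n_eq by auto

lemma block_gt_next: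
  assumes "i \<in> {1..n}" "l + 1 < i" shows "\<pi> l + 1 < \<pi> i"
proof -
  have "n + 1 - i \<in> {1..n}" "n + 1 - i < l" using assms n_eq by auto
  from block_less_l[OF this] block_symm[OF symm assms(1)] N_eq show ?thesis by simp
qed

lemma middle_mem: "l \<in> {1..n}" "l + 1 \<in> {1..n}"
  using n_eq l_ge by auto

abbreviation down_move :: "nat \<Rightarrow> nat \<Rightarrow> bool" where
  "down_move a' a \<equiv> a' = l \<and> a = l + 1"

abbreviation up_move :: "nat \<Rightarrow> nat \<Rightarrow> bool" where
  "up_move a' a \<equiv> a' = l + 1 \<and> a = l"

lemma card_closed_down:
  "card {F. F \<subseteq> sum_root ` sum_cells \<and> move_closed (\<lambda>a' a. levi_move a' a \<or> down_move a' a) F} =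
    card (downsets (shifted_cells N big_blocks))"
proof (rule card_move_closed[OF symm])
  fix b b' a' assume b: "b \<in> {1..n}" "b' \<in> {1..n}" "b' + b = n + 1" "\<pi> b' \<le> \<pi> b"
  show "(levi_move b' b \<or> down_move b' b) \<or>
    (\<exists>c\<in>{1..n}. c \<noteq> b \<and> c \<noteq> b' \<and> c \<noteq> a' \<and> \<pi> b' \<le> \<pi> c \<and> \<pi> c \<le> \<pi> b)"
  proof (cases "b = l + 1")
    case True
    then show ?thesis using b n_eq by simp
  next
    case False
    have "l < b"
      using block_le_l[of b] block_gt_l[of b'] b n_eq by force
    with False b have b': "b' < l" "l + 1 < b" using n_eq by auto
    have "\<pi> b' \<le> \<pi> l" "\<pi> l + 1 \<le> \<pi> b"
      using block_le_l[of b'] block_gt_l[of b] b b' by auto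
    then have "\<forall>c\<in>{l, l + 1}. c \<noteq> b \<and> c \<noteq> b' \<and> \<pi> b' \<le> \<pi> c \<and> \<pi> c \<le> \<pi> b"
      using block_next b' by auto
    moreover have "l \<noteq> a' \<or> l + 1 \<noteq> a'" by simp
    ultimately show ?thesis using middle_mem by blast
  qed
qed (use block_last in \<open>auto simp: levi_move_def\<close>)

text \<open>
  The block numbers after uniting the two middle blocks. If both replacements are moves, the middle
  indices cannot be told apart and the cells are those of this coarser numbering.
\<close>

definition merged :: "nat \<Rightarrow> nat" where
  "merged i = (if i \<le> l then \<pi> i else \<pi> i - 1)"

lemma block_coordinates_merged: "block_coordinates n \<epsilon> symm diag merged (N - 1)"
proof unfold_locales
  fix i j assume ij: "i \<in> {1..n}" "j \<in> {1..n}" "i \<le> j"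
  then show "merged i \<le> merged j"
    using block_mono[OF ij] block_le_l[of i] block_gt_l[of j] by (auto simp: merged_def)
next
  show "merged ` {1..n} = {1..N - 1}"
  proof (intro equalityI subsetI)
    fix p assume "p \<in> merged ` {1..n}"
    then obtain i where i: "i \<in> {1..n}" "p = merged i" by blast
    then show "p \<in> {1..N - 1}"
      using block_range[OF i(1)] block_le_l[of i] block_gt_l[of i] N_eq block_range[OF middle_mem(1)]
      by (cases "i \<le> l") (auto simp: merged_def)
  next
    fix p assume p: "p \<in> {1..N - 1}"
    show "p \<in> merged ` {1..n}"
    proof (cases "p \<le> \<pi> l")
      case True
      then have "p \<in> \<pi> ` {1..n}" unfolding block_surj using p by auto
      then obtain i where "i \<in> {1..n}" "p = \<pi> i" by blast
      moreover from this True have "i \<le> l" using block_gt_l[of i] by force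
      ultimately show ?thesis by (auto simp: merged_def)
    next
      case False
      then have "p + 1 \<in> \<pi> ` {1..n}" unfolding block_surj using p by auto
      then obtain i where i: "i \<in> {1..n}" "\<pi> i = p + 1" by force
      moreover from i False have "\<not> i \<le> l" using block_le_l[of i] by force
      ultimately have "merged i = p" by (simp add: merged_def)
      with i(1) show ?thesis by blast
    qed
  qed
next
  fix i assume i: symm "i \<in> {1..n}"
  moreover have "n + 1 - i \<in> {1..n}" using i(2) by auto
  ultimately show "merged (n + 1 - i) + merged i = N - 1 + 1"
    using block_symm[OF i] block_gt_l[of i] block_gt_l[of "n + 1 - i"] N_eq block_range[OF middle_mem(1)] n_eq
    by (cases "i \<le> l") (auto simp: merged_def)
qed

lemma sum_cells_merged: "block_coordinates.sum_cells n diag merged (N - 1) = sum_cells"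
proof -
  interpret mg: block_coordinates n \<epsilon> symm diag merged "N - 1"
    by (rule block_coordinates_merged)
  have "merged a + merged b \<le> N - 1 \<longleftrightarrow> \<pi> a + \<pi> b \<le> N" if "legit_sum n diag a b" for a b
  proof -
    have ab: "a \<in> {1..n}" "b \<in> {1..n}" "a \<noteq> b"
      using that no_diag by (auto simp: legit_sum_def)
    have "1 \<le> \<pi> l" using block_range[OF middle_mem(1)] by simp
    show ?thesis
    proof (cases "a \<le> l \<and> b \<le> l")
      case True
      then have "a < l \<or> b < l" using ab by auto
      then have "\<pi> a + \<pi> b < N"
        using block_less_l[of a] block_less_l[of b] block_le_l[of a] block_le_l[of b] ab True N_eq by auto
      with True show ?thesis by (simp add: merged_def)
    next
      case False
      then show ?thesis
        using block_gt_l[of a] block_gt_l[of b] ab N_eq \<open>1 \<le> \<pi> l\<close>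
        by (cases "a \<le> l"; cases "b \<le> l") (auto simp: merged_def)
    qed
  qed
  then show ?thesis unfolding mg.sum_cells_def sum_cells_def by blast
qed

lemma big_blocks_merged: "block_coordinates.big_blocks n diag merged (N - 1) = big_blocks"
proof -
  interpret mg: block_coordinates n \<epsilon> symm diag merged "N - 1"
    by (rule block_coordinates_merged)
  have l1: "1 \<le> \<pi> l" using block_range[OF middle_mem(1)] by simp
  have same: "merged i = p \<longleftrightarrow> \<pi> i = p" if "i \<in> {1..n}" "p < \<pi> l" for i p
    using that block_gt_l[of i] by (auto simp: merged_def)
  have unique: "i = l" if "i \<in> {1..n}" "\<pi> i = \<pi> l" for i
    using that block_less_l[of i] block_gt_l[of i] by (cases i l rule: linorder_cases) auto
  show ?thesis
  proof (intro equalityI subsetI)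
    fix p assume "p \<in> mg.big_blocks"
    then have p: "1 \<le> p" "2 * p \<le> N - 1" "\<exists>a\<in>{1..n}. \<exists>b\<in>{1..n}. a \<noteq> b \<and> merged a = p \<and> merged b = p"
      unfolding mg.big_blocks_def using no_diag by blast+
    then have "p < \<pi> l" using N_eq l1 by simp
    with p same show "p \<in> big_blocks" unfolding big_blocks_def by auto
  next
    fix p assume "p \<in> big_blocks"
    then have p: "1 \<le> p" "2 * p \<le> N" "\<exists>a\<in>{1..n}. \<exists>b\<in>{1..n}. a \<noteq> b \<and> \<pi> a = p \<and> \<pi> b = p"
      unfolding big_blocks_def using no_diag by blast+
    then have "p \<noteq> \<pi> l" using unique by metis
    with p N_eq have "p < \<pi> l" by simp
    with p same N_eq show "p \<in> mg.big_blocks" unfolding mg.big_blocks_def by auto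
  qed
qed

lemma card_closed_both:
  "card {F. F \<subseteq> sum_root ` sum_cells \<and>
      move_closed (\<lambda>a' a. levi_move a' a \<or> down_move a' a \<or> up_move a' a) F} =
    card (downsets (shifted_cells (N - 1) big_blocks))"
proof -
  interpret mg: block_coordinates n \<epsilon> symm diag merged "N - 1"
    by (rule block_coordinates_merged)
  have closed: "move_closed mv F \<longleftrightarrow> mg.move_closed mv F" for mv F
    unfolding move_closed_def mg.move_closed_def sum_cells_merged ..
  let ?mv = "\<lambda>a' a. levi_move a' a \<or> down_move a' a \<or> up_move a' a"
  have "card {F. F \<subseteq> mg.sum_root ` mg.sum_cells \<and> mg.move_closed ?mv F} =
    card (downsets (shifted_cells (N - 1) mg.big_blocks))"
  proof (rule mg.card_move_closed[OF symm])
    fix a a' assume a: "a \<in> {1..n}" and mv: "?mv a' a"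
    show "merged a' \<le> merged a"
    proof (cases "levi_move a' a")
      case True
      then show ?thesis
        using block_le_l[of a'] block_gt_l[of a] by (auto simp: levi_move_def merged_def)
    next
      case False
      with mv block_next show ?thesis by (auto simp: merged_def)
    qed
  next
    fix a a' assume a: "a \<in> {1..n}" "a' \<in> {1..n}" "merged a' \<le> merged a" "diag \<or> a' + a \<noteq> n + 1"
    have "\<pi> a' \<le> \<pi> a"
    proof (rule ccontr)
      assume "\<not> \<pi> a' \<le> \<pi> a"
      with a(3) have "a \<le> l" "l < a'"
        using block_gt_l[of a] block_gt_l[of a'] a(1,2) by (auto simp: merged_def split: if_splits)
      moreover from this have "\<pi> a = \<pi> l" "\<pi> a' = \<pi> l + 1"
        using block_le_l[of a] block_gt_l[of a'] a by (auto simp: merged_def)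
      ultimately have "a = l" "a' = l + 1"
        using block_less_l[of a] block_gt_next[of a'] a by force+
      with a(4) n_eq no_diag show False by simp
    qed
    with a show "?mv a' a" by (simp add: levi_move_def)
  next
    fix b b' a' assume b: "b \<in> {1..n}" "b' \<in> {1..n}" "b' + b = n + 1" "merged b' \<le> merged b"
    show "?mv b' b \<or>
      (\<exists>c\<in>{1..n}. c \<noteq> b \<and> c \<noteq> b' \<and> c \<noteq> a' \<and> merged b' \<le> merged c \<and> merged c \<le> merged b)"
    proof (cases "b = l \<or> b = l + 1")
      case True
      then show ?thesis using b n_eq by auto
    next
      case False
      have "l < b"
      proof (rule ccontr)
        assume "\<not> l < b"
        then have "b < l" "l + 1 < b'" using False b n_eq by auto
        then show False
          using block_less_l[of b] block_gt_next[of b'] b by (auto simp: merged_def)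
      qed
      with False b have b': "b' < l" "l + 1 < b" using n_eq by auto
      have "merged b' \<le> merged l" "merged l \<le> merged b"
        using mg.block_mono[of b' l] mg.block_mono[of l b] b b' middle_mem by auto
      moreover have "merged (l + 1) = merged l" using block_next by (simp add: merged_def)
      ultimately have "\<forall>c\<in>{l, l + 1}. c \<noteq> b \<and> c \<noteq> b' \<and> merged b' \<le> merged c \<and> merged c \<le> merged b"
        using b' by auto
      moreover have "l \<noteq> a' \<or> l + 1 \<noteq> a'" by simp
      ultimately show ?thesis using middle_mem by blast
    qed
  qed
  then show ?thesis
    unfolding closed sum_cells_merged big_blocks_merged .
qed

text \<open>
  Exchanging the middle indices is the sign change of the last coordinate. It preserves the roots, the simple
  roots and \<open>I\<close>, so that every statement about the coordinates \<open>\<epsilon>\<close> also holds for \<open>\<epsilon> (flip i)\<close>.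
\<close>

definition flip :: "nat \<Rightarrow> nat" where
  "flip i = (if i = l then l + 1 else if i = l + 1 then l else i)"

lemma flip_mem: "i \<in> {1..n} \<Longrightarrow> flip i \<in> {1..n}"
  using middle_mem by (simp add: flip_def)

lemma flip_flip [simp]: "flip (flip i) = i"
  by (simp add: flip_def)

lemma flip_dual: "i \<in> {1..n} \<Longrightarrow> flip (n + 1 - i) = n + 1 - flip i"
  using n_eq by (auto simp: flip_def)

lemma legit_flip: "legit (flip i) (flip j) \<longleftrightarrow> legit i j"
proof -
  have "legit (flip i) (flip j)" if "legit i j" for i j
    using that flip_mem[of i] flip_mem[of j] n_eq no_diag
    by (auto simp: legit_pair_def flip_def split: if_splits)
  from this[of i j] this[of "flip i" "flip j"] show ?thesis by auto
qed

lemma parabolic_coordinates_flip: "parabolic_coordinates n (\<lambda>i. \<epsilon> (flip i)) symm diag \<pi> N D P I"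
proof -
  interpret fl: root_coordinates n "\<lambda>i. \<epsilon> (flip i)" symm diag
  proof unfold_locales
    fix x :: "nat \<Rightarrow> int"
    assume odd: "symm \<Longrightarrow> \<forall>i\<in>{1..n}. x (n + 1 - i) = - x i"
    have "\<forall>i\<in>{1..n}. x (flip (n + 1 - i)) = - x (flip i)" if symm
      using odd[OF that] flip_dual flip_mem by metis
    then obtain f where "linfun f"
      "\<forall>i\<in>{1..n}. \<forall>j\<in>{1..n}. f (\<epsilon> i - \<epsilon> j) = complex_of_int (x (flip i) - x (flip j))"
      using functional[of "\<lambda>i. x (flip i)"] by blast
    then show "\<exists>f. linfun f \<and>
      (\<forall>i\<in>{1..n}. \<forall>j\<in>{1..n}. f (\<epsilon> (flip i) - \<epsilon> (flip j)) = complex_of_int (x i - x j))"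
      using flip_mem by (metis flip_flip)
  next
    fix i assume "symm" "i \<in> {1..n}"
    then show "\<epsilon> (flip (n + 1 - i)) = - \<epsilon> (flip i)"
      using symmetric[of "flip i"] flip_dual flip_mem by simp
  qed (rule diag_unless_symm)
  interpret fl: block_coordinates n "\<lambda>i. \<epsilon> (flip i)" symm diag \<pi> N
    by unfold_locales (fact block_mono block_surj block_symm)+
  show ?thesis
  proof unfold_locales
    show "D = fl.coord_roots"
    proof -
      have "fl.coord_roots = {\<epsilon> i - \<epsilon> j | i j. legit i j}"
        unfolding fl.coord_roots_def using legit_flip by (metis (no_types, lifting) flip_flip)
      then show ?thesis using D_eq by (simp add: coord_roots_def)
    qed
    show "simple_system D P" "I \<subseteq> P" by (fact simple I_subset)+
    fix a assume "a \<in> P"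
    then obtain i j where ij: "legit i j" "i < j" "a = \<epsilon> i - \<epsilon> j" "a \<in> I \<longleftrightarrow> \<pi> i = \<pi> j"
      using simple_coords by blast
    have mem: "i \<in> {1..n}" "j \<in> {1..n}" "i + j \<noteq> n + 1" using ij(1) no_diag by (auto simp: legit_pair_def)
    have "flip i < flip j"
      using ij(2) mem(3) n_eq by (auto simp: flip_def)
    moreover have "\<pi> (flip i) = \<pi> (flip j) \<longleftrightarrow> \<pi> i = \<pi> j"
      using ij(2) mem n_eq block_less_l[of i] block_less_l[of j] block_gt_next[of i] block_gt_next[of j] block_next
      by (auto simp: flip_def)
    ultimately show "\<exists>i j. legit i j \<and> i < j \<and> a = \<epsilon> (flip i) - \<epsilon> (flip j) \<and> (a \<in> I \<longleftrightarrow> \<pi> i = \<pi> j)"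
      using ij legit_flip[of i j] by (intro exI[of _ "flip i"] exI[of _ "flip j"]) auto
  qed
qed

lemma middle_partner:
  assumes "s = l \<or> s = l + 1" "t = l \<or> t = l + 1" "legit_sum n diag s b" "(t, b) \<in> sum_cells"
  shows "b < l"
proof -
  have b: "b \<in> {1..n}" "\<pi> t + \<pi> b \<le> N" using assms(3,4) by (auto simp: legit_sum_def sum_cells_def)
  have "\<pi> l \<le> \<pi> t" using assms(2) block_next by auto
  then have "b \<le> l"
    using b N_eq block_gt_l[of b] by force
  moreover have "b \<noteq> l" if "s = l" using assms(3) that no_diag by (auto simp: legit_sum_def)
  moreover have "b \<noteq> l" if "s = l + 1" using assms(3) that n_eq by (auto simp: legit_sum_def)
  ultimately show ?thesis using assms(1) by force
qed

lemma middle_cell: "b \<in> {1..n} \<Longrightarrow> b < l \<Longrightarrow> s = l \<or> s = l + 1 \<Longrightarrow>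
    legit_sum n diag s b \<and> (s, b) \<in> sum_cells \<and> (b, s) \<in> sum_cells"
  unfolding legit_sum_def sum_cells_def
  using middle_mem block_less_l[of b] block_next N_eq n_eq by auto

lemma closed_middle:
  assumes "s = l \<or> s = l + 1" "t = l \<or> t = l + 1"
  shows "move_closed (\<lambda>a' a. a' = s \<and> a = t) F \<longleftrightarrow>
    (\<forall>b\<in>{1..n}. b < l \<longrightarrow> \<epsilon> t + \<epsilon> b \<in> F \<longrightarrow> \<epsilon> s + \<epsilon> b \<in> F)"
proof -
  have "b \<in> {1..n}" if "(t, b) \<in> sum_cells" for b using that by (auto simp: sum_cells_def legit_sum_def)
  then show ?thesis
    unfolding move_closed_single
    using middle_partner[OF assms] middle_cell[OF _ _ assms(1)] middle_cell[OF _ _ assms(2)] by blast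
qed

text \<open>
  The indices \<open>b < l\<close> with \<open>\<epsilon> l + \<epsilon> b \<in> F\<close> form an initial segment with respect to the blocks, and so do
  those with \<open>\<epsilon> (l + 1) + \<epsilon> b \<in> F\<close>. One of two initial segments contains the other.
\<close>

lemma closed_down_or_up:
  assumes F: "F \<subseteq> sum_root ` sum_cells" "move_closed levi_move F"
  shows "move_closed down_move F \<or> move_closed up_move F"
proof (rule ccontr)
  assume "\<not> ?thesis"
  then obtain a b where a: "a \<in> {1..n}" "a < l" "\<epsilon> (l + 1) + \<epsilon> a \<in> F" "\<epsilon> l + \<epsilon> a \<notin> F"
    and b: "b \<in> {1..n}" "b < l" "\<epsilon> l + \<epsilon> b \<in> F" "\<epsilon> (l + 1) + \<epsilon> b \<notin> F"
    using closed_middle[of l "l + 1" F] closed_middle[of "l + 1" l F] by auto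
  have move: "\<epsilon> s + \<epsilon> c \<in> F"
    if "d \<in> {1..n}" "d < l" "c \<in> {1..n}" "c < l" "\<pi> c \<le> \<pi> d" "s = l \<or> s = l + 1" "\<epsilon> s + \<epsilon> d \<in> F" for c d s
  proof -
    have "levi_move c d" unfolding levi_move_def using that n_eq by auto
    moreover have "legit_sum n diag c s"
      using middle_cell[OF that(3,4,6)] legit_sum_commute[of n diag c s] by simp
    moreover have "(d, s) \<in> sum_cells" using middle_cell[OF that(1,2,6)] by simp
    moreover have "\<epsilon> d + \<epsilon> s \<in> F" using that(7) by (simp add: add.commute)
    ultimately have "\<epsilon> c + \<epsilon> s \<in> F" using move_closedD[OF F(2)] by blast
    then show ?thesis by (simp add: add.commute)
  qed
  show False
  proof (cases "\<pi> a \<le> \<pi> b")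
    case True
    then show ?thesis using move[of b a l] a b by blast
  next
    case False
    then show ?thesis using move[of a b "l + 1"] a b by auto
  qed
qed

lemma card_closed_up:
  "card {F. F \<subseteq> sum_root ` sum_cells \<and> move_closed (\<lambda>a' a. levi_move a' a \<or> up_move a' a) F} =
    card (downsets (shifted_cells N big_blocks))"
proof -
  interpret fl: parabolic_coordinates n "\<lambda>i. \<epsilon> (flip i)" symm diag \<pi> N D P I
    by (rule parabolic_coordinates_flip)
  interpret fl: fork_coordinates n "\<lambda>i. \<epsilon> (flip i)" symm diag \<pi> N D P I l
    by unfold_locales (fact symm no_diag n_eq l_ge block_last)+
  have up: "move_closed up_move F \<longleftrightarrow> fl.move_closed down_move F" for F
  proof -
    have "\<epsilon> (flip (l + 1)) + \<epsilon> (flip b) = \<epsilon> l + \<epsilon> b" "\<epsilon> (flip l) + \<epsilon> (flip b) = \<epsilon> (l + 1) + \<epsilon> b"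
      if "b < l" for b using that by (auto simp: flip_def)
    then show ?thesis
      using closed_middle[of "l + 1" l F] fl.closed_middle[of l "l + 1" F] by auto
  qed
  have "F \<subseteq> sum_root ` sum_cells \<and> move_closed (\<lambda>a' a. levi_move a' a \<or> up_move a' a) F \<longleftrightarrow>
      F \<subseteq> fl.sum_root ` fl.sum_cells \<and> fl.move_closed (\<lambda>a' a. fl.levi_move a' a \<or> down_move a' a) F" for F
  proof -
    have "F \<subseteq> sum_root ` sum_cells \<and> move_closed levi_move F \<longleftrightarrow> F \<in> F_sets D P I"
      by (simp add: F_sets_symmetric[OF symm])
    moreover have "F \<subseteq> fl.sum_root ` fl.sum_cells \<and> fl.move_closed fl.levi_move F \<longleftrightarrow> F \<in> F_sets D P I"
      by (simp add: fl.F_sets_symmetric[OF symm])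
    ultimately show ?thesis
      unfolding move_closed_disj fl.move_closed_disj up by blast
  qed
  then show ?thesis
    using fl.card_closed_down by simp
qed

text \<open>
  Inclusion-exclusion over the two replacements of the middle indices.
\<close>

lemma card_F_sets_fork:
  "card (F_sets D P I) + card (downsets (shifted_cells (N - 1) big_blocks)) =
    2 * card (downsets (shifted_cells N big_blocks))"
proof -
  let ?U = "sum_root ` sum_cells"
  let ?A = "{F. F \<subseteq> ?U \<and> move_closed (\<lambda>a' a. levi_move a' a \<or> down_move a' a) F}"
  let ?B = "{F. F \<subseteq> ?U \<and> move_closed (\<lambda>a' a. levi_move a' a \<or> up_move a' a) F}"
  have "finite (Pow ?U)" using finite_sum_cells by simp
  then have fin: "finite ?A" "finite ?B"
    by (rule finite_subset[rotated]; blast)+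
  have "F_sets D P I = ?A \<union> ?B"
    unfolding F_sets_symmetric[OF symm] move_closed_disj using closed_down_or_up by blast
  moreover have "{F. F \<subseteq> ?U \<and> move_closed (\<lambda>a' a. levi_move a' a \<or> down_move a' a \<or> up_move a' a) F} = ?A \<inter> ?B"
    unfolding move_closed_disj[of levi_move] move_closed_disj[of down_move] by blast
  ultimately show ?thesis
    using card_Un_Int[OF fin] card_closed_down card_closed_up card_closed_both by simp
qed

end

section \<open>Blocks cut out by a set of simple roots\<close>

text \<open>
  \<open>T\<close> contains \<open>t\<close> if the indices \<open>t\<close> and \<open>t + 1\<close> are glued together, so the block number is one more
  than the number of gaps to the left.
\<close>

definition block_index :: "nat set \<Rightarrow> nat \<Rightarrow> nat" where
  "block_index T i = Suc (card ({1..<i} - T))"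

lemma block_index_Suc:
  "1 \<le> i \<Longrightarrow> block_index T (Suc i) = block_index T i + (if i \<in> T then 0 else 1)"
proof -
  assume "1 \<le> i"
  then have "{1..<Suc i} - T = (if i \<in> T then {1..<i} - T else insert i ({1..<i} - T))"
    by (auto simp: atLeastLessThanSuc)
  then show ?thesis by (simp add: block_index_def)
qed

lemma block_index_1: "block_index T 1 = 1"
  by (simp add: block_index_def)

lemma block_index_mono: "i \<le> j \<Longrightarrow> block_index T i \<le> block_index T j"
  unfolding block_index_def by (intro Suc_leI le_imp_less_Suc card_mono) auto

lemma block_index_surj: "1 \<le> n \<Longrightarrow> block_index T ` {1..n} = {1..block_index T n}"
proof (induction n rule: dec_induct)
  case base
  then show ?case using block_index_1[of T] by simp
next
  case (step n)
  have "{1..Suc n} = insert (Suc n) {1..n}" by auto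
  then have "block_index T ` {1..Suc n} = insert (block_index T (Suc n)) {1..block_index T n}"
    using step.IH by simp
  also have "\<dots> = {1..block_index T (Suc n)}"
    using block_index_Suc[of n T] step.hyps by (auto simp: block_index_def)
  finally show ?case .
qed

lemma block_index_eq: "1 \<le> i \<Longrightarrow> block_index T i + card (T \<inter> {1..<i}) = i"
proof -
  assume i: "1 \<le> i"
  have "card ({1..<i} - T) = card {1..<i} - card ({1..<i} \<inter> T)"
    by (rule card_Diff_subset_Int) simp
  moreover have "card ({1..<i} \<inter> T) \<le> card {1..<i}"
    by (rule card_mono) auto
  ultimately have "card ({1..<i} - T) + card ({1..<i} \<inter> T) = card {1..<i}"
    by linarith
  moreover have "card {1..<i} = i - 1" by simp
  ultimately show ?thesis
    using i unfolding block_index_def Int_commute[of T] by linarith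
qed

lemma block_index_symm:
  assumes T: "\<And>t. t \<in> {1..<n} \<Longrightarrow> t \<in> T \<longleftrightarrow> n - t \<in> T" and i: "i \<in> {1..n}"
  shows "block_index T (n + 1 - i) + block_index T i = block_index T n + 1"
proof -
  have "card ({1..<n + 1 - i} - T) = card ({i..<n} - T)"
  proof (rule bij_betw_same_card, rule bij_betw_byWitness[where f = "\<lambda>t. n - t" and f' = "\<lambda>t. n - t"])
    show "\<forall>t\<in>{1..<n + 1 - i} - T. n - (n - t) = t" "\<forall>t\<in>{i..<n} - T. n - (n - t) = t"
      using i by auto
    show "(\<lambda>t. n - t) ` ({1..<n + 1 - i} - T) \<subseteq> {i..<n} - T"
    proof
      fix s assume "s \<in> (\<lambda>t. n - t) ` ({1..<n + 1 - i} - T)"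
      then obtain t where "t \<in> {1..<n + 1 - i}" "t \<notin> T" "s = n - t" by blast
      moreover from this have "t \<in> {1..<n}" using i by auto
      ultimately show "s \<in> {i..<n} - T" using T[of t] i by auto
    qed
    show "(\<lambda>t. n - t) ` ({i..<n} - T) \<subseteq> {1..<n + 1 - i} - T"
    proof
      fix s assume "s \<in> (\<lambda>t. n - t) ` ({i..<n} - T)"
      then obtain t where "t \<in> {i..<n}" "t \<notin> T" "s = n - t" by blast
      moreover from this have "t \<in> {1..<n}" using i by auto
      ultimately show "s \<in> {1..<n + 1 - i} - T" using T[of t] i by auto
    qed
  qed
  moreover have "{1..<n} - T = ({1..<i} - T) \<union> ({i..<n} - T)" using i by auto
  then have "card ({1..<n} - T) = card ({1..<i} - T) + card ({i..<n} - T)"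
    by (simp only:) (rule card_Un_disjoint; auto)
  ultimately show ?thesis by (simp add: block_index_def)
qed

lemma block_index_less_iff:
  assumes "1 \<le> i" "i \<le> j"
  shows "block_index T i < block_index T j \<longleftrightarrow> (\<exists>t. i \<le> t \<and> t < j \<and> t \<notin> T)"
proof
  assume "\<exists>t. i \<le> t \<and> t < j \<and> t \<notin> T"
  then obtain t where t: "i \<le> t" "t < j" "t \<notin> T" by blast
  then have "block_index T i < block_index T (Suc t)"
    using block_index_Suc[of t T] block_index_mono[of i t T] assms by simp
  also have "\<dots> \<le> block_index T j" using t by (intro block_index_mono) simp
  finally show "block_index T i < block_index T j" .
next
  assume less: "block_index T i < block_index T j"
  show "\<exists>t. i \<le> t \<and> t < j \<and> t \<notin> T"
  proof (rule ccontr)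
    assume "\<not> ?thesis"
    then have "t \<in> T" if "i \<le> t" "t < j" for t using that by blast
    then have "x \<in> {1..<j} - T \<longleftrightarrow> x \<in> {1..<i} - T" for x
      using assms by (cases "i \<le> x") auto
    then have "{1..<j} - T = {1..<i} - T" by (rule set_eqI)
    with less show False by (simp add: block_index_def)
  qed
qed

section \<open>The classical root systems in coordinates\<close>

fun coord_dim :: "classical_type \<Rightarrow> nat \<Rightarrow> nat" where
  "coord_dim TypeA l = l + 1"
| "coord_dim TypeB l = 2 * l + 1"
| "coord_dim TypeC l = 2 * l"
| "coord_dim TypeD l = 2 * l"

text \<open>
  The coordinates \<open>e\<^sub>1, \<dots>, e\<^sub>l\<close>, followed in the folded types by \<open>0\<close> (type \<open>B\<close> only) and by
  \<open>- e\<^sub>l, \<dots>, - e\<^sub>1\<close>.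
\<close>

definition coord :: "classical_type \<Rightarrow> nat \<Rightarrow> (nat \<Rightarrow> 'v::ab_group_add) \<Rightarrow> nat \<Rightarrow> 'v" where
  "coord X l e i = (if X = TypeA \<or> i \<le> l then e i
     else if X = TypeB \<and> i = l + 1 then 0 else - e (coord_dim X l + 1 - i))"

abbreviation coord_diag :: "classical_type \<Rightarrow> bool" where
  "coord_diag X \<equiv> X = TypeA \<or> X = TypeC"

lemma coord_low: "i \<le> l \<Longrightarrow> coord X l e i = e i"
  by (simp add: coord_def)

lemma coord_dual:
  assumes "X \<noteq> TypeA" "i \<in> {1..l}"
  shows "coord X l e (coord_dim X l + 1 - i) = - e i"
  using assms by (cases X) (auto simp: coord_def)

lemma coord_cases:
  assumes "X \<noteq> TypeA" "i \<in> {1..coord_dim X l}"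
  obtains "i \<in> {1..l}" "coord X l e i = e i"
  | "X = TypeB" "i = l + 1" "coord X l e i = 0"
  | k where "k \<in> {1..l}" "i + k = coord_dim X l + 1" "coord X l e i = - e k"
proof -
  have dim: "coord_dim X l = (if X = TypeB then 2 * l + 1 else 2 * l)"
    using assms(1) by (cases X) auto
  show thesis
  proof (cases "i \<le> l")
    case True
    then show ?thesis using that(1) assms(2) by (simp add: coord_low)
  next
    case False
    show ?thesis
    proof (cases "X = TypeB \<and> i = l + 1")
      case True
      then show ?thesis using that(2) by (simp add: coord_def)
    next
      case no_zero: False
      then show ?thesis
        using that(3)[of "coord_dim X l + 1 - i"] False assms dim
        by (auto simp: coord_def split: if_splits)
    qed
  qed
qed

lemma coord_symmetric:
  assumes "X \<noteq> TypeA" "i \<in> {1..coord_dim X l}"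
  shows "coord X l e (coord_dim X l + 1 - i) = - coord X l e i"
proof (rule coord_cases[OF assms, of e])
  fix k assume k: "k \<in> {1..l}" "i + k = coord_dim X l + 1" "coord X l e i = - e k"
  then have "coord_dim X l + 1 - i = k" by simp
  then show ?thesis using k by (simp add: coord_low)
next
  assume "i \<in> {1..l}" "coord X l e i = e i"
  then show ?thesis using coord_dual[OF assms(1)] by metis
next
  assume "X = TypeB" "i = l + 1" "coord X l e i = 0"
  then show ?thesis by (simp add: coord_def)
qed

lemma coord_diff_in_std_roots:
  assumes X: "X \<noteq> TypeA" and legit: "legit_pair (coord_dim X l) (coord_diag X) i j"
  shows "coord X l e i - coord X l e j \<in> std_roots X l e"
proof -
  let ?n = "coord_dim X l"
  have ij: "i \<in> {1..?n}" "j \<in> {1..?n}" "i \<noteq> j" "X = TypeC \<or> i + j \<noteq> ?n + 1"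
    using legit X by (auto simp: legit_pair_def)
  have D: "{e i - e j | i j. i \<in> {1..l} \<and> j \<in> {1..l} \<and> i \<noteq> j} \<subseteq> std_roots X l e"
    "{e i + e j | i j. i \<in> {1..l} \<and> j \<in> {1..l} \<and> i \<noteq> j} \<subseteq> std_roots X l e"
    "{- (e i + e j) | i j. i \<in> {1..l} \<and> j \<in> {1..l} \<and> i \<noteq> j} \<subseteq> std_roots X l e"
    using X by (cases X; simp add: std_roots_D_def; blast)+
  have minus: "e a - e b \<in> std_roots X l e" if "a \<in> {1..l}" "b \<in> {1..l}" "a \<noteq> b" for a b
    using that D(1) by blast
  have plus: "e a + e b \<in> std_roots X l e" "- (e a + e b) \<in> std_roots X l e"
    if "a \<in> {1..l}" "b \<in> {1..l}" "a \<noteq> b" for a b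
    using that D(2,3) by blast+
  have long: "e a + e a \<in> std_roots X l e" "- (e a + e a) \<in> std_roots X l e" if "X = TypeC" "a \<in> {1..l}" for a
    using that by auto
  have short: "e a \<in> std_roots X l e" "- e a \<in> std_roots X l e" if "X = TypeB" "a \<in> {1..l}" for a
    using that by auto
  show ?thesis
  proof (rule coord_cases[OF X ij(1), of e]; rule coord_cases[OF X ij(2), of e])
    fix k assume k: "i \<in> {1..l}" "coord X l e i = e i" "k \<in> {1..l}" "j + k = ?n + 1" "coord X l e j = - e k"
    then show ?thesis
      using plus(1)[of i k] long(1)[of i] ij by (cases "i = k") (auto simp: add.commute)
  next
    fix k assume k: "k \<in> {1..l}" "i + k = ?n + 1" "coord X l e i = - e k" "j \<in> {1..l}" "coord X l e j = e j"
    show ?thesis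
    proof -
      have "- e k - e j = - (e j + e k)" by simp
      moreover have "- (e j + e k) \<in> std_roots X l e"
        using plus(2)[of j k] long(2)[of j] ij k by (cases "j = k") (simp_all add: add.commute)
      ultimately show ?thesis using k by metis
    qed
  next
    fix k k' assume k: "k \<in> {1..l}" "i + k = ?n + 1" "coord X l e i = - e k"
      and k': "k' \<in> {1..l}" "j + k' = ?n + 1" "coord X l e j = - e k'"
    then have "k' \<noteq> k" using ij(3) by auto
    then show ?thesis using minus[of k' k] k k' by simp
  qed (use minus short ij in auto)
qed

lemma std_roots_coord:
  assumes X: "rank_ok X l"
  shows "std_roots X l e =
    {coord X l e i - coord X l e j | i j. legit_pair (coord_dim X l) (coord_diag X) i j}"
proof (cases "X = TypeA")
  case True
  then show ?thesis by (auto simp: coord_def legit_pair_def)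
next
  case False
  let ?n = "coord_dim X l" and ?R = "{coord X l e i - coord X l e j | i j. legit_pair (coord_dim X l) (coord_diag X) i j}"
  have n: "?n = (if X = TypeB then 2 * l + 1 else 2 * l)" using False by (cases X) auto
  have mem: "coord X l e i - coord X l e j \<in> ?R" if "legit_pair ?n (coord_diag X) i j" for i j
    using that by blast
  have minus: "e a - e b \<in> ?R" if "a \<in> {1..l}" "b \<in> {1..l}" "a \<noteq> b" for a b
    using mem[of a b] that n by (auto simp: legit_pair_def coord_low)
  have plus: "e a + e b \<in> ?R" "- (e a + e b) \<in> ?R"
    if "a \<in> {1..l}" "b \<in> {1..l}" "a \<noteq> b \<or> X = TypeC" for a b
  proof -
    have b: "coord X l e (?n + 1 - b) = - e b" "coord X l e a = e a"
      using coord_dual[OF False that(2)] that(1) by (simp_all add: coord_low)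
    have "legit_pair ?n (coord_diag X) a (?n + 1 - b)" "legit_pair ?n (coord_diag X) (?n + 1 - b) a"
      using that n False by (auto simp: legit_pair_def split: if_splits)
    from mem[OF this(1)] mem[OF this(2)] show "e a + e b \<in> ?R" "- (e a + e b) \<in> ?R"
      unfolding b by (simp_all add: algebra_simps)
  qed
  have short: "e a \<in> ?R" "- e a \<in> ?R" if "a \<in> {1..l}" "X = TypeB" for a
  proof -
    have "coord X l e a = e a" "coord X l e (l + 1) = 0" using that by (simp_all add: coord_def)
    moreover have "legit_pair ?n (coord_diag X) a (l + 1)" "legit_pair ?n (coord_diag X) (l + 1) a"
      using that by (auto simp: legit_pair_def)
    ultimately show "e a \<in> ?R" "- e a \<in> ?R"
      using mem[of a "l + 1"] mem[of "l + 1" a] by simp_all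
  qed
  have D: "std_roots_D l e \<subseteq> ?R"
    unfolding std_roots_D_def
  proof (intro Un_least subsetI)
    fix x assume "x \<in> {e i - e j | i j. i \<in> {1..l} \<and> j \<in> {1..l} \<and> i \<noteq> j}"
    then obtain i j where ij: "i \<in> {1..l}" "j \<in> {1..l}" "i \<noteq> j" "x = e i - e j" by blast
    show "x \<in> ?R" unfolding ij(4) by (rule minus[OF ij(1-3)])
  next
    fix x assume "x \<in> {e i + e j | i j. i \<in> {1..l} \<and> j \<in> {1..l} \<and> i \<noteq> j}"
    then obtain i j where ij: "i \<in> {1..l}" "j \<in> {1..l}" "i \<noteq> j" "x = e i + e j" by blast
    show "x \<in> ?R" unfolding ij(4) by (rule plus(1)[OF ij(1,2)]) (use ij(3) in simp)
  next
    fix x assume "x \<in> {- (e i + e j) | i j. i \<in> {1..l} \<and> j \<in> {1..l} \<and> i \<noteq> j}"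
    then obtain i j where ij: "i \<in> {1..l}" "j \<in> {1..l}" "i \<noteq> j" "x = - (e i + e j)" by blast
    show "x \<in> ?R" unfolding ij(4) by (rule plus(2)[OF ij(1,2)]) (use ij(3) in simp)
  qed
  have "std_roots X l e \<subseteq> ?R"
  proof
    fix x assume x: "x \<in> std_roots X l e"
    consider "x \<in> std_roots_D l e" | i where "X = TypeB" "i \<in> {1..l}" "x = e i \<or> x = - e i"
      | i where "X = TypeC" "i \<in> {1..l}" "x = e i + e i \<or> x = - (e i + e i)"
      using x False by (cases X) auto
    then show "x \<in> ?R"
    proof cases
      case 1
      with D show ?thesis by (rule subsetD)
    next
      case (2 i)
      from 2(3) short[OF 2(2,1)] show ?thesis by (elim disjE) (simp_all only:)
    next
      case (3 i)
      from 3(3) plus[OF 3(2) 3(2)] 3(1) show ?thesis by (elim disjE) (simp_all only: simp_thms)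
    qed
  qed
  moreover have "?R \<subseteq> std_roots X l e"
    using coord_diff_in_std_roots[OF False] by blast
  ultimately show ?thesis by (rule equalityI)
qed

text \<open>
  The simple root \<open>\<alpha>\<^sub>t\<close> is \<open>\<epsilon> t - \<epsilon> (t + 1)\<close>, except that the last one in type \<open>D\<close> is
  \<open>\<epsilon> (l - 1) - \<epsilon> (l + 1)\<close>.
\<close>

definition simple_start :: "classical_type \<Rightarrow> nat \<Rightarrow> nat \<Rightarrow> nat" where
  "simple_start X l t = (if X = TypeD \<and> t = l then l - 1 else t)"

lemma std_simple_coord:
  assumes "rank_ok X l" "t \<in> {1..l}"
  shows "std_simple X l e t = coord X l e (simple_start X l t) - coord X l e (t + 1)"
  using assms by (cases X) (auto simp: coord_def simple_start_def)

lemma simple_start_legit: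
  assumes "rank_ok X l" "t \<in> {1..l}"
  shows "legit_pair (coord_dim X l) (coord_diag X) (simple_start X l t) (t + 1)" "simple_start X l t < t + 1"
  using assms by (cases X; auto simp: legit_pair_def simple_start_def)+

text \<open>
  The functional is prescribed on the simple roots. These give the differences of neighbouring coordinates in the
  first half, the symmetry gives them in the second half, and all other differences are sums of these.
\<close>

lemma coord_functional:
  fixes x :: "nat \<Rightarrow> int"
  assumes X: "rank_ok X l" and simple: "simple_system D P" and bij: "bij_betw \<alpha> {1..l} P"
    and \<alpha>: "\<And>t. t \<in> {1..l} \<Longrightarrow> \<alpha> t = std_simple X l e t"
    and odd: "X \<noteq> TypeA \<Longrightarrow> \<forall>i\<in>{1..coord_dim X l}. x (coord_dim X l + 1 - i) = - x i"
  shows "\<exists>f. linfun f \<and> (\<forall>i\<in>{1..coord_dim X l}. \<forall>j\<in>{1..coord_dim X l}.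
    f (coord X l e i - coord X l e j) = of_int (x i - x j))"
proof -
  let ?n = "coord_dim X l" and ?c = "coord X l e"
  obtain f where f: "linfun f"
    and fP: "\<forall>a\<in>P. f a = of_int (x (simple_start X l (inv_into {1..l} \<alpha> a)) - x (inv_into {1..l} \<alpha> a + 1))"
    using simple_system_linfun[OF simple,
        of "\<lambda>a. of_int (x (simple_start X l (inv_into {1..l} \<alpha> a)) - x (inv_into {1..l} \<alpha> a + 1))"] by blast
  have f\<alpha>: "f (?c (simple_start X l t) - ?c (t + 1)) = of_int (x (simple_start X l t) - x (t + 1))"
    if t: "t \<in> {1..l}" for t
  proof -
    have "\<alpha> t \<in> P" "inv_into {1..l} \<alpha> (\<alpha> t) = t"
      using bij t by (auto simp: bij_betw_def inv_into_f_f)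
    then have "f (\<alpha> t) = of_int (x (simple_start X l t) - x (t + 1))" using fP by metis
    then show ?thesis using \<alpha>[OF t] std_simple_coord[OF X t] by metis
  qed
  have low: "f (?c t - ?c (t + 1)) = of_int (x t - x (t + 1))" if t: "t \<in> {1..l}" for t
  proof (cases "X = TypeD \<and> t = l")
    case False
    then show ?thesis using f\<alpha>[OF t] by (auto simp: simple_start_def)
  next
    case True
    then have l: "l - 1 \<in> {1..l}" "l - 1 + 1 = l" "simple_start X l (l - 1) = l - 1"
      using X by (auto simp: simple_start_def)
    have "?c l - ?c (l + 1) = (?c (l - 1) - ?c (l + 1)) - (?c (l - 1) - ?c l)" by simp
    then have "f (?c l - ?c (l + 1)) = f (?c (l - 1) - ?c (l + 1)) - f (?c (l - 1) - ?c l)"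
      using linfun_diff[OF f] by metis
    then show ?thesis
      using f\<alpha>[OF t] f\<alpha>[OF l(1)] True l by (auto simp: simple_start_def)
  qed
  have step: "f (?c t - ?c (t + 1)) = of_int (x t - x (t + 1))" if t: "t \<in> {1..<?n}" for t
  proof (cases "t \<le> l")
    case True
    then show ?thesis using low[of t] t by simp
  next
    case False
    then have X': "X \<noteq> TypeA" using t by auto
    let ?s = "?n - t"
    have s: "?s \<in> {1..l}" "?s \<in> {1..?n}" "t \<in> {1..?n}" "?n + 1 - t = ?s + 1" "?n + 1 - ?s = t + 1"
      using X' t False by (cases X; auto)+
    have "?c t = - ?c (?s + 1)" "?c (t + 1) = - ?c ?s"
      using coord_symmetric[OF X' s(2), of e] coord_symmetric[OF X' s(3), of e] unfolding s(4,5) by simp_all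
    then have "?c t - ?c (t + 1) = ?c ?s - ?c (?s + 1)" by simp
    moreover have "x t = - x (?s + 1)" "x (t + 1) = - x ?s"
      using odd[OF X'] s by (metis minus_minus)+
    ultimately show ?thesis using low[OF s(1)] by simp
  qed
  have chain: "f (?c i - ?c j) = of_int (x i - x j)" if "1 \<le> i" "i \<le> j" "j \<le> ?n" for i j
    using that(2,3)
  proof (induction j rule: dec_induct)
    case base
    show ?case by (simp only: diff_self linfun_zero[OF f] of_int_0)
  next
    case (step m)
    have "?c i - ?c (Suc m) = (?c i - ?c m) + (?c m - ?c (m + 1))" by simp
    then have "f (?c i - ?c (Suc m)) = f (?c i - ?c m) + f (?c m - ?c (m + 1))"
      using linfun_add[OF f] by metis
    also have "f (?c i - ?c m) = of_int (x i - x m)"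
      by (rule step.IH) (use step in simp)
    also have "f (?c m - ?c (m + 1)) = of_int (x m - x (m + 1))"
      by (rule \<open>\<And>t. t \<in> {1..<?n} \<Longrightarrow> f (?c t - ?c (t + 1)) = of_int (x t - x (t + 1))\<close>)
        (use step that(1) in auto)
    also have "complex_of_int (x i - x m) + of_int (x m - x (m + 1)) = of_int (x i - x (Suc m))"
      by simp
    finally show ?case .
  qed
  have "f (?c i - ?c j) = of_int (x i - x j)" if "i \<in> {1..?n}" "j \<in> {1..?n}" for i j
  proof (cases "i \<le> j")
    case True
    then show ?thesis using chain that by simp
  next
    case False
    then have "f (?c j - ?c i) = of_int (x j - x i)" using chain[of j i] that by simp
    moreover have "?c i - ?c j = - (?c j - ?c i)" by simp
    ultimately show ?thesis using linfun_uminus[OF f] by (metis minus_diff_eq of_int_minus)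
  qed
  with f show ?thesis by blast
qed

lemma root_coordinates_coord:
  assumes X: "rank_ok X l" and simple: "simple_system D P" and bij: "bij_betw \<alpha> {1..l} P"
    and \<alpha>: "\<And>t. t \<in> {1..l} \<Longrightarrow> \<alpha> t = std_simple X l e t"
  shows "root_coordinates (coord_dim X l) (coord X l e) (X \<noteq> TypeA) (coord_diag X)"
proof unfold_locales
  fix x :: "nat \<Rightarrow> int"
  assume odd: "X \<noteq> TypeA \<Longrightarrow> \<forall>i\<in>{1..coord_dim X l}. x (coord_dim X l + 1 - i) = - x i"
  show "\<exists>f. linfun f \<and> (\<forall>i\<in>{1..coord_dim X l}. \<forall>j\<in>{1..coord_dim X l}.
      f (coord X l e i - coord X l e j) = of_int (x i - x j))"
    using coord_functional[OF X simple bij \<alpha> odd] .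
next
  fix i assume "X \<noteq> TypeA" "i \<in> {1..coord_dim X l}"
  then show "coord X l e (coord_dim X l + 1 - i) = - coord X l e i"
    by (rule coord_symmetric)
qed simp

text \<open>
  A simple root glues two neighbouring indices and, in the folded types, also the two opposite indices.
\<close>

definition joins :: "classical_type \<Rightarrow> nat \<Rightarrow> nat set \<Rightarrow> nat set" where
  "joins X l J = (if X = TypeA then J else J \<union> (\<lambda>t. coord_dim X l - t) ` J)"

lemma joins_low:
  assumes "J \<subseteq> {1..l}" "t \<in> {1..l}"
  shows "t \<in> joins X l J \<longleftrightarrow> t \<in> J"
proof -
  have "t \<in> J" if "s \<in> J" "t = coord_dim X l - s" "X \<noteq> TypeA" for s
  proof -
    have "s \<in> {1..l}" using that(1) assms(1) by blast
    with that assms(2) have "t = s" by (cases X) auto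
    with that(1) show ?thesis by simp
  qed
  then show ?thesis by (auto simp: joins_def)
qed

lemma joins_symmetric:
  assumes "X \<noteq> TypeA" "J \<subseteq> {1..l}" "t \<in> {1..<coord_dim X l}"
  shows "t \<in> joins X l J \<longleftrightarrow> coord_dim X l - t \<in> joins X l J"
proof -
  have dual: "coord_dim X l - (coord_dim X l - s) = s" if "s \<in> J" for s
    using that assms(1,2) by (cases X) auto
  have *: "coord_dim X l - s \<in> joins X l J" if "s \<in> joins X l J" for s
    using that dual assms(1) by (auto simp: joins_def)
  from *[of t] *[of "coord_dim X l - t"] assms(3) show ?thesis by auto
qed

lemma block_index_joins:
  assumes J: "J \<subseteq> {1..l}" and i: "i \<in> {1..l + 1}"
  shows "block_index (joins X l J) i + card {t \<in> J. t < i} = i"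
proof -
  have "joins X l J \<inter> {1..<i} = {t \<in> J. t < i}"
    using joins_low[OF J, of _ X] i J by auto
  then show ?thesis using block_index_eq[of i "joins X l J"] i by simp
qed

text \<open>
  In type \<open>D\<close> the root \<open>\<alpha>\<^sub>l\<close> joins \<open>l - 1\<close> to \<open>l + 1\<close>. This is compatible with consecutive blocks only if
  \<open>\<alpha>\<^sub>l\<^sub>-\<^sub>1\<close> also lies in \<open>I\<close> whenever \<open>\<alpha>\<^sub>l\<close> does.
\<close>

lemma parabolic_coordinates_coord:
  assumes X: "rank_ok X l" and simple: "simple_system (std_roots X l e) P" and bij: "bij_betw \<alpha> {1..l} P"
    and \<alpha>: "\<And>t. t \<in> {1..l} \<Longrightarrow> \<alpha> t = std_simple X l e t"
    and J: "J \<subseteq> {1..l}" and fork: "X = TypeD \<Longrightarrow> l \<in> J \<Longrightarrow> l - 1 \<in> J"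
  defines "T \<equiv> joins X l J"
  shows "parabolic_coordinates (coord_dim X l) (coord X l e) (X \<noteq> TypeA) (coord_diag X)
    (block_index T) (block_index T (coord_dim X l)) (std_roots X l e) P (\<alpha> ` J)"
proof -
  interpret root_coordinates "coord_dim X l" "coord X l e" "X \<noteq> TypeA" "coord_diag X"
    by (rule root_coordinates_coord[OF X simple bij \<alpha>])
  have l: "1 \<le> l" "1 \<le> coord_dim X l" using X by (cases X; simp)+
  show ?thesis
  proof unfold_locales
    show "block_index T ` {1..coord_dim X l} = {1..block_index T (coord_dim X l)}"
      using block_index_surj[OF l(2)] .
  next
    fix i assume "X \<noteq> TypeA" "i \<in> {1..coord_dim X l}"
    then show "block_index T (coord_dim X l + 1 - i) + block_index T i = block_index T (coord_dim X l) + 1"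
      unfolding T_def by (intro block_index_symm joins_symmetric[OF _ J])
  next
    show "std_roots X l e = coord_roots"
      unfolding coord_roots_def by (rule std_roots_coord[OF X])
  next
    show "\<alpha> ` J \<subseteq> P" using bij J by (auto simp: bij_betw_def)
  next
    fix a assume "a \<in> P"
    then obtain t where t: "t \<in> {1..l}" "a = \<alpha> t" using bij by (auto simp: bij_betw_def)
    have "a \<in> \<alpha> ` J \<longleftrightarrow> t \<in> J"
      unfolding t(2) using inj_on_image_mem_iff[of \<alpha> "{1..l}" t J] t(1) J bij by (simp add: bij_betw_def)
    moreover have "block_index T (simple_start X l t) = block_index T (t + 1) \<longleftrightarrow> t \<in> J"
    proof (cases "X = TypeD \<and> t = l")
      case False
      then have "simple_start X l t = t" by (auto simp: simple_start_def)
      then show ?thesis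
        using block_index_Suc[of t T] joins_low[OF J t(1), of X] t(1) by (simp add: T_def)
    next
      case True
      then have l1: "l - 1 \<in> {1..l}" "Suc (l - 1) = l" using X by auto
      have "block_index T (t + 1) = block_index T (l - 1) + (if l - 1 \<in> J then 0 else 1) + (if l \<in> J then 0 else 1)"
        using block_index_Suc[of l T] block_index_Suc[of "l - 1" T] True l1
          joins_low[OF J l1(1), of X] joins_low[OF J t(1), of X] t(1) by (simp add: T_def)
      then show ?thesis using True fork by (auto simp: simple_start_def)
    qed
    ultimately show "\<exists>i j. legit i j \<and> i < j \<and> a = coord X l e i - coord X l e j \<and>
        (a \<in> \<alpha> ` J \<longleftrightarrow> block_index T i = block_index T j)"
      using simple_start_legit[OF X t(1)] \<alpha>[OF t(1)] std_simple_coord[OF X t(1), of e] t(2)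
      by (intro exI[of _ "simple_start X l t"] exI[of _ "t + 1"]) simp
  next
    show "simple_system (std_roots X l e) P" by (rule simple)
  next
    fix i j :: nat assume "i \<le> j"
    then show "block_index T i \<le> block_index T j" by (rule block_index_mono)
  qed
qed

section \<open>Dynkin diagrams\<close>

lemma is_coroot_linfun: "is_coroot D a f \<Longrightarrow> linfun f"
  by (simp add: is_coroot_def linfun_def)

text \<open>
  The product of two reflections in the same root \<open>a\<close> translates \<open>b\<close> by a multiple of \<open>a\<close>. Since \<open>D\<close> is
  finite, this multiple is zero.
\<close>

lemma coroot_unique:
  assumes fin: "finite D" and a: "a \<noteq> 0" and b: "b \<in> D" and f: "is_coroot D a f" and g: "is_coroot D a g"
  shows "f b = g b"
proof (rule ccontr)
  assume ne: "f b \<noteq> g b"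
  let ?d = "g b - f b"
  \<comment> \<open>The iterated translates of \<open>b\<close> are pairwise distinct and all lie in \<open>D\<close>.\<close>
  let ?b = "\<lambda>m v. b v + of_nat m * ?d * a v"
  have val: "h (?b m) = h b + 2 * of_nat m * ?d" if "is_coroot D a h" for h m
  proof -
    have "?b m = b + (\<lambda>v. (of_nat m * ?d) * a v)" by (simp add: plus_fun_def)
    then have "h (?b m) = h b + (of_nat m * ?d) * h a"
      using linfun_add[OF is_coroot_linfun[OF that]] linfun_scale[OF is_coroot_linfun[OF that]] by metis
    then show ?thesis using that by (simp add: is_coroot_def)
  qed
  have mem: "?b m \<in> D" for m
  proof (induction m)
    case 0
    then show ?case using b by simp
  next
    case (Suc m)
    let ?c = "\<lambda>v. ?b m v - g (?b m) * a v"
    have closed: "(\<lambda>v. c v - h c * a v) \<in> D" if "is_coroot D a h" "c \<in> D" for h c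
      using that by (simp add: is_coroot_def)
    have c: "?c \<in> D" by (rule closed[OF g Suc])
    have "(\<lambda>v. ?c v - f ?c * a v) \<in> D" by (rule closed[OF f c])
    moreover have "f ?c = f (?b m) - g (?b m) * 2"
    proof -
      have "?c = ?b m - (\<lambda>v. g (?b m) * a v)" by (simp add: fun_diff_def)
      then have "f ?c = f (?b m) - g (?b m) * f a"
        using linfun_diff[OF is_coroot_linfun[OF f]] linfun_scale[OF is_coroot_linfun[OF f]] by metis
      then show ?thesis using f by (simp add: is_coroot_def)
    qed
    moreover have "(\<lambda>v. ?c v - (f (?b m) - g (?b m) * 2) * a v) = ?b (Suc m)"
      unfolding val[OF f] val[OF g] by (simp add: algebra_simps)
    ultimately show ?case by simp
  qed
  obtain v where v: "a v \<noteq> 0" using a by (auto simp: fun_eq_iff)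
  have "inj ?b"
  proof (rule injI)
    fix m m' assume "?b m = ?b m'"
    then have "?b m v = ?b m' v" by metis
    with v ne show "m = m'" by simp
  qed
  moreover have "finite (range ?b)" using fin mem by (rule_tac finite_subset[of _ D]) auto
  ultimately show False using finite_imageD by blast
qed

lemma cartan_integer_eq:
  assumes "finite D" "a \<noteq> 0" "b \<in> D" "is_coroot D a f"
  shows "cartan_integer D b a = f b"
  unfolding cartan_integer_def
  by (rule the_equality) (use assms coroot_unique in blast)+

context root_coordinates
begin

lemma finite_coord_roots: "finite coord_roots"
proof (rule finite_subset)
  show "coord_roots \<subseteq> (\<lambda>(i, j). \<epsilon> i - \<epsilon> j) ` ({1..n} \<times> {1..n})"
    by (auto simp: coord_roots_def legit_pair_def)
qed simp

text \<open>
  The reflection in a root acts on the coordinates by a permutation \<open>\<sigma>\<close>, so it suffices to give \<open>\<sigma>\<close> and the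
  values \<open>x\<close> of the coroot on the coordinates.
\<close>

lemma cartan_integer_reflection:
  fixes x :: "nat \<Rightarrow> int" and \<sigma> :: "nat \<Rightarrow> nat"
  assumes odd: "symm \<Longrightarrow> \<forall>i\<in>{1..n}. x (n + 1 - i) = - x i"
    and pq: "legit p q" "x p - x q = 2"
    and refl: "\<And>i. i \<in> {1..n} \<Longrightarrow> \<epsilon> i - (\<lambda>v. of_int (x i) * (\<epsilon> p - \<epsilon> q) v) = \<epsilon> (\<sigma> i)"
    and legit\<sigma>: "\<And>i j. legit i j \<Longrightarrow> legit (\<sigma> i) (\<sigma> j)"
    and ij: "legit i j"
  shows "cartan_integer coord_roots (\<epsilon> i - \<epsilon> j) (\<epsilon> p - \<epsilon> q) = of_int (x i - x j)"
proof -
  obtain f where f: "linfun f"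
    and val: "\<forall>i\<in>{1..n}. \<forall>j\<in>{1..n}. f (\<epsilon> i - \<epsilon> j) = of_int (x i - x j)"
    using functional[OF odd] by blast
  have val': "f (\<epsilon> i - \<epsilon> j) = of_int (x i - x j)" if "legit i j" for i j
    using val that by (simp add: legit_pair_def)
  have "is_coroot coord_roots (\<epsilon> p - \<epsilon> q) f"
    unfolding is_coroot_def
  proof (intro conjI ballI)
    show "f (\<epsilon> p - \<epsilon> q) = 2" using val'[OF pq(1)] pq(2) by simp
    fix b assume "b \<in> coord_roots"
    then obtain i j where ij: "legit i j" "b = \<epsilon> i - \<epsilon> j" by (auto simp: coord_roots_def)
    then have mem: "i \<in> {1..n}" "j \<in> {1..n}" by (auto simp: legit_pair_def)
    have "(\<lambda>v. b v - f b * (\<epsilon> p - \<epsilon> q) v) =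
        (\<epsilon> i - (\<lambda>v. of_int (x i) * (\<epsilon> p - \<epsilon> q) v)) - (\<epsilon> j - (\<lambda>v. of_int (x j) * (\<epsilon> p - \<epsilon> q) v))"
      unfolding ij(2) val'[OF ij(1)] by (simp add: fun_eq_iff algebra_simps)
    also have "\<dots> = \<epsilon> (\<sigma> i) - \<epsilon> (\<sigma> j)" unfolding refl[OF mem(1)] refl[OF mem(2)] ..
    finally show "(\<lambda>v. b v - f b * (\<epsilon> p - \<epsilon> q) v) \<in> coord_roots"
      unfolding coord_roots_def using legit\<sigma>[OF ij(1)] by blast
  qed (use f in \<open>simp_all add: linfun_def\<close>)
  moreover have "\<epsilon> i - \<epsilon> j \<in> coord_roots" using ij by (auto simp: coord_roots_def)
  ultimately show ?thesis
    using cartan_integer_eq[OF finite_coord_roots root_nonzero[OF pq(1)]] val'[OF ij] by metis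
qed

lemma legit_involution:
  assumes range: "\<And>i. i \<in> {1..n} \<Longrightarrow> \<sigma> i \<in> {1..n}"
    and invol: "\<And>i. i \<in> {1..n} \<Longrightarrow> \<sigma> (\<sigma> i) = i"
    and dual: "\<And>i. symm \<Longrightarrow> i \<in> {1..n} \<Longrightarrow> \<sigma> (n + 1 - i) = n + 1 - \<sigma> i"
    and ij: "legit i j"
  shows "legit (\<sigma> i) (\<sigma> j)"
proof -
  have mem: "i \<in> {1..n}" "j \<in> {1..n}" "i \<noteq> j" using ij by (auto simp: legit_pair_def)
  have "\<sigma> i \<noteq> \<sigma> j" using invol[OF mem(1)] invol[OF mem(2)] mem(3) by metis
  moreover have "\<sigma> i + \<sigma> j \<noteq> n + 1" if "\<not> diag"
  proof
    assume eq: "\<sigma> i + \<sigma> j = n + 1"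
    have symm using that diag_unless_symm by blast
    from eq have "\<sigma> i = n + 1 - \<sigma> j" by simp
    also have "\<dots> = \<sigma> (n + 1 - j)" using dual[OF \<open>symm\<close> mem(2)] by simp
    finally have "\<sigma> (\<sigma> i) = \<sigma> (\<sigma> (n + 1 - j))" by (rule arg_cong)
    moreover have "n + 1 - j \<in> {1..n}" using mem(2) by auto
    ultimately have "i = n + 1 - j" using invol mem(1) by metis
    with ij that show False by (auto simp: legit_pair_def)
  qed
  ultimately show ?thesis using range[OF mem(1)] range[OF mem(2)] unfolding legit_pair_def by blast
qed

text \<open>
  The reflection exchanges \<open>p\<close> with \<open>q\<close> and the index opposite to \<open>p\<close> with the one opposite to \<open>q\<close>.
\<close>

lemma cartan_integer_generic:
  assumes pq: "legit p q" "symm \<Longrightarrow> p + q \<noteq> n + 1" "symm \<Longrightarrow> 2 * p \<noteq> n + 1" "symm \<Longrightarrow> 2 * q \<noteq> n + 1"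
    and ij: "legit i j"
  shows "cartan_integer coord_roots (\<epsilon> i - \<epsilon> j) (\<epsilon> p - \<epsilon> q) =
    of_int ((spike {p} i - spike {q} i) - (spike {p} j - spike {q} j))"
proof -
  let ?x = "\<lambda>i. spike {p} i - spike {q} i"
  define p' q' where "p' = n + 1 - p" and "q' = n + 1 - q"
  let ?\<sigma> = "\<lambda>i. if i = p then q else if i = q then p
    else if symm \<and> i = p' then q' else if symm \<and> i = q' then p' else i"
  have mem: "p \<in> {1..n}" "q \<in> {1..n}" "p \<noteq> q" "p' \<in> {1..n}" "q' \<in> {1..n}" "p' \<noteq> q'"
    "n + 1 - p' = p" "n + 1 - q' = q" "n + 1 - p = p'" "n + 1 - q = q'"
    using pq(1) by (auto simp: legit_pair_def p'_def q'_def)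
  have apart: "p \<noteq> p'" "q \<noteq> q'" "p \<noteq> q'" "q \<noteq> p'" if symm
    using pq(2-4)[OF that] mem(1,2) unfolding p'_def q'_def by auto
  have spike: "spike {p} i = (if i = p then 1 else if symm \<and> i = p' then - 1 else 0)"
    "spike {q} i = (if i = q then 1 else if symm \<and> i = q' then - 1 else 0)" if "i \<in> {1..n}" for i
  proof -
    have "i + p = n + 1 \<longleftrightarrow> i = p'" "i + q = n + 1 \<longleftrightarrow> i = q'" using mem that by auto
    then show "spike {p} i = (if i = p then 1 else if symm \<and> i = p' then - 1 else 0)"
      "spike {q} i = (if i = q then 1 else if symm \<and> i = q' then - 1 else 0)"
      using spike_single[OF mem(1) that pq(3)] spike_single[OF mem(2) that pq(4)] by simp_all
  qed
  show ?thesis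
  proof (rule cartan_integer_reflection[OF _ pq(1) _ _ _ ij, where \<sigma> = ?\<sigma>])
    show "\<forall>i\<in>{1..n}. ?x (n + 1 - i) = - ?x i" if symm
      using spike_odd[OF that, of "{p}"] spike_odd[OF that, of "{q}"] by simp
    show "?x p - ?x q = 2"
      using spike[OF mem(1)] spike[OF mem(2)] mem(3) apart by auto
    show "\<epsilon> i - (\<lambda>v. of_int (?x i) * (\<epsilon> p - \<epsilon> q) v) = \<epsilon> (?\<sigma> i)" if i: "i \<in> {1..n}" for i
    proof -
      have dual: "\<epsilon> p' = - \<epsilon> p" "\<epsilon> q' = - \<epsilon> q" if "symm"
        using symmetric[OF that mem(1)] symmetric[OF that mem(2)] unfolding mem(9,10) by simp_all
      consider "i = p" | "i = q" | "symm" "i = p'" | "symm" "i = q'" |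
        "i \<noteq> p" "i \<noteq> q" "\<not> (symm \<and> i = p')" "\<not> (symm \<and> i = q')" by blast
      then show ?thesis
      proof cases
        case 1
        then have "?x i = 1" using spike[OF i] mem(3) apart by auto
        then show ?thesis using 1 by (simp add: fun_eq_iff)
      next
        case 2
        then have "?x i = - 1" using spike[OF i] mem(3) apart by auto
        then show ?thesis using 2 by (simp add: fun_eq_iff)
      next
        case 3
        then have "?x i = - 1" using spike[OF i] mem(6) apart by auto
        then show ?thesis
          using 3 dual[OF 3(1)] apart[OF 3(1)] by (simp add: fun_eq_iff)
      next
        case 4
        then have "?x i = 1" using spike[OF i] mem(6) apart by auto
        then show ?thesis
          using 4 dual[OF 4(1)] apart[OF 4(1)] mem(6) by (simp add: fun_eq_iff)
      next
        case 5
        then have "?x i = 0" using spike[OF i] by auto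
        then show ?thesis using 5 by (auto simp: fun_eq_iff)
      qed
    qed
    show "legit (?\<sigma> i) (?\<sigma> j)" if "legit i j" for i j
    proof (rule legit_involution[OF _ _ _ that, where \<sigma> = ?\<sigma>])
      fix i assume i: "i \<in> {1..n}"
      show "?\<sigma> i \<in> {1..n}" using i mem(1,2,4,5) by simp
      show "?\<sigma> (?\<sigma> i) = i" using mem(3,6) apart by (cases symm) simp_all
      assume symm
      have "n + 1 - i = p \<longleftrightarrow> i = p'" "n + 1 - i = q \<longleftrightarrow> i = q'"
        "n + 1 - i = p' \<longleftrightarrow> i = p" "n + 1 - i = q' \<longleftrightarrow> i = q"
        using i mem(1,2) unfolding p'_def q'_def by auto
      then show "?\<sigma> (n + 1 - i) = n + 1 - ?\<sigma> i"
        using \<open>symm\<close> apart[OF \<open>symm\<close>] mem(3,6) mem(7-10) by (simp only: if_True simp_thms split: if_split) blast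
    qed
  qed
qed

text \<open>
  For the roots \<open>\<epsilon> p\<close> of type \<open>B\<close> (with \<open>c = 2\<close>) and \<open>2 (\<epsilon> p)\<close> of type \<open>C\<close> (with \<open>c = 1\<close>) the reflection
  exchanges \<open>p\<close> with its opposite index.
\<close>

lemma cartan_integer_selfdual:
  assumes symm: symm and p: "legit p q" "2 * p \<noteq> n + 1" and c: "c * (1 - spike {p} q) = 2"
    and half: "\<epsilon> p + \<epsilon> p = (\<lambda>v. of_int c * (\<epsilon> p - \<epsilon> q) v)"
    and ij: "legit i j"
  shows "cartan_integer coord_roots (\<epsilon> i - \<epsilon> j) (\<epsilon> p - \<epsilon> q) =
    of_int (c * spike {p} i - c * spike {p} j)"
proof -
  define p' where "p' = n + 1 - p"
  let ?\<sigma> = "\<lambda>i. if i = p then p' else if i = p' then p else i"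
  have mem: "p \<in> {1..n}" "p' \<in> {1..n}" "n + 1 - p = p'" "n + 1 - p' = p" "p \<noteq> p'"
    using p by (auto simp: legit_pair_def p'_def)
  have dual: "\<epsilon> p' = - \<epsilon> p" using symmetric[OF symm mem(1)] unfolding mem(3) .
  have spike: "spike {p} i = (if i = p then 1 else if i = p' then - 1 else 0)" if "i \<in> {1..n}" for i
  proof -
    have "i + p = n + 1 \<longleftrightarrow> i = p'" using mem that by auto
    then show ?thesis using spike_single[OF mem(1) that p(2)] symm by simp
  qed
  show ?thesis
  proof (rule cartan_integer_reflection[OF _ p(1) _ _ _ ij, where \<sigma> = ?\<sigma>])
    show "\<forall>i\<in>{1..n}. c * spike {p} (n + 1 - i) = - (c * spike {p} i)"
      using spike_odd[OF symm, of "{p}"] by simp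
    show "c * spike {p} p - c * spike {p} q = 2"
      using c spike[OF mem(1)] by (simp add: algebra_simps)
    show "\<epsilon> i - (\<lambda>v. of_int (c * spike {p} i) * (\<epsilon> p - \<epsilon> q) v) = \<epsilon> (?\<sigma> i)" if i: "i \<in> {1..n}" for i
    proof -
      have scale: "(\<lambda>v. of_int (c * k) * (\<epsilon> p - \<epsilon> q) v) = (\<lambda>v. of_int k * (\<epsilon> p + \<epsilon> p) v)" for k
        unfolding half by (simp add: fun_eq_iff)
      show ?thesis
        unfolding scale spike[OF i] using dual mem(5) by (auto simp: fun_eq_iff)
    qed
    show "legit (?\<sigma> i) (?\<sigma> j)" if "legit i j" for i j
    proof (rule legit_involution[OF _ _ _ that, where \<sigma> = ?\<sigma>])
      fix i assume i: "i \<in> {1..n}"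
      show "?\<sigma> i \<in> {1..n}" using i mem(1,2) by simp
      show "?\<sigma> (?\<sigma> i) = i" using mem(5) by simp
      have "n + 1 - i = p \<longleftrightarrow> i = p'" "n + 1 - i = p' \<longleftrightarrow> i = p"
        using i mem by auto
      then show "?\<sigma> (n + 1 - i) = n + 1 - ?\<sigma> i"
        using mem(3-5) by (simp only: split: if_split) blast
    qed
  qed
qed

end

definition dynkin_edge :: "classical_type \<Rightarrow> nat \<Rightarrow> nat \<Rightarrow> nat \<Rightarrow> bool" where
  "dynkin_edge X l s t \<longleftrightarrow> (if X = TypeD
     then s + 1 = t \<and> t < l \<or> t + 1 = s \<and> s < l \<or> s + 2 = l \<and> t = l \<or> t + 2 = l \<and> s = l
     else s + 1 = t \<or> t + 1 = s)"

lemma dynkin_adjacent_iff_edge: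
  assumes X: "rank_ok X l" and simple: "simple_system D P" and bij: "bij_betw \<alpha> {1..l} P"
    and \<alpha>: "\<And>t. t \<in> {1..l} \<Longrightarrow> \<alpha> t = std_simple X l e t" and D: "D = std_roots X l e"
    and s: "s \<in> {1..l}" and t: "t \<in> {1..l}"
  shows "dynkin_adjacent D (\<alpha> s) (\<alpha> t) \<longleftrightarrow> dynkin_edge X l s t"
proof (cases "s = t")
  case True
  then show ?thesis by (auto simp: dynkin_adjacent_def dynkin_edge_def)
next
  case False
  let ?n = "coord_dim X l" and ?c = "coord X l e"
  let ?i = "simple_start X l s" and ?j = "s + 1" and ?p = "simple_start X l t" and ?q = "t + 1"
  interpret root_coordinates ?n ?c "X \<noteq> TypeA" "coord_diag X"
    by (rule root_coordinates_coord[OF X simple bij \<alpha>])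
  have D': "D = coord_roots"
    unfolding D coord_roots_def by (rule std_roots_coord[OF X])
  have roots: "\<alpha> s = ?c ?i - ?c ?j" "\<alpha> t = ?c ?p - ?c ?q"
    using \<alpha> s t std_simple_coord[OF X] by metis+
  have legit: "legit ?i ?j" "legit ?p ?q"
    using simple_start_legit[OF X] s t by blast+
  have "\<alpha> s \<noteq> \<alpha> t" using bij_betw_imp_inj_on[OF bij] s t False by (metis inj_onD)
  moreover have "cartan_integer D (\<alpha> s) (\<alpha> t) \<noteq> 0 \<longleftrightarrow> dynkin_edge X l s t"
  proof (cases "(X = TypeB \<or> X = TypeC) \<and> t = l")
    \<comment> \<open>The coroot is the generic one unless the reflection exchanges opposite indices.\<close>
    case last: False
    have far: "?p + ?q \<noteq> ?n + 1 \<and> 2 * ?p \<noteq> ?n + 1 \<and> 2 * ?q \<noteq> ?n + 1" if "X \<noteq> TypeA"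
    proof (cases "X = TypeD")
      case True
      then have "?n + 1 = 2 * l + 1" "?p + ?q = (if t = l then 2 * l else 2 * t + 1)" "t = l \<or> t < l"
        using t X by (auto simp: simple_start_def)
      then show ?thesis by presburger
    next
      case False
      then have "?p = t" "t < l" "?n = 2 * l \<or> ?n = 2 * l + 1"
        using t last that by (cases X; auto simp: simple_start_def)+
      then show ?thesis by presburger
    qed
    have "cartan_integer D (\<alpha> s) (\<alpha> t) =
        of_int ((spike {?p} ?i - spike {?q} ?i) - (spike {?p} ?j - spike {?q} ?j))"
      unfolding roots D'
      by (rule cartan_integer_generic[OF legit(2) _ _ _ legit(1)])
        (use far in blast)+
    moreover have "(spike {?p} ?i - spike {?q} ?i) - (spike {?p} ?j - spike {?q} ?j) \<noteq> 0 \<longleftrightarrow> dynkin_edge X l s t"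
    proof -
      have mem: "?i \<in> {1..?n}" "?j \<in> {1..?n}" "?p \<in> {1..?n}" "?q \<in> {1..?n}"
        using legit by (auto simp: legit_pair_def)
      have spike: "spike {?p} i = (if i = ?p then 1 else if X \<noteq> TypeA \<and> i + ?p = ?n + 1 then - 1 else 0)"
        "spike {?q} i = (if i = ?q then 1 else if X \<noteq> TypeA \<and> i + ?q = ?n + 1 then - 1 else 0)"
        if "i \<in> {1..?n}" for i
        using spike_single[OF mem(3) that] spike_single[OF mem(4) that] far by blast+
      note spikes = spike[OF mem(1)] spike[OF mem(2)]
      show ?thesis
      proof (cases "X = TypeD")
        case False
        then have start: "?p = t" "?i = s" by (auto simp: simple_start_def)
        show ?thesis
        proof (cases "X = TypeA")
          case True
          then show ?thesis
            unfolding spikes unfolding start unfolding dynkin_edge_def using \<open>s \<noteq> t\<close> by simp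
        next
          case notA: False
          then have n: "?n = 2 * l \<or> ?n = 2 * l + 1" "t < l"
            using False last t by (cases X; auto)+
          then have "s + t \<noteq> ?n + 1" "s + (t + 1) \<noteq> ?n + 1" "s + 1 + t \<noteq> ?n + 1"
            "s + 1 + (t + 1) = ?n + 1 \<Longrightarrow> s = t + 1"
            using s by auto
          then show ?thesis
            unfolding spikes unfolding start unfolding dynkin_edge_def using False notA \<open>s \<noteq> t\<close> by auto
        qed
      next
        case True
        then have n: "?n = 2 * l" "4 \<le> l" using X by auto
        consider "s < l" "t < l" | "s = l" "t < l" | "s < l" "t = l"
          using s t \<open>s \<noteq> t\<close> by force
        then show ?thesis
        proof cases
          case 1
          then show ?thesis
            unfolding spikes unfolding dynkin_edge_def n(1) using True \<open>s \<noteq> t\<close> by (simp add: simple_start_def) 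
        next
          case 2
          then have start: "?p = t" "?i = l - 1" by (auto simp: simple_start_def True)
          have "l - 1 + t \<noteq> 2 * l + 1" "l + l - Suc 0 \<noteq> Suc (2 * l)" "l - 1 + (t + 1) \<noteq> 2 * l + 1" "l + 1 + t \<noteq> 2 * l + 1"
            "l + 1 + (t + 1) = 2 * l + 1 \<longleftrightarrow> t + 1 = l" "l - 1 = t \<longleftrightarrow> t + 1 = l" "l - 1 = t + 1 \<longleftrightarrow> t + 2 = l"
            using 2 n by auto
          then show ?thesis
            unfolding spikes unfolding start unfolding dynkin_edge_def n(1) 2(1) using True 2 n by simp
        next
          case 3
          then have start: "?i = s" "?p = l - 1" by (auto simp: simple_start_def True)
          have "s + (l - 1) \<noteq> 2 * l + 1" "l + l - Suc 0 \<noteq> Suc (2 * l)" "s + (l + 1) \<noteq> 2 * l + 1" "s + 1 + (l - 1) \<noteq> 2 * l + 1"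
            "s + 1 + (l + 1) = 2 * l + 1 \<longleftrightarrow> s + 1 = l" "s = l - 1 \<longleftrightarrow> s + 1 = l" "s + 1 = l - 1 \<longleftrightarrow> s + 2 = l"
            using 3 n by auto
          then show ?thesis
            unfolding spikes unfolding start unfolding dynkin_edge_def n(1) 3(2) using True 3 n by simp
        qed
      qed
    qed
    ultimately show ?thesis by (simp only: of_int_eq_0_iff)
  next
    case last: True
    then have t': "?p = l" "?q = l + 1" "t = l" by (auto simp: simple_start_def)
    let ?k = "if X = TypeB then 2 else 1 :: int"
    have "cartan_integer D (\<alpha> s) (\<alpha> t) = of_int (?k * spike {?p} ?i - ?k * spike {?p} ?j)"
      unfolding roots D'
    proof (rule cartan_integer_selfdual[OF _ legit(2) _ _ _ legit(1)])
      show "X \<noteq> TypeA" using last by auto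
      show "2 * ?p \<noteq> ?n + 1" using last t' by auto
      show "?k * (1 - spike {?p} ?q) = 2"
        using last t' by (auto simp: spike_weight_def)
      show "?c ?p + ?c ?p = (\<lambda>v. of_int ?k * (?c ?p - ?c ?q) v)"
        using last t' by (auto simp: coord_def fun_eq_iff)
    qed
    moreover have "?k * spike {?p} ?i - ?k * spike {?p} ?j \<noteq> 0 \<longleftrightarrow> dynkin_edge X l s t"
    proof -
      have n: "?n = 2 * l \<or> ?n = 2 * l + 1" "s < l" "?i = s"
        using last s False by (auto simp: simple_start_def)
      have "l \<in> {1..?n}" "s \<in> {1..?n}" "s + 1 \<in> {1..?n}" "2 * l \<noteq> ?n + 1"
        using n s t by auto
      then have spikes: "spike {l} i = (if i = l then 1 else if i + l = ?n + 1 then - 1 else 0)"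
        if "i \<in> {s, s + 1}" for i
        using spike_single[of l i] that last by auto
      have "spike {l} s = 0" "spike {l} (s + 1) = (if s + 1 = l then 1 else 0)"
        using spikes[of s] spikes[of "s + 1"] n by auto
      then show ?thesis
        unfolding t'(1) n(3) dynkin_edge_def using last n(2) by auto
    qed
    ultimately show ?thesis by (simp only: of_int_eq_0_iff)
  qed
  ultimately show ?thesis by (simp add: dynkin_adjacent_def)
qed

section \<open>Connected components as intervals of nodes\<close>

definition connected_in :: "(nat \<Rightarrow> nat \<Rightarrow> bool) \<Rightarrow> nat set \<Rightarrow> nat \<Rightarrow> nat set" where
  "connected_in E J i = {j \<in> J. (i, j) \<in> {(s, t). s \<in> J \<and> t \<in> J \<and> E s t}\<^sup>*}"

lemma components_eq:
  assumes inj: "inj_on \<alpha> J" and edge: "\<And>s t. s \<in> J \<Longrightarrow> t \<in> J \<Longrightarrow> dynkin_adjacent D (\<alpha> s) (\<alpha> t) \<longleftrightarrow> E s t"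
  shows "components D (\<alpha> ` J) = (\<lambda>i. \<alpha> ` connected_in E J i) ` J"
proof -
  let ?R = "{(s, t). s \<in> J \<and> t \<in> J \<and> E s t}"
  let ?A = "{(x, y). x \<in> \<alpha> ` J \<and> y \<in> \<alpha> ` J \<and> dynkin_adjacent D x y}"
  have forward: "(\<alpha> i, \<alpha> j) \<in> ?A\<^sup>*" if "(i, j) \<in> ?R\<^sup>*" for i j
    using that
  proof (induction rule: rtrancl_induct)
    case (step y z)
    then have "(\<alpha> y, \<alpha> z) \<in> ?A" using edge by blast
    with step.IH show ?case by (rule rtrancl_into_rtrancl)
  qed simp
  have backward: "\<exists>j. b = \<alpha> j \<and> j \<in> J \<and> (i, j) \<in> ?R\<^sup>*" if "(\<alpha> i, b) \<in> ?A\<^sup>*" "i \<in> J" for i b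
    using that(1)
  proof (induction rule: rtrancl_induct)
    case base
    then show ?case using that(2) by blast
  next
    case (step y z)
    then obtain j where j: "y = \<alpha> j" "j \<in> J" "(i, j) \<in> ?R\<^sup>*" by blast
    from step(2) obtain k where k: "z = \<alpha> k" "k \<in> J" "dynkin_adjacent D (\<alpha> j) (\<alpha> k)" using j by auto
    then have "(j, k) \<in> ?R" using edge j by blast
    with j(3) have "(i, k) \<in> ?R\<^sup>*" by (rule rtrancl_into_rtrancl)
    with k show ?case by blast
  qed
  let ?rel = "{(a, b). a \<in> \<alpha> ` J \<and> b \<in> \<alpha> ` J \<and> (a, b) \<in> ?A\<^sup>*}"
  have class_eq: "?rel `` {\<alpha> i} = \<alpha> ` connected_in E J i" if i: "i \<in> J" for i
  proof (intro equalityI subsetI)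
    fix b assume "b \<in> ?rel `` {\<alpha> i}"
    then have "(\<alpha> i, b) \<in> ?A\<^sup>*" by blast
    from backward[OF this i] show "b \<in> \<alpha> ` connected_in E J i"
      unfolding connected_in_def by blast
  next
    fix b assume "b \<in> \<alpha> ` connected_in E J i"
    then obtain j where j: "j \<in> J" "(i, j) \<in> ?R\<^sup>*" "b = \<alpha> j" unfolding connected_in_def by blast
    from forward[OF j(2)] i j show "b \<in> ?rel `` {\<alpha> i}" by blast
  qed
  show ?thesis
    unfolding components_def quotient_def using class_eq by auto
qed

lemma connected_in_self: "i \<in> J \<Longrightarrow> i \<in> connected_in E J i"
  by (simp add: connected_in_def)

lemma connected_in_step: "j \<in> connected_in E J i \<Longrightarrow> k \<in> J \<Longrightarrow> E j k \<Longrightarrow> k \<in> connected_in E J i"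
  unfolding connected_in_def by (auto intro: rtrancl_into_rtrancl)

lemma connected_in_eq:
  assumes sym: "\<And>s t. E s t \<Longrightarrow> E t s" and i: "i \<in> connected_in E J j" and j: "j \<in> J"
  shows "connected_in E J i = connected_in E J j"
proof -
  let ?R = "{(s, t). s \<in> J \<and> t \<in> J \<and> E s t}"
  have "sym ?R" using sym by (auto simp: sym_def)
  then have "sym (?R\<^sup>*)" by (rule sym_rtrancl)
  moreover have "(j, i) \<in> ?R\<^sup>*" using i by (simp add: connected_in_def)
  ultimately have "(i, j) \<in> ?R\<^sup>*" by (blast dest: symD)
  with \<open>(j, i) \<in> ?R\<^sup>*\<close> show ?thesis
    unfolding connected_in_def by (blast intro: rtrancl_trans)
qed

lemma connected_in_same_side:
  assumes gap: "\<And>s t. s \<in> J \<Longrightarrow> t \<in> J \<Longrightarrow> E s t \<Longrightarrow> s < g \<longleftrightarrow> t < g" and j: "j \<in> connected_in E J i"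
  shows "i < g \<longleftrightarrow> j < g"
proof -
  have "(i, j) \<in> {(s, t). s \<in> J \<and> t \<in> J \<and> E s t}\<^sup>*" using j by (simp add: connected_in_def)
  then show ?thesis
    by (induction rule: rtrancl_induct) (use gap in auto)
qed

text \<open>
  The components of a subset \<open>J\<close> of the Dynkin diagram, listed by their smallest elements. The bound \<open>L\<close> is there
  for type \<open>D\<close>: the nodes \<open>l - 1\<close> and \<open>l\<close> are consecutive but not adjacent, so that neighbours are known to lie
  in the same component only up to \<open>L = l - 1\<close>.
\<close>

locale interval_components =
  fixes J :: "nat set" and l L s :: nat and Q :: "nat \<Rightarrow> nat set"
  assumes J: "J \<subseteq> {1..l}" and cover: "(\<Union>j\<in>{1..s}. Q j) = J"
    and nonempty: "\<And>j. j \<in> {1..s} \<Longrightarrow> Q j \<noteq> {}"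
    and disjoint: "\<And>i j k. j \<in> {1..s} \<Longrightarrow> k \<in> {1..s} \<Longrightarrow> i \<in> Q j \<Longrightarrow> i \<in> Q k \<Longrightarrow> j = k"
    and convex: "\<And>i i' j t. j \<in> {1..s} \<Longrightarrow> i \<in> Q j \<Longrightarrow> i' \<in> Q j \<Longrightarrow> i \<le> t \<Longrightarrow> t \<le> i' \<Longrightarrow> t \<in> J"
    and join: "\<And>j t. j \<in> {1..s} \<Longrightarrow> t \<in> Q j \<Longrightarrow> t + 1 \<in> J \<Longrightarrow> t + 1 \<le> L \<Longrightarrow> t + 1 \<in> Q j"
    and ordered: "strict_mono_on {1..s} (\<lambda>j. Min (Q j))"
    and L: "l - 1 \<le> L"
begin

lemma Q_subset: "j \<in> {1..s} \<Longrightarrow> Q j \<subseteq> J"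
  using cover by blast

lemma finite_Q: "j \<in> {1..s} \<Longrightarrow> finite (Q j)"
  using Q_subset[of j] J by (meson finite_atLeastAtMost finite_subset)

lemma Min_Q: "j \<in> {1..s} \<Longrightarrow> Min (Q j) \<in> Q j"
  using finite_Q nonempty by simp

lemma Min_Q_le: "j \<in> {1..s} \<Longrightarrow> i \<in> Q j \<Longrightarrow> Min (Q j) \<le> i"
  using finite_Q by simp

lemma run:
  assumes j: "j \<in> {1..s}" and i: "i \<in> Q j" and run: "{i..i'} \<subseteq> J" "i \<le> i'" "i' \<le> L"
  shows "i' \<in> Q j"
  using run(2,1,3)
proof (induction i' rule: dec_induct)
  case (step m)
  then have "{i..m} \<subseteq> J" by auto
  with step have "m \<in> Q j" by simp
  moreover have "Suc m \<in> J" using step by auto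
  ultimately show ?case using join[OF j, of m] step by simp
qed (rule i)

lemma Q_before:
  assumes k: "k \<in> {1..s}" and j: "j \<in> {1..s}" and "k < j" and i: "i \<in> Q k"
  shows "i < Min (Q j)"
proof (rule ccontr)
  assume "\<not> i < Min (Q j)"
  then have le: "Min (Q j) \<le> i" by simp
  have less: "Min (Q k) < Min (Q j)"
    using ordered k j \<open>k < j\<close> by (auto simp: strict_mono_on_def)
  have "{Min (Q k)..i} \<subseteq> J" using convex[OF k Min_Q[OF k] i] by auto
  then have "{Min (Q k)..Min (Q j)} \<subseteq> J" using le by auto
  have "Min (Q j) \<in> Q k"
  proof (cases "Min (Q j) \<le> L")
    case True
    then show ?thesis
      using run[OF k Min_Q[OF k] \<open>{Min (Q k)..Min (Q j)} \<subseteq> J\<close>] less by simp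
  next
    case False
    moreover have "i \<le> l" using Q_subset[OF k] i J by auto
    ultimately have "Min (Q j) = i" using le L by simp
    with i show ?thesis by simp
  qed
  with disjoint[OF k j] Min_Q[OF j] \<open>k < j\<close> show False by blast
qed

lemma card_before: "j \<in> {1..s} \<Longrightarrow> card {t \<in> J. t < Min (Q j)} = (\<Sum>k = 1..<j. card (Q k))"
proof -
  assume j: "j \<in> {1..s}"
  have "{t \<in> J. t < Min (Q j)} = (\<Union>k\<in>{1..<j}. Q k)"
  proof (intro equalityI subsetI)
    fix t assume t: "t \<in> {t \<in> J. t < Min (Q j)}"
    then obtain k where k: "k \<in> {1..s}" "t \<in> Q k" using cover by blast
    have "k \<noteq> j" using t k(2) Min_Q_le[OF j] by force
    moreover have "\<not> j < k"
    proof
      assume "j < k"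
      from Q_before[OF j k(1) this Min_Q[OF j]] Min_Q_le[OF k] t show False by simp
    qed
    ultimately show "t \<in> (\<Union>k\<in>{1..<j}. Q k)" using k by auto
  next
    fix t assume "t \<in> (\<Union>k\<in>{1..<j}. Q k)"
    then obtain k where "k \<in> {1..s}" "k < j" "t \<in> Q k" using j by auto
    then show "t \<in> {t \<in> J. t < Min (Q j)}"
      using Q_before[OF _ j] Q_subset by blast
  qed
  moreover have "card (\<Union>k\<in>{1..<j}. Q k) = (\<Sum>k = 1..<j. card (Q k))"
  proof (rule card_UN_disjoint)
    show "\<forall>k\<in>{1..<j}. finite (Q k)" using finite_Q j by auto
    show "\<forall>k\<in>{1..<j}. \<forall>k'\<in>{1..<j}. k \<noteq> k' \<longrightarrow> Q k \<inter> Q k' = {}"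
    proof (intro ballI impI)
      fix k k' assume "k \<in> {1..<j}" "k' \<in> {1..<j}" "k \<noteq> k'"
      then show "Q k \<inter> Q k' = {}" using disjoint[of k k'] j by fastforce
    qed
  qed simp
  ultimately show ?thesis by simp
qed

lemma block_index_Min:
  assumes T: "\<And>t. t \<in> {1..l} \<Longrightarrow> t \<in> T \<longleftrightarrow> t \<in> J" and j: "j \<in> {1..s}" and i: "i \<in> Q j"
  shows "block_index T (Min (Q j)) = block_index T i"
proof -
  have "1 \<le> Min (Q j)" using Q_subset[OF j] Min_Q[OF j] J by auto
  moreover have "t \<in> T" if "Min (Q j) \<le> t" "t < i" for t
  proof -
    have "t \<in> J" using convex[OF j Min_Q[OF j] i] that by simp
    then show ?thesis using T J by blast
  qed
  ultimately show ?thesis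
    using block_index_less_iff[of "Min (Q j)" i T] Min_Q_le[OF j i] block_index_mono[of "Min (Q j)" i T] by force
qed

lemma block_index_Min_less:
  assumes T: "\<And>t. t \<in> {1..l} \<Longrightarrow> t \<in> T \<longleftrightarrow> t \<in> J"
    and k: "k \<in> {1..s}" and j: "j \<in> {1..s}" and "k < j" and le: "Min (Q j) \<le> L"
  shows "block_index T (Min (Q k)) < block_index T (Min (Q j))"
proof -
  have less: "Min (Q k) < Min (Q j)"
    using ordered k j \<open>k < j\<close> by (auto simp: strict_mono_on_def)
  have mem: "1 \<le> Min (Q k)" "Min (Q j) \<in> J" "Min (Q j) \<le> l"
    using Q_subset[OF k] Min_Q[OF k] Q_subset[OF j] Min_Q[OF j] J by auto
  have "\<exists>t. Min (Q k) \<le> t \<and> t < Min (Q j) \<and> t \<notin> T"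
  proof (rule ccontr)
    assume none: "\<not> ?thesis"
    have "{Min (Q k)..Min (Q j)} \<subseteq> J"
    proof
      fix t assume t: "t \<in> {Min (Q k)..Min (Q j)}"
      show "t \<in> J"
      proof (cases "t = Min (Q j)")
        case False
        then have "t \<in> T" using none t by auto
        then show ?thesis using T[of t] t mem by auto
      qed (use mem in simp)
    qed
    from run[OF k Min_Q[OF k] this] less le have "Min (Q j) \<in> Q k" by simp
    with disjoint[OF k j] Min_Q[OF j] \<open>k < j\<close> show False by blast
  qed
  with block_index_less_iff[of "Min (Q k)" "Min (Q j)" T] less mem show ?thesis by simp
qed

text \<open>
  The components below the middle correspond to the big blocks below the middle.
\<close>

lemma bij_betw_block_index_Min:
  assumes T: "\<And>t. t \<in> {1..l} \<Longrightarrow> t \<in> T \<longleftrightarrow> t \<in> J"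
    and low: "\<And>t. t \<in> J \<Longrightarrow> 2 * block_index T t \<le> N \<Longrightarrow> t \<le> L"
  shows "bij_betw (\<lambda>j. block_index T (Min (Q j))) {j \<in> {1..s}. 2 * block_index T (Min (Q j)) \<le> N}
    (block_index T ` {t \<in> J. 2 * block_index T t \<le> N})"
  unfolding bij_betw_def
proof
  have less: "block_index T (Min (Q k)) < block_index T (Min (Q j))"
    if "k \<in> {1..s}" "j \<in> {1..s}" "k < j" "2 * block_index T (Min (Q j)) \<le> N" for k j
    using block_index_Min_less[OF T that(1-3)] low[of "Min (Q j)"] Q_subset[OF that(2)] Min_Q[OF that(2)] that(4)
    by blast
  show "inj_on (\<lambda>j. block_index T (Min (Q j))) {j \<in> {1..s}. 2 * block_index T (Min (Q j)) \<le> N}"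
  proof (rule inj_onI)
    fix k j assume "k \<in> {j \<in> {1..s}. 2 * block_index T (Min (Q j)) \<le> N}"
      "j \<in> {j \<in> {1..s}. 2 * block_index T (Min (Q j)) \<le> N}"
      "block_index T (Min (Q k)) = block_index T (Min (Q j))"
    then show "k = j" using less[of k j] less[of j k] by (cases k j rule: linorder_cases) auto
  qed
  show "(\<lambda>j. block_index T (Min (Q j))) ` {j \<in> {1..s}. 2 * block_index T (Min (Q j)) \<le> N} =
    block_index T ` {t \<in> J. 2 * block_index T t \<le> N}"
  proof (intro equalityI subsetI)
    fix p assume "p \<in> (\<lambda>j. block_index T (Min (Q j))) ` {j \<in> {1..s}. 2 * block_index T (Min (Q j)) \<le> N}"
    then obtain j where "j \<in> {1..s}" "2 * block_index T (Min (Q j)) \<le> N" "p = block_index T (Min (Q j))"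
      by blast
    with Q_subset[of j] Min_Q[of j] show "p \<in> block_index T ` {t \<in> J. 2 * block_index T t \<le> N}"
      by blast
  next
    fix p assume "p \<in> block_index T ` {t \<in> J. 2 * block_index T t \<le> N}"
    then obtain t where t: "t \<in> J" "2 * block_index T t \<le> N" "p = block_index T t" by blast
    obtain j where j: "j \<in> {1..s}" "t \<in> Q j" using cover t by blast
    have "block_index T (Min (Q j)) = block_index T t" using block_index_Min[OF T j] .
    with t j(1) show "p \<in> (\<lambda>j. block_index T (Min (Q j))) ` {j \<in> {1..s}. 2 * block_index T (Min (Q j)) \<le> N}"
      by (intro image_eqI[of _ _ j]) simp_all
  qed
qed

end

text \<open>
  The components are convex because an edge cannot pass over a missing node. The only edge between
  nonconsecutive nodes joins \<open>l - 2\<close> to \<open>l\<close> in type \<open>D\<close>, and the assumption \<open>fork\<close> ensures that then \<open>l - 1\<close> is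
  not missing.
\<close>

lemma interval_components_of_diagram:
  assumes X: "rank_ok X l" and inj: "inj_on \<alpha> {1..l}" and J: "J \<subseteq> {1..l}"
    and edge: "\<And>s t. s \<in> {1..l} \<Longrightarrow> t \<in> {1..l} \<Longrightarrow> dynkin_adjacent D (\<alpha> s) (\<alpha> t) \<longleftrightarrow> dynkin_edge X l s t"
    and fork: "X = TypeD \<Longrightarrow> l \<in> J \<Longrightarrow> l - 1 \<in> J"
    and K: "bij_betw K {1..s} (components D (\<alpha> ` J))"
    and ordered: "strict_mono_on {1..s} (\<lambda>j. comp_min \<alpha> l (K j))"
  defines "Q \<equiv> \<lambda>j. {i \<in> {1..l}. \<alpha> i \<in> K j}"
  shows "interval_components J l (if X = TypeD then l - 1 else l) s Q"
    and "\<And>j. j \<in> {1..s} \<Longrightarrow> \<exists>i\<in>J. Q j = connected_in (dynkin_edge X l) J i"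
    and "\<And>j. j \<in> {1..s} \<Longrightarrow> card (K j) = card (Q j)"
proof -
  let ?E = "dynkin_edge X l"
  have injJ: "inj_on \<alpha> J" using inj J by (rule inj_on_subset)
  have comps: "components D (\<alpha> ` J) = (\<lambda>i. \<alpha> ` connected_in ?E J i) ` J"
    by (rule components_eq[OF injJ]) (use edge J in blast)
  have conn_sub: "connected_in ?E J i \<subseteq> J" for i by (auto simp: connected_in_def)
  have sym: "?E t u" if "?E u t" for t u using that by (auto simp: dynkin_edge_def split: if_splits)
  have Q_eq: "Q j = connected_in ?E J i \<and> K j = \<alpha> ` Q j" if "K j = \<alpha> ` connected_in ?E J i" for i j
  proof -
    have "Q j = connected_in ?E J i"
    proof (intro equalityI subsetI)
      fix t assume "t \<in> Q j"
      then have "t \<in> {1..l}" "\<alpha> t \<in> \<alpha> ` connected_in ?E J i" by (auto simp: Q_def that)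
      then show "t \<in> connected_in ?E J i"
        using inj_on_image_mem_iff[OF inj, of t "connected_in ?E J i"] conn_sub[of i] J by blast
    next
      fix t assume "t \<in> connected_in ?E J i"
      then show "t \<in> Q j" using conn_sub[of i] J by (auto simp: Q_def that)
    qed
    with that show ?thesis by simp
  qed
  have cls: "\<exists>i\<in>J. Q j = connected_in ?E J i \<and> K j = \<alpha> ` Q j" if "j \<in> {1..s}" for j
  proof -
    have "K ` {1..s} = (\<lambda>i. \<alpha> ` connected_in ?E J i) ` J"
      using K comps by (simp add: bij_betw_def)
    then have "K j \<in> (\<lambda>i. \<alpha> ` connected_in ?E J i) ` J" using that by (metis imageI)
    then obtain i where i: "K j = \<alpha> ` connected_in ?E J i" "i \<in> J" by (rule imageE)
    from Q_eq[OF i(1)] i(2) show ?thesis by (rule bexI)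
  qed
  then show "\<And>j. j \<in> {1..s} \<Longrightarrow> \<exists>i\<in>J. Q j = connected_in ?E J i" by blast
  show "card (K j) = card (Q j)" if "j \<in> {1..s}" for j
  proof -
    have "Q j \<subseteq> {1..l}" by (auto simp: Q_def)
    with inj have "inj_on \<alpha> (Q j)" by (rule inj_on_subset)
    moreover have "K j = \<alpha> ` Q j" using cls[OF that] by blast
    ultimately show ?thesis by (simp add: card_image)
  qed
  have conn: "Q j = connected_in ?E J t" if j: "j \<in> {1..s}" and t: "t \<in> Q j" for j t
  proof -
    obtain i where i: "i \<in> J" "Q j = connected_in ?E J i" using cls[OF j] by blast
    have "connected_in ?E J t = connected_in ?E J i"
      by (rule connected_in_eq) (use sym t i in auto)
    with i show ?thesis by simp
  qed
  have Q_sub: "Q j \<subseteq> J" if j: "j \<in> {1..s}" for j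
  proof -
    obtain i where "Q j = connected_in ?E J i" using cls[OF j] by blast
    then show ?thesis using conn_sub[of i] by simp
  qed
  show "interval_components J l (if X = TypeD then l - 1 else l) s Q"
  proof unfold_locales
    show "J \<subseteq> {1..l}" by (rule J)
    show "(\<Union>j\<in>{1..s}. Q j) = J"
    proof (intro equalityI subsetI)
      fix t assume "t \<in> (\<Union>j\<in>{1..s}. Q j)"
      then obtain j where "j \<in> {1..s}" "t \<in> Q j" by blast
      then show "t \<in> J" using Q_sub[of j] by (rule_tac subsetD)
    next
      fix t assume t: "t \<in> J"
      have "K ` {1..s} = (\<lambda>i. \<alpha> ` connected_in ?E J i) ` J"
        using K comps by (simp add: bij_betw_def)
      moreover have "\<alpha> ` connected_in ?E J t \<in> (\<lambda>i. \<alpha> ` connected_in ?E J i) ` J"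
        using t by (rule imageI)
      ultimately have "\<alpha> ` connected_in ?E J t \<in> K ` {1..s}" by (simp only:)
      then obtain j where j: "\<alpha> ` connected_in ?E J t = K j" "j \<in> {1..s}" by (rule imageE)
      have "t \<in> Q j" using Q_eq[OF j(1)[symmetric]] connected_in_self[OF t] by simp
      with j(2) show "t \<in> (\<Union>j\<in>{1..s}. Q j)" by (rule UN_I)
    qed
    show "Q j \<noteq> {}" if j: "j \<in> {1..s}" for j
    proof -
      obtain i where "i \<in> J" "Q j = connected_in ?E J i" using cls[OF j] by blast
      then show ?thesis using connected_in_self[of i J ?E] by auto
    qed
    show "j = k" if "j \<in> {1..s}" "k \<in> {1..s}" "i \<in> Q j" "i \<in> Q k" for i j k
    proof -
      have "Q j = Q k" using conn[OF that(1,3)] conn[OF that(2,4)] by simp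
      moreover have "K j = \<alpha> ` Q j" "K k = \<alpha> ` Q k" using cls[OF that(1)] cls[OF that(2)] by blast+
      ultimately have "K j = K k" by simp
      then show ?thesis by (rule inj_onD[OF bij_betw_imp_inj_on[OF K] _ that(1,2)])
    qed
    show "t \<in> J" if j: "j \<in> {1..s}" and i: "i \<in> Q j" and i': "i' \<in> Q j" and t: "i \<le> t" "t \<le> i'" for i i' j t
    proof (rule ccontr)
      assume tJ: "t \<notin> J"
      have ii: "i' \<in> connected_in ?E J i" using conn[OF j i] i' by simp
      have mem: "i \<in> J" "i' \<in> J" using Q_sub[OF j] i i' by blast+
      have "i < t \<longleftrightarrow> i' < t"
      proof (rule connected_in_same_side[OF _ ii])
        fix u v assume uv: "u \<in> J" "v \<in> J" "?E u v"
        then have "u \<noteq> t" "v \<noteq> t" using tJ by auto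
        then show "u < t \<longleftrightarrow> v < t"
        proof (cases "X = TypeD")
          case True
          then have "l \<in> J \<Longrightarrow> t \<noteq> l - 1" using fork tJ by blast
          then show ?thesis
            using uv True \<open>u \<noteq> t\<close> \<open>v \<noteq> t\<close> unfolding dynkin_edge_def if_P[OF True] by (elim disjE) auto
        next
          case False
          then show ?thesis
            using uv \<open>u \<noteq> t\<close> \<open>v \<noteq> t\<close> unfolding dynkin_edge_def by auto
        qed
      qed
      then show False using t mem tJ by (metis le_neq_implies_less not_less)
    qed
    show "t + 1 \<in> Q j" if j: "j \<in> {1..s}" and t: "t \<in> Q j" "t + 1 \<in> J" "t + 1 \<le> (if X = TypeD then l - 1 else l)" for j t
    proof -
      have "t \<in> J" using Q_sub[OF j] t(1) by blast
      have "?E t (t + 1)" using t(3) \<open>t \<in> J\<close> J by (auto simp: dynkin_edge_def split: if_splits)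
      then have "t + 1 \<in> connected_in ?E J t"
        using connected_in_step[OF connected_in_self[OF \<open>t \<in> J\<close>]] t(2) by blast
      then show ?thesis using conn[OF j t(1)] by simp
    qed
    show "strict_mono_on {1..s} (\<lambda>j. Min (Q j))"
      using ordered by (simp add: comp_min_def Q_def)
  qed simp
qed

section \<open>Numerical identities\<close>

lemma ballot_eq_T':
  assumes "2 * q \<le> M + 1"
  shows "real_of_int (ballot M q) = T' (int M - 1 - int q) (int q)"
proof (cases q)
  case 0
  then have a: "nat (int M - 1 - int q + int q + 1) = M" "nat (int M - 1 - int q + 2) = Suc M" "nat (int q) = 0"
    by auto
  show ?thesis
    unfolding T'_def a using 0 by (simp add: ballot_def)
next
  case (Suc k)
  then obtain d where M: "M = k + 1 + d" using assms by (metis add.commute add_2_eq_Suc' le_Suc_ex mult_2 add_le_imp_le_left Suc_eq_plus1 add_Suc_right add_Suc Suc_le_mono trans_le_add1 le_add1 add_leD1)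
  have a: "nat (int M - 1 - int q + int q + 1) = M" "nat (int M - 1 - int q + 2) = Suc d" "nat (int q) = Suc k"
    using Suc M by auto
  have "real (M choose Suc k) = fact M / (fact (Suc k) * fact d)" "real (M choose k) = fact M / (fact k * fact (Suc d))"
    using binomial_fact[of "Suc k" M, where 'a = real] binomial_fact[of k M, where 'a = real] M by simp_all
  then have "real_of_int (ballot M q) = fact M / (fact (Suc k) * fact d) - fact M / (fact k * fact (Suc d))"
    using Suc by (simp add: ballot_def)
  also have "\<dots> = fact M * (real d - real k) / (fact (Suc k) * fact (Suc d))"
  proof -
    have "F / ((x * a) * b) - F / (a * (y * b)) = F * (y - x) / ((x * a) * (y * b))"
      if "a \<noteq> 0" "b \<noteq> 0" "x \<noteq> 0" "y \<noteq> 0" for F a b x y :: real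
      using that by (simp add: field_simps)
    from this[of "fact k" "fact d" "real (Suc k)" "real (Suc d)" "fact M"] show ?thesis by simp
  qed
  also have "real d - real k = real_of_int (int M - 1 - int q - int q + 2)"
    using Suc M by simp
  finally show ?thesis
    unfolding T'_def a using Suc by simp
qed

lemma catalan_central: "real (m + 1) * catalan m = real (2 * m choose m)"
  by (simp add: catalan_def)

lemma binomial_central_odd: "(2 * m + 2) choose (m + 1) = 2 * ((2 * m + 1) choose m)"
proof -
  have "(2 * m + 1) choose (m + 1) = (2 * m + 1) choose m"
    using binomial_symmetric[of m "2 * m + 1"] by simp
  then show ?thesis using binomial_Suc_Suc[of "2 * m + 1" m] by simp
qed

lemma catalan_odd: "real (m + 2) / 2 * catalan (m + 1) = real (2 * m + 1 choose m)"
proof -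
  have "real (m + 2) * catalan (m + 1) = real (2 * (m + 1) choose (m + 1))"
    using catalan_central[of "m + 1"] by simp
  also have "\<dots> = 2 * real (2 * m + 1 choose m)"
    using binomial_central_odd[of m] by simp
  finally show ?thesis by simp
qed

lemma catalan_fork:
  assumes "1 \<le> m"
  shows "2 * real (2 * m - 1 choose (m - 1)) - real (2 * m - 2 choose (m - 1)) =
    (3 * real m - 2) * catalan (m - 1)"
proof -
  \<comment> \<open>After this shift all binomials are multiples of \<open>binom (2k) k\<close>, which is \<open>(k + 1)\<close> times \<open>catalan k\<close>.\<close>
  obtain k where m: "m = Suc k" using assms by (cases m) auto
  have "Suc k * (2 * k + 1 choose Suc k) = (2 * k + 1) * (2 * k choose k)"
    using Suc_times_binomial[of k "2 * k"] by simp
  moreover have "(2 * k + 1) choose (Suc k) = (2 * k + 1) choose k"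
    using binomial_symmetric[of k "2 * k + 1"] by simp
  ultimately have "Suc k * (2 * k + 1 choose k) = (2 * k + 1) * (2 * k choose k)" by (simp only:)
  from arg_cong[OF this, of real] have "real (Suc k) * real (2 * k + 1 choose k) = real (2 * k + 1) * real (2 * k choose k)"
    by (simp only: of_nat_mult)
  then have "real (2 * k + 1 choose k) = (2 * real k + 1) / (real k + 1) * real (2 * k choose k)"
    by (simp add: field_simps)
  then have "2 * real (2 * k + 1 choose k) - real (2 * k choose k) = (3 * real k + 1) / (real k + 1) * real (2 * k choose k)"
    by (simp add: field_simps)
  then show ?thesis using m by (simp add: catalan_def add.commute)
qed

lemma shifted_count_odd:
  assumes "\<And>p. p \<in> S \<Longrightarrow> 1 \<le> p \<and> p \<le> m"
  shows "real (card (downsets (shifted_cells (2 * m + 1) S))) =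
    real (m + 1) * catalan m + (\<Sum>p\<in>S. T' (2 * int m - int p) (int p - 1))"
proof -
  have "int (card (downsets (shifted_cells (2 * m + 1) S))) =
      int (2 * m choose m) + (\<Sum>p\<in>S. ballot (2 * m) (p - 1))"
    using card_downsets_shifted[of S "2 * m + 1"] assms by fastforce
  then have "real_of_int (int (card (downsets (shifted_cells (2 * m + 1) S)))) =
      real (2 * m choose m) + (\<Sum>p\<in>S. real_of_int (ballot (2 * m) (p - 1)))"
    by simp
  also have "(\<Sum>p\<in>S. real_of_int (ballot (2 * m) (p - 1))) = (\<Sum>p\<in>S. T' (2 * int m - int p) (int p - 1))"
  proof (rule sum.cong)
    fix p assume "p \<in> S"
    then have "1 \<le> p" "p \<le> m" using assms by auto
    then show "real_of_int (ballot (2 * m) (p - 1)) = T' (2 * int m - int p) (int p - 1)"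
      using ballot_eq_T'[of "p - 1" "2 * m"] by (simp add: of_nat_diff)
  qed simp
  finally show ?thesis using catalan_central[of m] by simp
qed

lemma shifted_count_even:
  assumes "\<And>p. p \<in> S \<Longrightarrow> 1 \<le> p \<and> p \<le> m" and m: "1 \<le> m"
  shows "real (card (downsets (shifted_cells (2 * m) S))) =
    real (m + 1) / 2 * catalan m + (\<Sum>p\<in>S. T' (2 * int m - int p - 1) (int p - 1))"
proof -
  have "(2 * m - 1) div 2 = m - 1" using m by presburger
  then have "int (card (downsets (shifted_cells (2 * m) S))) =
      int (2 * m - 1 choose (m - 1)) + (\<Sum>p\<in>S. ballot (2 * m - 1) (p - 1))"
    using card_downsets_shifted[of S "2 * m"] assms by fastforce
  then have "real_of_int (int (card (downsets (shifted_cells (2 * m) S)))) =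
      real (2 * m - 1 choose (m - 1)) + (\<Sum>p\<in>S. real_of_int (ballot (2 * m - 1) (p - 1)))"
    by simp
  also have "(\<Sum>p\<in>S. real_of_int (ballot (2 * m - 1) (p - 1))) = (\<Sum>p\<in>S. T' (2 * int m - int p - 1) (int p - 1))"
  proof (rule sum.cong)
    fix p assume "p \<in> S"
    then have p: "1 \<le> p" "p \<le> m" using assms by auto
    have "int (2 * m - 1) - 1 - int (p - 1) = 2 * int m - int p - 1" "int (p - 1) = int p - 1"
      using p m by auto
    then show "real_of_int (ballot (2 * m - 1) (p - 1)) = T' (2 * int m - int p - 1) (int p - 1)"
      using ballot_eq_T'[of "p - 1" "2 * m - 1"] p by simp
  qed simp
  finally show ?thesis using catalan_odd[of "m - 1"] m by (cases m) simp_all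
qed

text \<open>
  Each \<open>p \<in> S\<close> contributes twice a ballot number of size \<open>2m - 1\<close> minus one of size \<open>2m - 2\<close>. By the Pascal
  recursion, one of the two copies minus the subtracted number is again a ballot number of size \<open>2m - 2\<close>;
  this is the first of the two \<open>T'\<close> in the sum, and the other copy is the second.
\<close>

lemma shifted_count_fork:
  assumes S: "\<And>p. p \<in> S \<Longrightarrow> 1 \<le> p \<and> p < m" and m: "1 \<le> m"
  shows "2 * real (card (downsets (shifted_cells (2 * m) S))) - real (card (downsets (shifted_cells (2 * m - 1) S))) =
    (3 * real m - 2) * catalan (m - 1) +
    (\<Sum>p\<in>S. T' (2 * int m - int p - 1) (int p - 2) + T' (2 * int m - int p - 1) (int p - 1))"
proof -
  have d: "(2 * m - 1) div 2 = m - 1" "(2 * m - 1 - 1) div 2 = m - 1" "2 * m - 1 - 1 = 2 * m - 2" "(2 * m - 2) div 2 = m - 1"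
    using m by presburger+
  have even: "int (card (downsets (shifted_cells (2 * m) S))) =
      int (2 * m - 1 choose (m - 1)) + (\<Sum>p\<in>S. ballot (2 * m - 1) (p - 1))"
    using card_downsets_shifted[of S "2 * m"] S m d by fastforce
  have "\<And>p. p \<in> S \<Longrightarrow> 1 \<le> p \<and> 2 * p \<le> 2 * m - 1" using S by fastforce
  then have odd: "int (card (downsets (shifted_cells (2 * m - 1) S))) =
      int (2 * m - 2 choose (m - 1)) + (\<Sum>p\<in>S. ballot (2 * m - 2) (p - 1))"
    using card_downsets_shifted[of S "2 * m - 1"] m unfolding d by simp
  have "2 * real (card (downsets (shifted_cells (2 * m) S))) - real (card (downsets (shifted_cells (2 * m - 1) S))) =
      real_of_int (2 * int (card (downsets (shifted_cells (2 * m) S))) - int (card (downsets (shifted_cells (2 * m - 1) S))))"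
    by simp
  also have "\<dots> = (2 * real (2 * m - 1 choose (m - 1)) - real (2 * m - 2 choose (m - 1))) +
      (\<Sum>p\<in>S. real_of_int (2 * ballot (2 * m - 1) (p - 1) - ballot (2 * m - 2) (p - 1)))"
    unfolding even odd by (simp add: sum_distrib_left sum_subtractf)
  also have "(\<Sum>p\<in>S. real_of_int (2 * ballot (2 * m - 1) (p - 1) - ballot (2 * m - 2) (p - 1))) =
      (\<Sum>p\<in>S. T' (2 * int m - int p - 1) (int p - 2) + T' (2 * int m - int p - 1) (int p - 1))"
  proof (rule sum.cong)
    fix p assume "p \<in> S"
    then have p: "1 \<le> p" "p < m" using S by auto
    have A: "real_of_int (ballot (2 * m - 1) (p - 1)) = T' (2 * int m - int p - 1) (int p - 1)"
    proof -
      have "int (2 * m - 1) - 1 - int (p - 1) = 2 * int m - int p - 1" "int (p - 1) = int p - 1"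
        using p m by auto
      then show ?thesis using ballot_eq_T'[of "p - 1" "2 * m - 1"] p by simp
    qed
    have B: "real_of_int (ballot (2 * m - 1) (p - 1) - ballot (2 * m - 2) (p - 1)) = T' (2 * int m - int p - 1) (int p - 2)"
    proof (cases "p = 1")
      case True
      then show ?thesis by (simp add: ballot_def T'_def)
    next
      case False
      then have "Suc (2 * m - 2) = 2 * m - 1" "Suc (p - 2) = p - 1" using p by auto
      then have "ballot (2 * m - 1) (p - 1) - ballot (2 * m - 2) (p - 1) = ballot (2 * m - 2) (p - 2)"
        using ballot_Suc[of "2 * m - 2" "p - 2"] by simp
      moreover have "int (2 * m - 2) - 1 - int (p - 2) = 2 * int m - int p - 1" "int (p - 2) = int p - 2"
        using p False by auto
      ultimately show ?thesis using ballot_eq_T'[of "p - 2" "2 * m - 2"] p by simp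
    qed
    show "real_of_int (2 * ballot (2 * m - 1) (p - 1) - ballot (2 * m - 2) (p - 1)) =
        T' (2 * int m - int p - 1) (int p - 2) + T' (2 * int m - int p - 1) (int p - 1)"
      unfolding A[symmetric] B[symmetric] by simp
  qed simp
  finally show ?thesis using catalan_fork[OF m] by simp
qed

lemma sum_ballot_shift: "(\<Sum>p = 1..k. ballot M (p - 1)) + (if k = 0 then int (M choose 0) else 0) =
    int (M choose (k - 1))"
proof (cases k)
  case (Suc j)
  have "(\<Sum>p = 1..Suc j. ballot M (p - 1)) = (\<Sum>p = 0..j. ballot M p)"
    by (rule sum.reindex_bij_witness[of _ "\<lambda>p. p + 1" "\<lambda>p. p - 1"]) auto
  then show ?thesis using sum_ballot[of M j] Suc by simp
qed simp

lemma shifted_count_full_even: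
  assumes m: "1 \<le> m"
  shows "real (card (downsets (shifted_cells (2 * m) {p. 1 \<le> p \<and> 2 * p \<le> 2 * m}))) =
    real (m + 1) * catalan m"
proof -
  obtain k where k: "m = Suc k" using m by (cases m) auto
  have S: "{p. 1 \<le> p \<and> 2 * p \<le> 2 * m} = {1..m}" by auto
  have "int (card (downsets (shifted_cells (2 * m) {1..m}))) =
      int ((2 * m - 1) choose ((2 * m - 1) div 2)) + (\<Sum>p = 1..m. ballot (2 * m - 1) (p - 1))"
    by (rule card_downsets_shifted) (use m in auto)
  also have "(\<Sum>p = 1..m. ballot (2 * m - 1) (p - 1)) = int ((2 * m - 1) choose (m - 1))"
    using sum_ballot_shift[of "2 * m - 1" m] m by simp
  also have "(2 * m - 1) div 2 = m - 1" using m by presburger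
  finally have "int (card (downsets (shifted_cells (2 * m) {1..m}))) = int (2 * (2 * k + 1 choose k))"
    using k by simp
  then have "card (downsets (shifted_cells (2 * m) {1..m})) = (2 * m choose m)"
    using binomial_central_odd[of k] k by simp
  then show ?thesis unfolding S using catalan_central[of m] by simp
qed

lemma shifted_count_full_odd:
  "real (card (downsets (shifted_cells (2 * m + 1) {p. 1 \<le> p \<and> 2 * p \<le> 2 * m + 1}))) =
    real (m + 2) / 2 * catalan (m + 1)"
proof -
  have S: "{p. 1 \<le> p \<and> 2 * p \<le> 2 * m + 1} = {1..m}" by auto
  have "int (card (downsets (shifted_cells (2 * m + 1) {1..m}))) =
      int ((2 * m + 1 - 1) choose ((2 * m + 1 - 1) div 2)) + (\<Sum>p = 1..m. ballot (2 * m + 1 - 1) (p - 1))"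
    by (rule card_downsets_shifted) auto
  also have "\<dots> = int (2 * m + 1 choose m)"
    using sum_ballot_shift[of "2 * m" m] by (cases m) auto
  finally show ?thesis unfolding S using catalan_odd[of m] by simp
qed

section \<open>Counting in each type\<close>

text \<open>
  The block of \<open>l + 1\<close> has number \<open>l - r + 1\<close>, because the gaps among the first \<open>l\<close> positions are given by the
  simple roots outside \<open>I\<close>. In the folded types, the symmetry of the blocks then determines \<open>N\<close>.
\<close>

lemma block_index_total:
  assumes X: "rank_ok X l" and J: "J \<subseteq> {1..l}"
  defines "T \<equiv> joins X l J"
  defines "N \<equiv> block_index T (coord_dim X l)"
  shows "X = TypeA \<Longrightarrow> N = l - card J + 1"
    and "X = TypeB \<Longrightarrow> N = 2 * (l - card J) + 1"
    and "X = TypeC \<or> X = TypeD \<Longrightarrow> N = 2 * (l - card J) + (if l \<in> J then 1 else 0)"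
    and "X \<noteq> TypeA \<Longrightarrow> N + 1 \<le> 2 * block_index T (l + 1)"
    and "X \<noteq> TypeA \<Longrightarrow> 2 * block_index T (l + 1) \<le> N + 2"
proof -
  have l: "1 \<le> l" using X by (cases X) auto
  have "{t \<in> J. t < l + 1} = J" using J by auto
  then have top: "block_index T (l + 1) + card J = l + 1"
    using block_index_joins[OF J, of "l + 1" X] by (simp add: T_def)
  have r: "card J \<le> l" using card_mono[OF _ J] by simp
  have symm: "block_index T (coord_dim X l + 1 - i) + block_index T i = N + 1"
    if "X \<noteq> TypeA" "i \<in> {1..coord_dim X l}" for i
    unfolding N_def T_def using that by (intro block_index_symm joins_symmetric[OF _ J])
  have step: "block_index T (l + 1) = block_index T l + (if l \<in> J then 0 else 1)"
    using block_index_Suc[OF l, of T] joins_low[OF J, of l X] l by (simp add: T_def)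
  show "N = l - card J + 1" if "X = TypeA" using top r that by (simp add: N_def)
  show B: "N = 2 * (l - card J) + 1" if "X = TypeB"
    using symm[of "l + 1"] top r that by simp
  show CD: "N = 2 * (l - card J) + (if l \<in> J then 1 else 0)" if "X = TypeC \<or> X = TypeD"
  proof -
    have "X \<noteq> TypeA" "coord_dim X l + 1 - l = l + 1" "l \<in> {1..coord_dim X l}" using that l by auto
    with symm[of l] have "block_index T (l + 1) + block_index T l = N + 1" by simp
    with step top r show ?thesis by (auto split: if_splits)
  qed
  show "N + 1 \<le> 2 * block_index T (l + 1)" "2 * block_index T (l + 1) \<le> N + 2" if "X \<noteq> TypeA"
    using that B CD top r by (cases X; auto)+
qed

text \<open>
  The indices of the simple roots in \<open>I\<close> form the set \<open>J\<close>. The assumption \<open>fork\<close> excludes the subsets in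
  type \<open>D\<close> that have to be handled by a sign change first.
\<close>

locale classical_parabolic =
  fixes X :: classical_type and l :: nat and e :: "nat \<Rightarrow> 'g \<Rightarrow> complex"
    and P :: "('g \<Rightarrow> complex) set" and \<alpha> :: "nat \<Rightarrow> 'g \<Rightarrow> complex" and J :: "nat set"
  assumes rank: "rank_ok X l" and simple_P: "simple_system (std_roots X l e) P"
    and bij: "bij_betw \<alpha> {1..l} P"
    and \<alpha>: "\<And>t. t \<in> {1..l} \<Longrightarrow> \<alpha> t = std_simple X l e t"
    and J: "J \<subseteq> {1..l}" and fork: "X = TypeD \<Longrightarrow> l \<in> J \<Longrightarrow> l - 1 \<in> J"
begin

abbreviation n :: nat where "n \<equiv> coord_dim X l"
abbreviation T :: "nat set" where "T \<equiv> joins X l J"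
abbreviation \<pi> :: "nat \<Rightarrow> nat" where "\<pi> \<equiv> block_index T"
abbreviation N :: nat where "N \<equiv> block_index T (coord_dim X l)"
abbreviation m :: nat where "m \<equiv> l - card J"

sublocale parabolic_coordinates n "coord X l e" "X \<noteq> TypeA" "coord_diag X" \<pi> N "std_roots X l e" P "\<alpha> ` J"
  by (rule parabolic_coordinates_coord[OF rank simple_P bij \<alpha> J fork])

text \<open>
  The numbers of the blocks below the middle in which some simple root of \<open>I\<close> joins two indices.
\<close>

definition S :: "nat set" where
  "S = \<pi> ` {t \<in> J. 2 * \<pi> t \<le> N}"

lemma l_pos: "1 \<le> l"
  using rank by (cases X) auto

lemma T_iff_J: "t \<in> {1..l} \<Longrightarrow> t \<in> T \<longleftrightarrow> t \<in> J"
  by (rule joins_low[OF J])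

lemma upper_block: "X \<noteq> TypeA \<Longrightarrow> l + 1 \<le> i \<Longrightarrow> N + 1 \<le> 2 * \<pi> i"
  using block_index_total(4)[OF rank J] block_index_mono[of "l + 1" i T] by auto

lemma next_block: "\<pi> (l + 1) = \<pi> l + (if l \<in> J then 0 else 1)"
  using block_index_Suc[OF l_pos, of T] T_iff_J[of l] l_pos by simp

lemma join_block: "t \<in> T \<Longrightarrow> 1 \<le> t \<Longrightarrow> \<pi> (t + 1) = \<pi> t"
  using block_index_Suc[of t T] by simp

lemma S_bounds: "p \<in> S \<Longrightarrow> 1 \<le> p \<and> 2 * p \<le> N"
  by (auto simp: S_def block_index_def)

lemma big_blocks_eq:
  assumes X: "X = TypeB \<or> X = TypeD"
  shows "big_blocks = S"
proof (intro equalityI subsetI)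
  fix p assume "p \<in> big_blocks"
  then have p: "2 * p \<le> N" "\<exists>a\<in>{1..n}. \<exists>b\<in>{1..n}. a \<noteq> b \<and> \<pi> a = p \<and> \<pi> b = p"
    unfolding big_blocks_def using X by auto
  then obtain a b where ab: "a \<in> {1..n}" "\<pi> a = p" "\<pi> b = p" "a < b"
    by (metis linorder_neqE_nat)
  have "a \<in> T" using block_index_less_iff[of a b T] ab by auto
  moreover have "a \<le> l" using upper_block[of a] X ab(2) p(1) by (cases "a \<le> l") auto
  ultimately have "a \<in> J" using T_iff_J[of a] ab(1) by simp
  then show "p \<in> S" using ab(2) p(1) by (auto simp: S_def)
next
  fix p assume "p \<in> S"
  then obtain t where t: "t \<in> J" "2 * \<pi> t \<le> N" "p = \<pi> t" by (auto simp: S_def)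
  have tl: "t \<in> {1..l}" using t J by auto
  then have "\<pi> (t + 1) = \<pi> t" using T_iff_J t(1) join_block by auto
  moreover have "t \<in> {1..n}" "t + 1 \<in> {1..n}" "t \<noteq> t + 1" using tl X by auto
  ultimately have "\<exists>a\<in>{1..n}. \<exists>b\<in>{1..n}. a \<noteq> b \<and> \<pi> a = p \<and> \<pi> b = p" using t(3) by metis
  then show "p \<in> big_blocks"
    unfolding big_blocks_def using t by (auto simp: block_index_def)
qed

text \<open>
  If \<open>b\<close> lies to the left of \<open>b'\<close>, the hypothesis on the blocks forces both into one block, and \<open>c\<close> with them.
\<close>

lemma dual_in_between:
  assumes "b \<in> {1..n}" "b' \<in> {1..n}" "\<pi> b' \<le> \<pi> b" "min b b' \<le> c" "c \<le> max b b'"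
  shows "\<pi> b' \<le> \<pi> c \<and> \<pi> c \<le> \<pi> b"
proof (cases "b' \<le> b")
  case True
  then show ?thesis using assms block_index_mono[of b' c T] block_index_mono[of c b T] by simp
next
  case False
  then have "\<pi> b = \<pi> b'" using assms(3) block_index_mono[of b b' T] by simp
  then show ?thesis using False assms block_index_mono[of c b' T] block_index_mono[of b c T] by simp
qed

lemma card_F_sets_A: "X = TypeA \<Longrightarrow> real (card (F_sets (std_roots X l e) P (\<alpha> ` J))) = catalan (m + 1)"
  using card_F_sets_nonsymmetric block_index_total(1)[OF rank J] by simp

lemma card_F_sets_B:
  assumes X: "X = TypeB"
  shows "real (card (F_sets (std_roots X l e) P (\<alpha> ` J))) =
    real (m + 1) * catalan m + (\<Sum>p\<in>S. T' (2 * int m - int p) (int p - 1))"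
proof -
  have N: "N = 2 * m + 1" using block_index_total(2)[OF rank J X] .
  have "card (F_sets (std_roots X l e) P (\<alpha> ` J)) = card (downsets (shifted_cells N big_blocks))"
  proof (rule card_F_sets_symmetric)
    show "X \<noteq> TypeA" using X by simp
    fix b b' a' assume b: "b \<in> {1..n}" "b' \<in> {1..n}" "b' + b = n + 1" "b' \<noteq> b" "\<pi> b' \<le> \<pi> b"
      and a': "a' \<in> {1..n}" "2 * \<pi> a' \<le> N"
    \<comment> \<open>The detour goes through the middle index, whose vector is zero.\<close>
    have "l + 1 \<in> {1..n}" "l + 1 \<noteq> b" "l + 1 \<noteq> b'" using b(3,4) X by auto
    moreover have "l + 1 \<noteq> a'" using upper_block[of "l + 1"] a' X by auto
    moreover have "\<pi> b' \<le> \<pi> (l + 1) \<and> \<pi> (l + 1) \<le> \<pi> b"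
      by (rule dual_in_between) (use b X in auto)
    ultimately show "coord_diag X \<or> (\<exists>c\<in>{1..n}. c \<noteq> b \<and> c \<noteq> b' \<and> c \<noteq> a' \<and> \<pi> b' \<le> \<pi> c \<and> \<pi> c \<le> \<pi> b)"
      by blast
  qed
  also have "\<dots> = card (downsets (shifted_cells (2 * m + 1) S))"
    using big_blocks_eq X N by simp
  finally show ?thesis
    using shifted_count_odd[of S m] S_bounds N by fastforce
qed

lemma card_F_sets_C:
  assumes X: "X = TypeC"
  shows "l \<notin> J \<Longrightarrow> real (card (F_sets (std_roots X l e) P (\<alpha> ` J))) = real (m + 1) * catalan m"
    and "l \<in> J \<Longrightarrow> real (card (F_sets (std_roots X l e) P (\<alpha> ` J))) = real (m + 2) / 2 * catalan (m + 1)"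
proof -
  have N: "N = 2 * m + (if l \<in> J then 1 else 0)" using block_index_total(3)[OF rank J] X by simp
  have "card (F_sets (std_roots X l e) P (\<alpha> ` J)) = card (downsets (shifted_cells N big_blocks))"
    by (rule card_F_sets_symmetric) (use X in auto)
  moreover have "big_blocks = {p. 1 \<le> p \<and> 2 * p \<le> N}"
    unfolding big_blocks_def using X by simp
  ultimately have card: "card (F_sets (std_roots X l e) P (\<alpha> ` J)) =
      card (downsets (shifted_cells N {p. 1 \<le> p \<and> 2 * p \<le> N}))" by simp
  show "real (card (F_sets (std_roots X l e) P (\<alpha> ` J))) = real (m + 1) * catalan m" if "l \<notin> J"
  proof -
    have "J \<subset> {1..l}" using that J l_pos by auto
    then have "card J < l" using psubset_card_mono[of "{1..l}" J] by simp
    then have "1 \<le> m" by simp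
    then show ?thesis using shifted_count_full_even[of m] that N card by simp
  qed
  show "real (card (F_sets (std_roots X l e) P (\<alpha> ` J))) = real (m + 2) / 2 * catalan (m + 1)" if "l \<in> J"
    using shifted_count_full_odd[of m] that N card by simp
qed

text \<open>
  The detour between opposite indices goes through one of the two middle indices. If \<open>b\<close> itself is a middle
  index it goes through \<open>l + 2\<close>, which lies in the block of \<open>l + 1\<close> because \<open>\<alpha>\<^sub>l\<^sub>-\<^sub>1\<close> is in \<open>I\<close>.
\<close>

lemma card_F_sets_D_joined:
  assumes X: "X = TypeD" and join: "l - 1 \<in> J"
  shows "card (F_sets (std_roots X l e) P (\<alpha> ` J)) = card (downsets (shifted_cells N S))"
  unfolding big_blocks_eq[OF disjI2[OF X], symmetric]
proof (rule card_F_sets_symmetric)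
  show "X \<noteq> TypeA" using X by simp
  have l: "4 \<le> l" and n: "n = 2 * l" using rank X by auto
  have "n - (l - 1) = l + 1" using n l by simp
  then have "l + 1 \<in> T" using join X unfolding joins_def by force
  then have last: "\<pi> (l + 2) = \<pi> (l + 1)" using join_block[of "l + 1"] by simp
  fix b b' a' assume b: "b \<in> {1..n}" "b' \<in> {1..n}" "b' + b = n + 1" "b' \<noteq> b" "\<pi> b' \<le> \<pi> b"
    and a': "a' \<in> {1..n}" "2 * \<pi> a' \<le> N"
  have "\<exists>c\<in>{1..n}. c \<noteq> b \<and> c \<noteq> b' \<and> c \<noteq> a' \<and> \<pi> b' \<le> \<pi> c \<and> \<pi> c \<le> \<pi> b"
  proof (cases "b = l \<or> b = l + 1")
    case True
    then have "{b, b'} = {l, l + 1}" using b(3) n by auto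
    then have "\<pi> b' \<le> \<pi> (l + 1) \<and> \<pi> (l + 1) \<le> \<pi> b"
      using dual_in_between[OF b(1,2,5), of "l + 1"] by (auto simp: doubleton_eq_iff)
    moreover have "l + 2 \<in> {1..n}" "l + 2 \<noteq> b" "l + 2 \<noteq> b'" using \<open>{b, b'} = {l, l + 1}\<close> n l by (auto simp: doubleton_eq_iff)
    moreover have "l + 2 \<noteq> a'" using upper_block[of "l + 2"] a' X by auto
    ultimately show ?thesis using last by metis
  next
    case False
    then have "min b b' \<le> l - 1" "l + 2 \<le> max b b'" using b(3,4) n by (auto simp: min_def max_def)
    then have "\<forall>c\<in>{l, l + 1}. c \<noteq> b \<and> c \<noteq> b' \<and> \<pi> b' \<le> \<pi> c \<and> \<pi> c \<le> \<pi> b"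
      using dual_in_between[OF b(1,2,5), of l] dual_in_between[OF b(1,2,5), of "l + 1"] False b(3) n l by auto
    moreover have "l \<in> {1..n}" "l + 1 \<in> {1..n}" "l \<noteq> a' \<or> l + 1 \<noteq> a'" using n l by auto
    ultimately show ?thesis by blast
  qed
  then show "coord_diag X \<or> (\<exists>c\<in>{1..n}. c \<noteq> b \<and> c \<noteq> b' \<and> c \<noteq> a' \<and> \<pi> b' \<le> \<pi> c \<and> \<pi> c \<le> \<pi> b)" ..
qed

lemma card_F_sets_D_one:
  assumes X: "X = TypeD" and join: "l - 1 \<in> J" "l \<notin> J"
  shows "real (card (F_sets (std_roots X l e) P (\<alpha> ` J))) =
    real (m + 1) / 2 * catalan m + (\<Sum>p\<in>S. T' (2 * int m - int p - 1) (int p - 1))"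
proof -
  have N: "N = 2 * m" using block_index_total(3)[OF rank J] X join by simp
  have "J \<subset> {1..l}" using join(2) J l_pos by auto
  then have "card J < l" using psubset_card_mono[of "{1..l}" J] by simp
  then have m: "1 \<le> m" by simp
  have "1 \<le> p \<and> p \<le> m" if "p \<in> S" for p using S_bounds[OF that] N by simp
  from shifted_count_even[OF this m] show ?thesis
    using card_F_sets_D_joined[OF X join(1)] N by simp
qed

lemma card_F_sets_D_both:
  assumes X: "X = TypeD" and join: "l \<in> J"
  shows "real (card (F_sets (std_roots X l e) P (\<alpha> ` J))) =
    real (m + 1) * catalan m + (\<Sum>p\<in>S. T' (2 * int m - int p) (int p - 1))"
proof -
  have N: "N = 2 * m + 1" using block_index_total(3)[OF rank J] X join by simp
  have "1 \<le> p \<and> p \<le> m" if "p \<in> S" for p using S_bounds[OF that] N by simp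
  from shifted_count_odd[OF this] show ?thesis
    using card_F_sets_D_joined[OF X fork[OF X join]] N by simp
qed

lemma card_F_sets_D_none:
  assumes X: "X = TypeD" and join: "l - 1 \<notin> J"
  shows "real (card (F_sets (std_roots X l e) P (\<alpha> ` J))) = (3 * real m - 2) * catalan (m - 1) +
    (\<Sum>p\<in>S. T' (2 * int m - int p - 1) (int p - 2) + T' (2 * int m - int p - 1) (int p - 1))"
proof -
  have l: "4 \<le> l" and n: "n = 2 * l" using rank X by auto
  have l_notin: "l \<notin> J" using fork X join by blast
  have N: "N = 2 * m" using block_index_total(3)[OF rank J] X l_notin by simp
  have "\<pi> l = \<pi> (l - 1) + 1"
    using block_index_Suc[of "l - 1" T] T_iff_J[of "l - 1"] join l by simp
  then have last: "\<pi> (l - 1) < \<pi> l" "\<pi> l < \<pi> (l + 1)" using next_block l_notin by simp_all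
  interpret fork_coordinates n "coord X l e" "X \<noteq> TypeA" "coord_diag X" \<pi> N "std_roots X l e" P "\<alpha> ` J" l
    by unfold_locales (use X l n last in auto)
  have ml: "\<pi> l = m" using N_eq N by simp
  have S: "1 \<le> p \<and> p < m" if p: "p \<in> S" for p
  proof -
    obtain t where t: "t \<in> J" "p = \<pi> t" using p by (auto simp: S_def)
    have "t \<noteq> l" "t \<noteq> l - 1" "t \<le> l" using t J l_notin join by auto
    then have "t \<le> l - 1" by simp
    then have "\<pi> t \<le> \<pi> (l - 1)" by (rule block_index_mono)
    then show ?thesis using last(1) t ml S_bounds[OF p] by simp
  qed
  have "1 \<le> m" using ml by (simp add: block_index_def flip: ml)
  have "card (F_sets (std_roots X l e) P (\<alpha> ` J)) + card (downsets (shifted_cells (N - 1) S)) =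
      2 * card (downsets (shifted_cells N S))"
    using card_F_sets_fork unfolding big_blocks_eq[OF disjI2[OF X]] .
  from this[unfolded N] have "real (card (F_sets (std_roots X l e) P (\<alpha> ` J))) =
      2 * real (card (downsets (shifted_cells (2 * m) S))) - real (card (downsets (shifted_cells (2 * m - 1) S)))"
    by linarith
  also note shifted_count_fork[OF S \<open>1 \<le> m\<close>]
  finally show ?thesis .
qed

context
  fixes K :: "nat \<Rightarrow> ('g \<Rightarrow> complex) set" and s :: nat
  assumes K: "bij_betw K {1..s} (components (std_roots X l e) (\<alpha> ` J))"
    and ordered: "strict_mono_on {1..s} (\<lambda>j. comp_min \<alpha> l (K j))"
begin

definition Q :: "nat \<Rightarrow> nat set" where
  "Q j = {i \<in> {1..l}. \<alpha> i \<in> K j}"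

definition ell :: "nat \<Rightarrow> int" where
  "ell j = int (comp_min \<alpha> l (K j)) - (\<Sum>k = 1..<j. int (card (K k)))"

lemma edges: "t \<in> {1..l} \<Longrightarrow> u \<in> {1..l} \<Longrightarrow>
    dynkin_adjacent (std_roots X l e) (\<alpha> t) (\<alpha> u) \<longleftrightarrow> dynkin_edge X l t u"
  by (rule dynkin_adjacent_iff_edge[OF rank simple_P bij \<alpha> refl])

lemma Q_eq: "Q = (\<lambda>j. {i \<in> {1..l}. \<alpha> i \<in> K j})"
  by (rule ext) (simp add: Q_def)

interpretation iv: interval_components J l "if X = TypeD then l - 1 else l" s Q
  unfolding Q_eq
  by (rule interval_components_of_diagram(1)[OF rank bij_betw_imp_inj_on[OF bij] J _ _ K ordered])
    (use edges fork in blast)+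

lemma component_connected: "j \<in> {1..s} \<Longrightarrow> \<exists>i\<in>J. Q j = connected_in (dynkin_edge X l) J i"
  unfolding Q_eq
  by (rule interval_components_of_diagram(2)[OF rank bij_betw_imp_inj_on[OF bij] J _ _ K ordered])
    (use edges fork in blast)+

lemma component_card: "j \<in> {1..s} \<Longrightarrow> card (K j) = card (Q j)"
  unfolding Q_eq
  by (rule interval_components_of_diagram(3)[OF rank bij_betw_imp_inj_on[OF bij] J _ _ K ordered])
    (use edges fork in blast)+

text \<open>
  The sum counts the nodes of \<open>J\<close> before the component, so \<open>l\<^sub>j\<close> is one more than the number of gaps
  before it.
\<close>

lemma ell_eq: "j \<in> {1..s} \<Longrightarrow> ell j = int (\<pi> (Min (Q j)))"
proof -
  assume j: "j \<in> {1..s}"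
  have "Min (Q j) \<in> J" using iv.Q_subset[OF j] iv.Min_Q[OF j] by blast
  then have "Min (Q j) \<in> {1..l + 1}" using J by auto
  from block_index_joins[OF J this, of X]
  have sum: "\<pi> (Min (Q j)) + (\<Sum>k = 1..<j. card (Q k)) = Min (Q j)"
    using iv.card_before[OF j] by simp
  have "(\<Sum>k = 1..<j. int (card (K k))) = (\<Sum>k = 1..<j. int (card (Q k)))"
    using component_card j by (intro sum.cong) auto
  moreover have "comp_min \<alpha> l (K j) = Min (Q j)" by (simp add: comp_min_def Q_def)
  ultimately show ?thesis
    unfolding ell_def using arg_cong[OF sum, of int] by simp
qed

lemma sum_components:
  assumes X: "X \<noteq> TypeA" and good: "{j \<in> {1..s}. 2 * \<pi> (Min (Q j)) \<le> N} = {1..k}"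
  shows "(\<Sum>j = 1..k. g (ell j)) = (\<Sum>p\<in>S. g (int p))"
proof -
  have low: "t \<le> (if X = TypeD then l - 1 else l)" if t: "t \<in> J" "2 * \<pi> t \<le> N" for t
  proof -
    have "t \<le> l" using t J by auto
    moreover have "t \<noteq> l" if "X = TypeD"
      using upper_block[of "l + 1"] next_block t X by auto
    ultimately show ?thesis by auto
  qed
  have "bij_betw (\<lambda>j. \<pi> (Min (Q j))) {1..k} S"
    unfolding good[symmetric] S_def
    by (rule iv.bij_betw_block_index_Min[OF T_iff_J low])
  then have "(\<Sum>p\<in>S. g (int p)) = (\<Sum>j = 1..k. g (int (\<pi> (Min (Q j)))))"
    by (rule sum.reindex_bij_betw[symmetric])
  also have "\<dots> = (\<Sum>j = 1..k. g (ell j))"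
  proof (rule sum.cong)
    fix j assume "j \<in> {1..k}"
    then have "j \<in> {1..s}" using good by blast
    then show "g (int (\<pi> (Min (Q j)))) = g (ell j)" using ell_eq by simp
  qed simp
  finally show ?thesis ..
qed

lemma good_iff:
  assumes X: "X \<noteq> TypeA" and j: "j \<in> {1..s}"
  shows "2 * \<pi> (Min (Q j)) \<le> N \<longleftrightarrow> l \<notin> J \<or> \<pi> (Min (Q j)) < \<pi> l"
proof -
  have "Min (Q j) \<le> l" using iv.Q_subset[OF j] iv.Min_Q[OF j] J by auto
  then have "\<pi> (Min (Q j)) \<le> \<pi> l" by (rule block_index_mono)
  then show ?thesis
    using upper_block[OF X, of "l + 1"] block_index_total(5)[OF rank J X] next_block by auto
qed

lemma good_all: "X \<noteq> TypeA \<Longrightarrow> l \<notin> J \<Longrightarrow> {j \<in> {1..s}. 2 * \<pi> (Min (Q j)) \<le> N} = {1..s}"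
  using good_iff by auto

lemma Min_Q_le_l: "j \<in> {1..s} \<Longrightarrow> Min (Q j) \<le> l"
  using iv.Q_subset[of j] iv.Min_Q[of j] J by auto

lemma run_to_end:
  assumes j: "j \<in> {1..s}" and eq: "\<pi> (Min (Q j)) = \<pi> l" and b: "Min (Q j) \<le> b" "b \<le> l"
    "b \<le> (if X = TypeD then l - 1 else l)" "l \<in> J"
  shows "b \<in> Q j"
proof (rule iv.run[OF j iv.Min_Q[OF j] _ b(1,3)])
  have pos: "1 \<le> Min (Q j)" using iv.Q_subset[OF j] iv.Min_Q[OF j] J by auto
  have "t \<in> J" if t: "Min (Q j) \<le> t" "t \<le> l" for t
  proof (cases "t = l")
    case False
    then have "t \<in> T" using block_index_less_iff[OF pos Min_Q_le_l[OF j], of T] eq t by auto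
    then show ?thesis using T_iff_J[of t] t pos by simp
  qed (use b in simp)
  then show "{Min (Q j)..b} \<subseteq> J" using b by auto
qed

text \<open>
  A component that reaches the middle block contains \<open>l\<close>, or else, in type \<open>D\<close>, the node \<open>l - 1\<close>, which is
  connected to \<open>l\<close> through \<open>l - 2\<close>. There is only one such component.
\<close>

lemma good_all_but_last:
  assumes X: "X \<noteq> TypeA" and l: "l \<in> J" and chain: "X = TypeD \<Longrightarrow> l - 2 \<in> J"
  shows "{j \<in> {1..s}. 2 * \<pi> (Min (Q j)) \<le> N} = {1..s - 1}"
proof -
  obtain j0 where j0: "j0 \<in> {1..s}" "l \<in> Q j0" using iv.cover l by blast
  have eq0: "\<pi> (Min (Q j0)) = \<pi> l" by (rule iv.block_index_Min[OF T_iff_J j0])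
  have linked: "t \<in> Q j0" if "X = TypeD" "t \<in> {l - 2, l - 1}" for t
  proof -
    obtain i where i: "Q j0 = connected_in (dynkin_edge X l) J i" using component_connected[OF j0(1)] by blast
    have l4: "4 \<le> l" using rank that by simp
    have edge: "dynkin_edge X l l (l - 2)" "dynkin_edge X l (l - 2) (l - 1)"
      using that(1) l4 by (auto simp: dynkin_edge_def)
    have "l - 2 \<in> Q j0"
      using connected_in_step[where E = "dynkin_edge X l" and j = l and k = "l - 2"] edge(1) j0(2) chain that(1) unfolding i by blast
    moreover from this have "l - 1 \<in> Q j0"
      using connected_in_step[where E = "dynkin_edge X l" and j = "l - 2" and k = "l - 1"] edge(2) fork that(1) l unfolding i by blast
    ultimately show ?thesis using that(2) by blast
  qed
  have unique: "j = j0" if j: "j \<in> {1..s}" and eq: "\<pi> (Min (Q j)) = \<pi> l" for j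
  proof (cases "X = TypeD \<and> Min (Q j) = l")
    case True
    then have "l \<in> Q j" using iv.Min_Q[OF j] by simp
    then show ?thesis using iv.disjoint[OF j j0(1)] j0(2) by blast
  next
    case False
    let ?b = "if X = TypeD then l - 1 else l"
    have "?b \<in> Q j" using Min_Q_le_l[OF j] False l by (intro run_to_end[OF j eq]) auto
    moreover have "?b \<in> Q j0" using linked j0(2) by auto
    ultimately show ?thesis using iv.disjoint[OF j j0(1)] by blast
  qed
  have "j0 = s"
  proof (rule ccontr)
    assume "j0 \<noteq> s"
    then have less: "s \<in> {1..s}" "j0 < s" using j0 by auto
    have "Min (Q s) \<noteq> l"
      using iv.Min_Q[OF less(1)] iv.disjoint[OF less(1) j0(1)] j0(2) less(2) by force
    then have "Min (Q s) \<le> (if X = TypeD then l - 1 else l)" using Min_Q_le_l[OF less(1)] by auto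
    from iv.block_index_Min_less[OF T_iff_J j0(1) less this] eq0
      block_index_mono[OF Min_Q_le_l[OF less(1)], of T]
    show False by simp
  qed
  have "2 * \<pi> (Min (Q j)) \<le> N \<longleftrightarrow> j \<noteq> s" if j: "j \<in> {1..s}" for j
    using good_iff[OF X j] l unique[OF j] eq0 \<open>j0 = s\<close> block_index_mono[OF Min_Q_le_l[OF j], of T]
    by (metis le_neq_implies_less less_irrefl)
  then show ?thesis using j0(1) by auto
qed

text \<open>
  Without \<open>l - 2\<close> both \<open>{l - 1}\<close> and \<open>{l}\<close> are components, and both belong to the middle block.
\<close>

lemma good_all_but_two:
  assumes X: "X = TypeD" and l: "l \<in> J" and gap: "l - 2 \<notin> J"
  shows "{j \<in> {1..s}. 2 * \<pi> (Min (Q j)) \<le> N} = {1..s - 2}"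
proof -
  have l4: "4 \<le> l" using rank X by simp
  have l1: "l - 1 \<in> J" by (rule fork[OF X l])
  have XA: "X \<noteq> TypeA" using X by simp
  have isolated: "Q j = {t}" if j: "j \<in> {1..s}" and t: "t \<in> Q j" "t = l \<or> t = l - 1" for j t
  proof -
    obtain i where i: "i \<in> J" "Q j = connected_in (dynkin_edge X l) J i" using component_connected[OF j] by blast
    have "t \<in> J" using iv.Q_subset[OF j] t by blast
    have no_edge: "\<not> dynkin_edge X l t u" if "u \<in> J" for u
    proof -
      have "u \<noteq> l - 2" using that gap by auto
      then show ?thesis using t(2) l4 X by (auto simp: dynkin_edge_def)
    qed
    have sym: "dynkin_edge X l v u" if "dynkin_edge X l u v" for u v
      using that by (auto simp: dynkin_edge_def split: if_splits)
    have "Q j = connected_in (dynkin_edge X l) J t"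
      using connected_in_eq[of "dynkin_edge X l" t J i] sym t(1) i by simp
    moreover have "u = t" if "(t, u) \<in> {(u, v). u \<in> J \<and> v \<in> J \<and> dynkin_edge X l u v}\<^sup>*" for u
      using that by (induction rule: rtrancl_induct) (use no_edge in auto)
    ultimately show ?thesis using t(1) by (auto simp: connected_in_def)
  qed
  obtain j1 where j1: "j1 \<in> {1..s}" "l \<in> Q j1" using iv.cover l by blast
  obtain j2 where j2: "j2 \<in> {1..s}" "l - 1 \<in> Q j2" using iv.cover l1 by blast
  have mins: "Min (Q j1) = l" "Min (Q j2) = l - 1"
    using isolated[OF j1] isolated[OF j2] by simp_all
  have mono: "Min (Q j) < Min (Q k)" if "j \<in> {1..s}" "k \<in> {1..s}" "j < k" for j k
    using iv.ordered that by (simp add: strict_mono_on_def)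
  have "j1 = s"
  proof (rule ccontr)
    assume "j1 \<noteq> s"
    then have "s \<in> {1..s}" "j1 < s" using j1 by auto
    from mono[OF j1(1) this] Min_Q_le_l[OF this(1)] mins(1) show False by simp
  qed
  have "j2 < s" using mins j2(1) \<open>j1 = s\<close> l4 by (metis atLeastAtMost_iff diff_less le_neq_implies_less less_irrefl less_le_trans zero_less_numeral zero_less_one)
  have "j2 = s - 1"
  proof (rule ccontr)
    assume "j2 \<noteq> s - 1"
    then have "s - 1 \<in> {1..s}" "j2 < s - 1" "s - 1 < s" using \<open>j2 < s\<close> j2(1) by auto
    then show False using mono[of j2 "s - 1"] mono[of "s - 1" s] j2(1) j1(1) mins \<open>j1 = s\<close> by simp
  qed
  have last: "\<pi> (l - 1) = \<pi> l"
    using join_block[of "l - 1"] T_iff_J[of "l - 1"] l1 l4 by simp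
  have "2 * \<pi> (Min (Q j)) \<le> N \<longleftrightarrow> j < s - 1" if j: "j \<in> {1..s}" for j
  proof -
    have "\<pi> (Min (Q j)) < \<pi> l" if "j < s - 1"
      using iv.block_index_Min_less[OF T_iff_J j j2(1)] that \<open>j2 = s - 1\<close> mins(2) last X by simp
    moreover have "\<pi> (Min (Q j)) = \<pi> l" if "\<not> j < s - 1"
    proof -
      have "j = j2 \<or> j = j1" using that j \<open>j1 = s\<close> \<open>j2 = s - 1\<close> by auto
      then show ?thesis using mins last by auto
    qed
    ultimately show ?thesis using good_iff[OF XA j] l by (metis less_irrefl)
  qed
  then show ?thesis by auto
qed

end

end

section \<open>The number of ad-nilpotent ideals\<close>

text \<open>
  Changing the sign of \<open>e\<^sub>l\<close> is a symmetry of the root system of type \<open>D\<close> that exchanges the last two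
  simple roots.
\<close>

definition negate_at :: "nat \<Rightarrow> (nat \<Rightarrow> 'v::ab_group_add) \<Rightarrow> nat \<Rightarrow> 'v" where
  "negate_at l e i = (if i = l then - e i else e i)"

lemma negate_at_negate_at [simp]: "negate_at l (negate_at l e) = e"
  by (auto simp: negate_at_def)

lemma std_roots_D_negate: "std_roots_D l (negate_at l e) = std_roots_D l e"
proof -
  have sub: "std_roots_D l (negate_at l e) \<subseteq> std_roots_D l e" for e :: "nat \<Rightarrow> 'v::ab_group_add"
  proof
    have mem: "e i - e j \<in> std_roots_D l e" "e i + e j \<in> std_roots_D l e" "- (e i + e j) \<in> std_roots_D l e"
      if "i \<in> {1..l}" "j \<in> {1..l}" "i \<noteq> j" for i j
      using that unfolding std_roots_D_def by blast+
    have mem': "- e i - e j \<in> std_roots_D l e" "- e i + e j \<in> std_roots_D l e"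
      if "i \<in> {1..l}" "j \<in> {1..l}" "i \<noteq> j" for i j
      using mem(3)[OF that] mem(1)[OF that(2,1)] that(3) by (simp_all add: algebra_simps)
    fix x assume "x \<in> std_roots_D l (negate_at l e)"
    then obtain i j where ij: "i \<in> {1..l}" "j \<in> {1..l}" "i \<noteq> j"
      and x: "x = negate_at l e i - negate_at l e j \<or> x = negate_at l e i + negate_at l e j
        \<or> x = - (negate_at l e i + negate_at l e j)"
      unfolding std_roots_D_def by blast
    from x show "x \<in> std_roots_D l e"
    proof (elim disjE; hypsubst)
      show "negate_at l e i - negate_at l e j \<in> std_roots_D l e"
        using mem[OF ij] mem'[OF ij] ij(3) by (auto simp: negate_at_def)
      show "negate_at l e i + negate_at l e j \<in> std_roots_D l e"
        using mem[OF ij] mem'[OF ij] ij(3) by (auto simp: negate_at_def)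
      show "- (negate_at l e i + negate_at l e j) \<in> std_roots_D l e"
        using mem[OF ij] mem[OF ij(2,1)] mem'[OF ij] ij(3) by (auto simp: negate_at_def)
    qed
  qed
  from sub[of e] sub[of "negate_at l e"] show ?thesis by simp
qed

definition swap_last :: "nat \<Rightarrow> nat \<Rightarrow> nat" where
  "swap_last l i = (if i = l then l - 1 else if i = l - 1 then l else i)"

lemma swap_last_mem: "2 \<le> l \<Longrightarrow> i \<in> {1..l} \<Longrightarrow> swap_last l i \<in> {1..l}"
  by (auto simp: swap_last_def)

lemma swap_last_swap_last: "2 \<le> l \<Longrightarrow> swap_last l (swap_last l i) = i"
  by (auto simp: swap_last_def)

lemma std_simple_negate:
  assumes "2 \<le> l" "t \<in> {1..l}"
  shows "std_simple TypeD l e (swap_last l t) = std_simple TypeD l (negate_at l e) t"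
  using assms by (auto simp: swap_last_def negate_at_def)

lemma classical_parabolic_index:
  assumes "simple_system D P" "bij_betw \<alpha> {1..l} P" "rank_ok X l" "D = std_roots X l e"
    "\<forall>i\<in>{1..l}. \<alpha> i = std_simple X l e i" "I \<subseteq> P"
    and fork: "X = TypeD \<Longrightarrow> \<alpha> l \<in> I \<Longrightarrow> \<alpha> (l - 1) \<in> I"
  defines "J \<equiv> {t \<in> {1..l}. \<alpha> t \<in> I}"
  shows "classical_parabolic X l e P \<alpha> J" "\<alpha> ` J = I" "card J = card I" "\<And>t. t \<in> {1..l} \<Longrightarrow> t \<in> J \<longleftrightarrow> \<alpha> t \<in> I"
proof -
  show mem: "t \<in> J \<longleftrightarrow> \<alpha> t \<in> I" if "t \<in> {1..l}" for t using that by (simp add: J_def)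
  show "classical_parabolic X l e P \<alpha> J"
    by unfold_locales (use assms in \<open>auto simp: J_def\<close>)
  show img: "\<alpha> ` J = I" using assms(2,6) by (auto simp: J_def bij_betw_def)
  have "inj_on \<alpha> J" using bij_betw_imp_inj_on[OF assms(2)] by (rule inj_on_subset) (auto simp: J_def)
  then show "card J = card I" using card_image img by metis
qed

theorem theorem5p12:
  fixes scale :: "complex \<Rightarrow> 'g::ab_group_add \<Rightarrow> 'g"
    and brk :: "'g \<Rightarrow> 'g \<Rightarrow> 'g"
    and H :: "'g set"
    and \<Delta> \<Pi> I :: "('g \<Rightarrow> complex) set"
    and \<alpha> :: "nat \<Rightarrow> 'g \<Rightarrow> complex"
    and X :: classical_type
    and l r s :: nat
    and K :: "nat \<Rightarrow> ('g \<Rightarrow> complex) set"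
  assumes "simple_lie_algebra scale brk"
    and "lie_algebra.cartan_subalgebra scale brk H"
    and "\<Delta> = lie_algebra.roots scale brk H"
    and "simple_system \<Delta> \<Pi>"
    and "bij_betw \<alpha> {1..l} \<Pi>"
    and "root_system_type X l \<Delta> \<alpha>"
    and "I \<subseteq> \<Pi>" and "r = card I"
    and "bij_betw K {1..s} (components \<Delta> I)"
    and "strict_mono_on {1..s} (\<lambda>j. comp_min \<alpha> l (K j))"
  shows
    "(X = TypeA \<longrightarrow> real (card (F_sets \<Delta> \<Pi> I)) = catalan (l - r + 1)) \<and>
     (X = TypeB \<longrightarrow> real (card (F_sets \<Delta> \<Pi> I)) =
        real (l - r + 1) * catalan (l - r) +
        (\<Sum>j = 1..(if \<alpha> l \<in> I then s - 1 else s).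
           T' (2 * int (l - r) - ell_B \<alpha> l K j) (ell_B \<alpha> l K j - 1))) \<and>
     (X = TypeC \<longrightarrow>
        (\<alpha> l \<notin> I \<longrightarrow> real (card (F_sets \<Delta> \<Pi> I)) = real (l - r + 1) * catalan (l - r)) \<and>
        (\<alpha> l \<in> I \<longrightarrow> real (card (F_sets \<Delta> \<Pi> I)) = real (l - r + 2) / 2 * catalan (l - r + 1))) \<and>
     (X = TypeD \<longrightarrow>
        (card ({\<alpha> (l - 1), \<alpha> l} \<inter> I) = 1 \<longrightarrow> real (card (F_sets \<Delta> \<Pi> I)) =
           real (l - r + 1) / 2 * catalan (l - r) +
           (\<Sum>j = 1..s. T' (2 * int (l - r) - ell_D \<alpha> l s K j - 1) (ell_D \<alpha> l s K j - 1))) \<and>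
        ({\<alpha> (l - 1), \<alpha> l} \<subseteq> I \<longrightarrow> real (card (F_sets \<Delta> \<Pi> I)) =
           real (l - r + 1) * catalan (l - r) +
           (\<Sum>j = 1..num_terms_D \<alpha> l I s.
              T' (2 * int (l - r) - ell_D \<alpha> l s K j) (ell_D \<alpha> l s K j - 1))) \<and>
        ({\<alpha> (l - 1), \<alpha> l} \<inter> I = {} \<longrightarrow> real (card (F_sets \<Delta> \<Pi> I)) =
           (3 * real (l - r) - 2) * catalan (l - r - 1) +
           (\<Sum>j = 1..s. T' (2 * int (l - r) - ell_D \<alpha> l s K j - 1) (ell_D \<alpha> l s K j - 2) +
                       T' (2 * int (l - r) - ell_D \<alpha> l s K j - 1) (ell_D \<alpha> l s K j - 1))))"
proof -
  note simple = assms(4) and bij_simple = assms(5) and I = assms(7) and r = assms(8)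
    and K = assms(9) and ordered = assms(10)
  obtain e where rank: "rank_ok X l" and D: "\<Delta> = std_roots X l e"
    and \<alpha>: "\<forall>i\<in>{1..l}. \<alpha> i = std_simple X l e i"
    using assms(6) by (auto simp: root_system_type_def)
  define J where "J = {t \<in> {1..l}. \<alpha> t \<in> I}"
  have l: "1 \<le> l" using rank by (cases X) auto
  have lJ: "l \<in> J \<longleftrightarrow> \<alpha> l \<in> I" using l by (simp add: J_def)
  note index = classical_parabolic_index[OF simple bij_simple rank D \<alpha> I, folded J_def]
  have notD: "classical_parabolic X l e \<Pi> \<alpha> J" "\<alpha> ` J = I" "card J = r" if "X \<noteq> TypeD"
    using index(1-3) that r by blast+
  have A: "real (card (F_sets \<Delta> \<Pi> I)) = catalan (l - r + 1)" if X: "X = TypeA"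
    using classical_parabolic.card_F_sets_A[OF notD(1) X] notD(2,3) D X by simp
  have C: "(\<alpha> l \<notin> I \<longrightarrow> real (card (F_sets \<Delta> \<Pi> I)) = real (l - r + 1) * catalan (l - r)) \<and>
        (\<alpha> l \<in> I \<longrightarrow> real (card (F_sets \<Delta> \<Pi> I)) = real (l - r + 2) / 2 * catalan (l - r + 1))" if X: "X = TypeC"
    using classical_parabolic.card_F_sets_C[OF notD(1) X] notD(2,3) D X lJ by simp
  have B: "real (card (F_sets \<Delta> \<Pi> I)) = real (l - r + 1) * catalan (l - r) +
        (\<Sum>j = 1..(if \<alpha> l \<in> I then s - 1 else s).
           T' (2 * int (l - r) - ell_B \<alpha> l K j) (ell_B \<alpha> l K j - 1))" if X: "X = TypeB"
  proof -
    interpret classical_parabolic X l e \<Pi> \<alpha> J using notD(1) X by simp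
    have I_eq: "\<alpha> ` J = I" and r_eq: "card J = r" using notD(2,3) X by simp_all
    have K': "bij_betw K {1..s} (components (std_roots X l e) (\<alpha> ` J))" using K D I_eq by simp
    have ell: "ell_B \<alpha> l K j = ell K j" for j
      unfolding ell_B_def ell_def[OF K' ordered] ..
    let ?k = "if \<alpha> l \<in> I then s - 1 else s"
    have "(\<Sum>j = 1..?k. T' (2 * int (l - r) - ell K j) (ell K j - 1)) =
        (\<Sum>p\<in>S. T' (2 * int (l - r) - int p) (int p - 1))"
      by (rule sum_components[OF K' ordered])
        (use X lJ good_all[OF K' ordered] good_all_but_last[OF K' ordered] in auto)
    then show ?thesis
      using card_F_sets_B[OF X] unfolding ell I_eq r_eq D by simp
  qed
  have D_case: "(card ({\<alpha> (l - 1), \<alpha> l} \<inter> I) = 1 \<longrightarrow> real (card (F_sets \<Delta> \<Pi> I)) =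
           real (l - r + 1) / 2 * catalan (l - r) +
           (\<Sum>j = 1..s. T' (2 * int (l - r) - ell_D \<alpha> l s K j - 1) (ell_D \<alpha> l s K j - 1))) \<and>
        ({\<alpha> (l - 1), \<alpha> l} \<subseteq> I \<longrightarrow> real (card (F_sets \<Delta> \<Pi> I)) =
           real (l - r + 1) * catalan (l - r) +
           (\<Sum>j = 1..num_terms_D \<alpha> l I s.
              T' (2 * int (l - r) - ell_D \<alpha> l s K j) (ell_D \<alpha> l s K j - 1))) \<and>
        ({\<alpha> (l - 1), \<alpha> l} \<inter> I = {} \<longrightarrow> real (card (F_sets \<Delta> \<Pi> I)) =
           (3 * real (l - r) - 2) * catalan (l - r - 1) +
           (\<Sum>j = 1..s. T' (2 * int (l - r) - ell_D \<alpha> l s K j - 1) (ell_D \<alpha> l s K j - 2) +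
                       T' (2 * int (l - r) - ell_D \<alpha> l s K j - 1) (ell_D \<alpha> l s K j - 1)))"
    if X: "X = TypeD"
  proof -
    have l4: "4 \<le> l" using rank X by simp
    have ne: "\<alpha> (l - 1) \<noteq> \<alpha> l"
    proof
      assume "\<alpha> (l - 1) = \<alpha> l"
      then have "l - 1 = l"
        by (rule inj_onD[OF bij_betw_imp_inj_on[OF bij_simple]]) (use l4 in auto)
      with l4 show False by simp
    qed
    then have one: "card ({\<alpha> (l - 1), \<alpha> l} \<inter> I) = 1 \<longleftrightarrow> (\<alpha> (l - 1) \<in> I) \<noteq> (\<alpha> l \<in> I)"
      by (cases "\<alpha> (l - 1) \<in> I"; cases "\<alpha> l \<in> I") (simp_all add: Int_insert_left)
    show ?thesis
    proof (cases "\<alpha> l \<in> I \<longrightarrow> \<alpha> (l - 1) \<in> I")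
      case True
      then have fork: "\<alpha> l \<in> I \<Longrightarrow> \<alpha> (l - 1) \<in> I" by blast
      note index_D = index[OF fork]
      interpret classical_parabolic X l e \<Pi> \<alpha> J by (rule index_D(1))
      have I_eq: "\<alpha> ` J = I" by (rule index_D(2))
      have r_eq: "card J = r" using index_D(3) r by simp
      have mem: "l \<in> J \<longleftrightarrow> \<alpha> l \<in> I" "l - 1 \<in> J \<longleftrightarrow> \<alpha> (l - 1) \<in> I" "l - 2 \<in> J \<longleftrightarrow> \<alpha> (l - 2) \<in> I"
        using l4 by (auto simp: J_def)
      have XA: "X \<noteq> TypeA" using X by simp
      have K': "bij_betw K {1..s} (components (std_roots X l e) (\<alpha> ` J))" using K D I_eq by simp
      have K_sub: "K j \<subseteq> I" if "j \<in> {1..s}" for j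
        using bij_betwE[OF K] that unfolding components_def quotient_def by blast
      have ell: "ell_D \<alpha> l s K j = ell K j" if "\<alpha> l \<notin> I \<or> j \<noteq> s" "j \<in> {1..s}" for j
        using that K_sub[of j] unfolding ell_D_def ell_def[OF K' ordered] by auto
      have sum_all: "(\<Sum>j = 1..s. g (ell_D \<alpha> l s K j)) = (\<Sum>p\<in>S. g (int p))" if "\<alpha> l \<notin> I" for g :: "int \<Rightarrow> real"
      proof -
        have "(\<Sum>j = 1..s. g (ell_D \<alpha> l s K j)) = (\<Sum>j = 1..s. g (ell K j))"
          using ell that by (intro sum.cong) simp_all
        also have "\<dots> = (\<Sum>p\<in>S. g (int p))"
          by (rule sum_components[OF K' ordered XA good_all[OF K' ordered XA]]) (use that mem in simp)
        finally show ?thesis .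
      qed
      have sum_both: "(\<Sum>j = 1..num_terms_D \<alpha> l I s. g (ell_D \<alpha> l s K j)) = (\<Sum>p\<in>S. g (int p))"
        if "\<alpha> l \<in> I" for g :: "int \<Rightarrow> real"
      proof -
        let ?k = "num_terms_D \<alpha> l I s"
        have "(\<Sum>j = 1..?k. g (ell_D \<alpha> l s K j)) = (\<Sum>j = 1..?k. g (ell K j))"
        proof (rule sum.cong)
          fix j assume "j \<in> {1..?k}"
          then have "j \<noteq> s" "j \<in> {1..s}" by (auto simp: num_terms_D_def split: if_splits)
          then show "g (ell_D \<alpha> l s K j) = g (ell K j)" using ell by simp
        qed simp
        also have "\<dots> = (\<Sum>p\<in>S. g (int p))"
        proof (rule sum_components[OF K' ordered XA])
          show "{j \<in> {1..s}. 2 * block_index (joins X l J) (Min (Q K j)) \<le> block_index (joins X l J) (coord_dim X l)} = {1..?k}"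
            using good_all_but_last[OF K' ordered XA] good_all_but_two[OF K' ordered X] that mem
            by (cases "\<alpha> (l - 2) \<in> I") (simp_all add: num_terms_D_def)
        qed
        finally show ?thesis .
      qed
      show ?thesis
      proof (intro conjI impI)
        assume "card ({\<alpha> (l - 1), \<alpha> l} \<inter> I) = 1"
        then have "l - 1 \<in> J" "l \<notin> J" using one True mem by auto
        then show "real (card (F_sets \<Delta> \<Pi> I)) = real (l - r + 1) / 2 * catalan (l - r) +
            (\<Sum>j = 1..s. T' (2 * int (l - r) - ell_D \<alpha> l s K j - 1) (ell_D \<alpha> l s K j - 1))"
          using card_F_sets_D_one[OF X] sum_all[of "\<lambda>q. T' (2 * int (l - r) - q - 1) (q - 1)"] mem
          unfolding I_eq r_eq D by simp
      next
        assume "{\<alpha> (l - 1), \<alpha> l} \<subseteq> I"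
        then have "l \<in> J" using mem by auto
        then show "real (card (F_sets \<Delta> \<Pi> I)) = real (l - r + 1) * catalan (l - r) +
            (\<Sum>j = 1..num_terms_D \<alpha> l I s. T' (2 * int (l - r) - ell_D \<alpha> l s K j) (ell_D \<alpha> l s K j - 1))"
          using card_F_sets_D_both[OF X] sum_both[of "\<lambda>q. T' (2 * int (l - r) - q) (q - 1)"] mem
          unfolding I_eq r_eq D by simp
      next
        assume "{\<alpha> (l - 1), \<alpha> l} \<inter> I = {}"
        then have "l - 1 \<notin> J" "\<alpha> l \<notin> I" using mem by auto
        then show "real (card (F_sets \<Delta> \<Pi> I)) = (3 * real (l - r) - 2) * catalan (l - r - 1) +
           (\<Sum>j = 1..s. T' (2 * int (l - r) - ell_D \<alpha> l s K j - 1) (ell_D \<alpha> l s K j - 2) +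
                       T' (2 * int (l - r) - ell_D \<alpha> l s K j - 1) (ell_D \<alpha> l s K j - 1))"
          using card_F_sets_D_none[OF X]
            sum_all[of "\<lambda>q. T' (2 * int (l - r) - q - 1) (q - 2) + T' (2 * int (l - r) - q - 1) (q - 1)"]
          unfolding I_eq r_eq D by simp
      qed
    next
      case False
      then have lI: "\<alpha> l \<in> I" "\<alpha> (l - 1) \<notin> I" by auto
      have l2: "2 \<le> l" using l4 by simp
      \<comment> \<open>The sign change of \<open>e l\<close> brings \<open>I\<close> into the form with \<open>\<alpha> (l - 1)\<close> instead of \<open>\<alpha> l\<close>.\<close>
      define \<alpha>' where "\<alpha>' = (\<lambda>t. \<alpha> (swap_last l t))"
      define J' where "J' = {t \<in> {1..l}. \<alpha>' t \<in> I}"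
      have D': "\<Delta> = std_roots X l (negate_at l e)"
        using D X by (simp add: std_roots_D_negate)
      have \<alpha>': "\<forall>i\<in>{1..l}. \<alpha>' i = std_simple X l (negate_at l e) i"
      proof
        fix i assume i: "i \<in> {1..l}"
        have "\<alpha>' i = std_simple X l e (swap_last l i)"
          using \<alpha> swap_last_mem[OF l2 i] unfolding \<alpha>'_def by blast
        then show "\<alpha>' i = std_simple X l (negate_at l e) i"
          using std_simple_negate[OF l2 i, of e] X by (simp only:)
      qed
      have "bij_betw (swap_last l) {1..l} {1..l}"
        by (rule bij_betw_byWitness[where f' = "swap_last l"])
          (use swap_last_mem[OF l2] swap_last_swap_last[OF l2] in auto)
      from bij_betw_trans[OF this bij_simple] have bij': "bij_betw \<alpha>' {1..l} \<Pi>"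
        unfolding \<alpha>'_def comp_def .
      have vals: "\<alpha>' l = \<alpha> (l - 1)" "\<alpha>' (l - 1) = \<alpha> l" "\<And>t. t \<noteq> l \<Longrightarrow> t \<noteq> l - 1 \<Longrightarrow> \<alpha>' t = \<alpha> t"
        using l4 by (auto simp: \<alpha>'_def swap_last_def)
      have index': "classical_parabolic X l (negate_at l e) \<Pi> \<alpha>' J'" "\<alpha>' ` J' = I" "card J' = card I"
      proof -
        have fork': "\<alpha>' (l - 1) \<in> I" using vals lI by simp
        note idx = classical_parabolic_index[OF simple bij' rank D' \<alpha>' I fork', folded J'_def]
        show "classical_parabolic X l (negate_at l e) \<Pi> \<alpha>' J'" "\<alpha>' ` J' = I" "card J' = card I"
          by (rule idx(1) idx(2) idx(3))+
      qed
      interpret classical_parabolic X l "negate_at l e" \<Pi> \<alpha>' J' by (rule index'(1))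
      have XA: "X \<noteq> TypeA" using X by simp
      have K_sub: "K j \<subseteq> I" if "j \<in> {1..s}" for j
        using bij_betwE[OF K] that unfolding components_def quotient_def by blast
      have K': "bij_betw K {1..s} (components (std_roots X l (negate_at l e)) (\<alpha>' ` J'))"
        using K D' index'(2) by simp
      let ?A = "\<lambda>j. {i \<in> {1..l}. \<alpha> i \<in> K j}" and ?A' = "\<lambda>j. {i \<in> {1..l}. \<alpha>' i \<in> K j}"
      have l_mem: "l \<in> {1..l}" "l - 1 \<in> {1..l}" using l4 by auto
      have inj: "i = l" if "\<alpha> i = \<alpha> l" "i \<in> {1..l}" for i
        using inj_onD[OF bij_betw_imp_inj_on[OF bij_simple] that l_mem(1)] .
      have inj': "i = l - 1" if "\<alpha>' i = \<alpha> l" "i \<in> {1..l}" for i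
        using inj_onD[OF bij_betw_imp_inj_on[OF bij'] that(1)[folded vals(2)] that(2) l_mem(2)] .
      have Min_A: "comp_min \<alpha> l (K j) \<in> ?A j" if j: "j \<in> {1..s}" for j
      proof -
        have "K j \<noteq> {}" using bij_betwE[OF K] j unfolding components_def quotient_def by blast
        then obtain x where x: "x \<in> K j" "x \<in> \<Pi>" using K_sub[OF j] I by blast
        then obtain t where "t \<in> {1..l}" "\<alpha> t = x" using bij_simple unfolding bij_betw_def by blast
        with x have "?A j \<noteq> {}" by blast
        then show ?thesis unfolding comp_min_def by (intro Min_in) simp_all
      qed
      have not_l1: "comp_min \<alpha> l (K j) \<noteq> l - 1" if j: "j \<in> {1..s}" for j
        using Min_A[OF j] K_sub[OF j] lI by auto
      \<comment> \<open>Only the component \<open>{\<alpha> l}\<close> changes its smallest index, from \<open>l\<close> to \<open>l - 1\<close>.\<close>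
      have comp_min': "int (comp_min \<alpha>' l (K j)) = int (comp_min \<alpha> l (K j)) - (if K j = {\<alpha> l} then 1 else 0)"
        if j: "j \<in> {1..s}" for j
      proof (cases "K j = {\<alpha> l}")
        case True
        have "?A j = {l}"
          unfolding True using inj l_mem(1) by blast
        moreover have "?A' j = {l - 1}"
          unfolding True using inj' l_mem(2) vals(2) by blast
        ultimately show ?thesis using True l2 by (simp add: comp_min_def of_nat_diff)
      next
        case False
        have other: "t \<in> ?A' j \<longleftrightarrow> t \<in> ?A j" if "t \<noteq> l" "t \<noteq> l - 1" for t
          using vals(3)[OF that] by simp
        have "l \<notin> ?A' j" using vals(1) lI K_sub[OF j] by auto
        have "comp_min \<alpha> l (K j) \<noteq> l \<or> \<alpha> l \<notin> K j"
        proof (rule ccontr)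
          assume "\<not> ?thesis"
          then have "Min (?A j) = l" "\<alpha> l \<in> K j" by (auto simp: comp_min_def)
          moreover obtain x where "x \<in> K j" "x \<noteq> \<alpha> l" using False \<open>\<alpha> l \<in> K j\<close> by blast
          moreover from this have "x \<in> \<alpha> ` {1..l}" using K_sub[OF j] I bij_simple unfolding bij_betw_def by blast
          ultimately obtain t where t: "t \<in> ?A j" "t \<noteq> l" by blast
          then have "Min (?A j) \<le> t" by (intro Min_le) simp_all
          with t \<open>Min (?A j) = l\<close> show False by auto
        qed
        then have small: "comp_min \<alpha> l (K j) \<noteq> l" using Min_A[OF j] by auto
        have mem: "comp_min \<alpha> l (K j) \<in> ?A' j"
          using other[OF small not_l1[OF j]] Min_A[OF j] by simp
        have "comp_min \<alpha>' l (K j) = comp_min \<alpha> l (K j)"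
          unfolding comp_min_def[of \<alpha>']
        proof (rule Min_eqI)
          fix t assume t: "t \<in> ?A' j"
          show "comp_min \<alpha> l (K j) \<le> t"
          proof (cases "t = l - 1")
            case True
            then show ?thesis using Min_A[OF j] small by auto
          next
            case False
            have "t \<noteq> l" using t \<open>l \<notin> ?A' j\<close> by blast
            from other[OF this False] t have "t \<in> ?A j" by (rule iffD1)
            then show ?thesis unfolding comp_min_def by (intro Min_le) simp_all
          qed
        next
          show "comp_min \<alpha> l (K j) \<in> ?A' j" by (rule mem)
        qed simp
        with False show ?thesis by simp
      qed
      have less: "comp_min \<alpha> l (K j) < comp_min \<alpha> l (K k)" if "j \<in> {1..s}" "k \<in> {1..s}" "j < k" for j k
        using ordered that by (simp add: strict_mono_on_def)
      have single: "comp_min \<alpha> l (K j) = l" if "j \<in> {1..s}" "K j = {\<alpha> l}" for j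
        using Min_A[OF that(1)] inj unfolding that(2) by blast
      have ordered': "strict_mono_on {1..s} (\<lambda>j. comp_min \<alpha>' l (K j))"
      proof (rule strict_mono_onI)
        fix j k assume jk: "j \<in> {1..s}" "k \<in> {1..s}" "j < k"
        show "comp_min \<alpha>' l (K j) < comp_min \<alpha>' l (K k)"
        proof (cases "K k = {\<alpha> l}")
          case True
          then show ?thesis
            using comp_min'[OF jk(1)] comp_min'[OF jk(2)] less[OF jk] not_l1[OF jk(1)] single[OF jk(2)]
            by (auto split: if_splits)
        next
          case False
          then show ?thesis
            using comp_min'[OF jk(1)] comp_min'[OF jk(2)] less[OF jk] by (auto split: if_splits)
        qed
      qed
      have ell: "ell_D \<alpha> l s K j = ell K j" if j: "j \<in> {1..s}" for j
      proof -
        have "j = s" if "K j = {\<alpha> l}"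
        proof (rule ccontr)
          assume "j \<noteq> s"
          then have "s \<in> {1..s}" "j < s" using j by auto
          from less[OF j this] Min_A[OF this(1)] single[OF j that] show False by simp
        qed
        then have "(j = s \<and> K s = {\<alpha> l}) = (K j = {\<alpha> l})" by auto
        then show ?thesis
          unfolding ell_D_def ell_def[OF K' ordered'] comp_min'[OF j] by simp
      qed
      have join: "l - 1 \<in> J'" "l \<notin> J'" using vals lI l4 by (auto simp: J'_def)
      have "(\<Sum>j = 1..s. T' (2 * int (l - r) - ell_D \<alpha> l s K j - 1) (ell_D \<alpha> l s K j - 1)) =
          (\<Sum>j = 1..s. T' (2 * int (l - r) - ell K j - 1) (ell K j - 1))"
        using ell by (intro sum.cong) simp_all
      also have "\<dots> = (\<Sum>p\<in>S. T' (2 * int (l - r) - int p - 1) (int p - 1))"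
        by (rule sum_components[OF K' ordered' XA good_all[OF K' ordered' XA join(2)]])
      finally have "real (card (F_sets \<Delta> \<Pi> I)) = real (l - r + 1) / 2 * catalan (l - r) +
          (\<Sum>j = 1..s. T' (2 * int (l - r) - ell_D \<alpha> l s K j - 1) (ell_D \<alpha> l s K j - 1))"
        using card_F_sets_D_one[OF X join] unfolding index'(2,3) D'[symmetric] r[symmetric] by simp
      then show ?thesis using lI by simp
    qed
  qed
  show ?thesis using A B C D_case by blast
qed

end
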